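(* Let $\mathcal{F}$ be a finite family of graphs with $\min_{F\in\mathcal{F}}\chi(F)=r+1\geq 3$, set $t=\max_{F\in\mathcal{F}}|F|$ and $q=q(\mathcal{F})$. Assume that there are $F_1,F_2\in\mathcal{F}$ with $F_1\subseteq tK_2\bigotimes T(t(r-1),r-1)$ and $F_2\subseteq (K_{q-1,t}\cup K_{1,t})\bigotimes T(t(r-1),r-1)$. Then for sufficiently large $n$, every graph $G\in{\rm EX}(n,\mathcal{F})$ has a partition $V(G)=W\cup\bigcup_{1\leq i\leq r}S_i$ such that: (i) $|W|=q-1$ and $|S_i|\in\{\lfloor\frac{n-q+1}{r}\rfloor,\lceil\frac{n-q+1}{r}\rceil\}$ for every $1\leq i\leq r$; (ii) for every $1\leq i\leq r$ there is $S'_i\subseteq S_i$ with $|S_i\setminus S'_i|\leq t^2$ such that $N_G(v)=V(G)\setminus S_i$ for every $v\in S'_i$.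
   Context: All graphs are finite and simple. $F\subseteq G$ means $G$ contains a copy of $F$; $\mathcal{F}$-free means containing no member of $\mathcal{F}$; ${\rm EX}(n,\mathcal{F})$ is the set of $\mathcal{F}$-free $n$-vertex graphs with the maximum number of edges. $\chi$ is chromatic number, $|G|$ the number of vertices, $N_G(v)$ the neighbourhood. $\cup$ is disjoint union, $tH$ is $t$ disjoint copies of $H$, and $\bigotimes$ is the join (disjoint union plus all edges between different factors). $\overline{K_s}$ is the edgeless graph on $s$ vertices, $K_{a,b}$ the complete bipartite graph. $T(n,r)$ is the Turán graph (complete $r$-partite, parts of size $\lfloor n/r\rfloor$ or $\lceil n/r\rceil$), with $T(n,1)=\overline{K_n}$. For such $\mathcal{F}$, $q(\mathcal{F})$ is the minimum integer $s$ such that $F\subseteq\overline{K_s}\bigotimes T(tr,r)$ for some $F\in\mathcal{F}$. *)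

theory Defs
  imports Complex_Main "HOL-Library.Disjoint_Sets"
begin

record 'a graph =
  verts :: "'a set"
  edges :: "'a set set"

definition simple_graph :: "'a graph \<Rightarrow> bool" where
  "simple_graph G \<longleftrightarrow> finite (verts G) \<and> (\<forall>e\<in>edges G. e \<subseteq> verts G \<and> card e = 2)"

definition neighbourhood :: "'a graph \<Rightarrow> 'a \<Rightarrow> 'a set" where
  "neighbourhood G v = {u. {u, v} \<in> edges G}"

(* F \<subseteq>\<^sub>G G: a not necessarily induced copy. The vertex types may differ. *)
definition has_copy :: "'a graph \<Rightarrow> 'b graph \<Rightarrow> bool" (infix "\<subseteq>\<^sub>G" 50) where
  "F \<subseteq>\<^sub>G G \<longleftrightarrow>
     (\<exists>f. inj_on f (verts F) \<and> f ` verts F \<subseteq> verts G \<and> (\<forall>e\<in>edges F. f ` e \<in> edges G))"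

definition family_free :: "'a graph set \<Rightarrow> 'b graph \<Rightarrow> bool" where
  "family_free \<F> G \<longleftrightarrow> (\<forall>F\<in>\<F>. \<not> F \<subseteq>\<^sub>G G)"

definition colourable :: "nat \<Rightarrow> 'a graph \<Rightarrow> bool" where
  "colourable k G \<longleftrightarrow>
     (\<exists>c. c ` verts G \<subseteq> {..<k} \<and> (\<forall>u v. {u, v} \<in> edges G \<longrightarrow> c u \<noteq> c v))"

definition chromatic_number :: "'a graph \<Rightarrow> nat" where
  "chromatic_number G = (LEAST k. colourable k G)"

(* The competitors range over graphs on the same vertex type as G. This loses nothing:
   a type with an n-element set carries every n-vertex graph up to isomorphism. *)
definition extremal_graphs :: "nat \<Rightarrow> 'a graph set \<Rightarrow> 'b graph set" where
  "extremal_graphs n \<F> =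
     {G. simple_graph G \<and> card (verts G) = n \<and> family_free \<F> G \<and>
         (\<forall>H :: 'b graph. simple_graph H \<and> card (verts H) = n \<and> family_free \<F> H \<longrightarrow>
            card (edges H) \<le> card (edges G))}"

definition edgeless_graph :: "nat \<Rightarrow> nat graph" where
  "edgeless_graph n = \<lparr>verts = {..<n}, edges = {}\<rparr>"

definition complete_graph :: "nat \<Rightarrow> nat graph" where
  "complete_graph n = \<lparr>verts = {..<n}, edges = {{i, j} | i j. i < n \<and> j < n \<and> i \<noteq> j}\<rparr>"

(* The parts are the residue classes modulo r in {..<n}, which have size
   \<lfloor>n/r\<rfloor> or \<lceil>n/r\<rceil>; meaningful for r > 0. *)
definition turan_graph :: "nat \<Rightarrow> nat \<Rightarrow> nat graph" where
  "turan_graph n r =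
     \<lparr>verts = {..<n}, edges = {{i, j} | i j. i < n \<and> j < n \<and> i mod r \<noteq> j mod r}\<rparr>"

definition graph_union :: "'a graph \<Rightarrow> 'b graph \<Rightarrow> ('a + 'b) graph" (infixr "\<uplus>\<^sub>G" 65) where
  "G \<uplus>\<^sub>G H =
     \<lparr>verts = verts G <+> verts H,
      edges = (\<lambda>e. Inl ` e) ` edges G \<union> (\<lambda>e. Inr ` e) ` edges H\<rparr>"

definition graph_join :: "'a graph \<Rightarrow> 'b graph \<Rightarrow> ('a + 'b) graph" (infixr "\<otimes>\<^sub>G" 70) where
  "G \<otimes>\<^sub>G H =
     \<lparr>verts = verts (G \<uplus>\<^sub>G H),
      edges = edges (G \<uplus>\<^sub>G H) \<union> {{Inl u, Inr v} | u v. u \<in> verts G \<and> v \<in> verts H}\<rparr>"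

definition graph_copies :: "nat \<Rightarrow> 'a graph \<Rightarrow> (nat \<times> 'a) graph" where
  "graph_copies t H =
     \<lparr>verts = {..<t} \<times> verts H, edges = {Pair i ` e | i e. i < t \<and> e \<in> edges H}\<rparr>"

definition complete_bipartite :: "nat \<Rightarrow> nat \<Rightarrow> (nat + nat) graph" where
  "complete_bipartite a b = edgeless_graph a \<otimes>\<^sub>G edgeless_graph b"

definition family_chi :: "'a graph set \<Rightarrow> nat" where
  "family_chi \<F> = Min (chromatic_number ` \<F>)"

definition family_order :: "'a graph set \<Rightarrow> nat" where
  "family_order \<F> = Max ((\<lambda>F. card (verts F)) ` \<F>)"

(* Always attained for a finite nonempty family with family_chi at least 2: one colour class
   of a member with minimum chromatic number goes into the edgeless factor. *)
definition family_q :: "'a graph set \<Rightarrow> nat" where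
  "family_q \<F> =
     (let r = family_chi \<F> - 1; t = family_order \<F>
      in LEAST s. \<exists>F\<in>\<F>. F \<subseteq>\<^sub>G edgeless_graph s \<otimes>\<^sub>G turan_graph (t * r) r)"

end

theory Submission
  imports Defs
begin

text \<open>
  Let \<open>G\<close> be extremal on \<open>n\<close> vertices. The hypotheses on \<open>F\<^sub>1\<close>, \<open>F\<^sub>2\<close> and \<open>q\<close> forbid three joins in
  \<open>G\<close>, and extremality is used through two competitors only: the complete multipartite graph
  with classes \<open>W, P\<^sub>1, \<dots>, P\<^sub>r\<close>, \<open>|W| = q - 1\<close>, and the graph in which a vertex \<open>u\<close> is given the common
  neighbourhood of \<open>t\<close> other vertices (a copy of a member of the family using \<open>u\<close> misses one of
  these \<open>t\<close> vertices, which can replace \<open>u\<close>).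

  By the Erdos-Stone theorem few vertices have small degree. Classifying the others by
  their adjacency to a fixed complete \<open>r\<close>-partite subgraph gives \<open>r\<close> almost independent classes,
  whose matchings are bounded because of \<open>F\<^sub>1\<close>; the second competitor then forces every
  degree to be at least \<open>(1 - 1/r - o(1)) n\<close>. Repeating the argument leaves \<open>r\<close> independent sets \<open>P\<^sub>i\<close>
  and a set \<open>E\<close> of bounded size. Call \<open>N(v) \<inter> E\<close> the type of \<open>v\<close>. If \<open>T\<^sub>i\<close> is a largest type among those
  of linear frequency in \<open>P\<^sub>i\<close>, then \<open>|\<Inter>T\<^sub>i| \<le> q - 1\<close> by the choice of \<open>q\<close>, and counting edges forces
  \<open>\<Sum>|E - T\<^sub>i| = |E| - (q - 1)\<close>, so the sets \<open>E - T\<^sub>i\<close> and \<open>W = \<Inter>T\<^sub>i\<close> partition \<open>E\<close>. By \<open>F\<^sub>2\<close> all other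
  types are smaller, and comparison with the competitor given by \<open>W\<close> and \<open>S\<^sub>i = P\<^sub>i \<union> (E - T\<^sub>i)\<close> shows
  that all but boundedly many \<open>v \<in> S\<^sub>i\<close> have neighbourhood \<open>V - S\<^sub>i\<close>. The exceptional vertices of \<open>S\<^sub>i\<close> induce
  a graph without isolated vertices, without \<open>t\<close>-matchings and with maximum degree less than
  \<open>t\<close>, hence there are at most \<open>t (t - 1)\<close> of them.
\<close>

section \<open>Common neighbours, blocks and matchings\<close>

text \<open>Erdos-Stone arguments lose o(n^2) edges while the conclusion allows only bounded errors,
  so the accuracy is raised in stages. The leftover set has at first only size at most \<gamma> n.
  It has to become a set \<open>E\<close> of size at most \<open>M\<close>, with \<open>M\<close>
  fixed before \<gamma>, because the argument by types pays a factor 2^M, a bound for the number of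
  types; only then can \<kappa> be chosen from \<open>M\<close> and \<gamma> from \<kappa>. The
  competitor with a set \<open>W\<close> is used twice: with balanced classes it fixes the
  coefficient of n in the edge count, which determines the sizes of the types \<open>T i\<close>;
  with the classes found in \<open>G\<close> itself all terms growing with n cancel, and the number
  of defects becomes bounded. The cloning competitor supplies what global counting cannot see, a
  condition on each single vertex: first the minimum degree, at the end the absence of isolated
  exceptional vertices and class sizes differing by at most 1. Everything up to the last section
  concerns a relation \<open>adj\<close> on a set \<open>V\<close>; passing to a subset only changes
  the second argument of \<open>nbh\<close> and \<open>degsum\<close>, so that no induced subgraphs
  have to be formed.\<close>

definition nbh :: "('b \<Rightarrow> 'b \<Rightarrow> bool) \<Rightarrow> 'b set \<Rightarrow> 'b \<Rightarrow> 'b set" where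
  "nbh adj U v = {u \<in> U. adj v u}"

definition degsum :: "('b \<Rightarrow> 'b \<Rightarrow> bool) \<Rightarrow> 'b set \<Rightarrow> nat" where
  "degsum adj U = (\<Sum>v\<in>U. card (nbh adj U v))"

text \<open>A copy of a complete multipartite graph with parts of equal size \<open>s\<close>, not
  necessarily induced: nothing is said about pairs inside a part. Disjointness of the parts comes
  from irreflexivity of \<open>adj\<close> (\<open>blocks_disjoint\<close>).\<close>

definition blocks :: "('b \<Rightarrow> 'b \<Rightarrow> bool) \<Rightarrow> nat \<Rightarrow> 'i set \<Rightarrow> ('i \<Rightarrow> 'b set) \<Rightarrow> bool" where
  "blocks adj s J B \<longleftrightarrow> (\<forall>i\<in>J. finite (B i) \<and> card (B i) = s) \<and>
     (\<forall>i\<in>J. \<forall>j\<in>J. i \<noteq> j \<longrightarrow> (\<forall>x\<in>B i. \<forall>y\<in>B j. adj x y))"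

definition matching :: "('b \<Rightarrow> 'b \<Rightarrow> bool) \<Rightarrow> 'b set set \<Rightarrow> bool" where
  "matching adj M \<longleftrightarrow> (\<forall>e\<in>M. \<exists>x y. e = {x, y} \<and> adj x y) \<and> pairwise disjnt M"

locale adjacency =
  fixes adj :: "'b \<Rightarrow> 'b \<Rightarrow> bool"
  assumes sym: "adj x y \<Longrightarrow> adj y x"
    and irrefl: "\<not> adj x x"

lemma nbh_subset: "nbh adj U v \<subseteq> U"
  by (auto simp: nbh_def)

lemma finite_nbh [simp]: "finite U \<Longrightarrow> finite (nbh adj U v)"
  by (simp add: nbh_def)

lemma card_nbh_le: "finite U \<Longrightarrow> card (nbh adj U v) \<le> card U"
  by (simp add: card_mono nbh_subset)

lemma card_nbh_Un:
  assumes "finite U" "finite V" "U \<inter> V = {}"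
  shows "card (nbh adj (U \<union> V) v) = card (nbh adj U v) + card (nbh adj V v)"
proof -
  have "nbh adj (U \<union> V) v = nbh adj U v \<union> nbh adj V v" by (auto simp: nbh_def)
  then show ?thesis using assms by (auto simp: nbh_def intro!: card_Un_disjoint)
qed

lemma card_nbh_UN:
  assumes "finite J" "\<And>j. j \<in> J \<Longrightarrow> finite (B j)" "disjoint_family_on B J"
  shows "card (nbh adj (\<Union>j\<in>J. B j) v) = (\<Sum>j\<in>J. card (nbh adj (B j) v))"
proof -
  have "nbh adj (\<Union>j\<in>J. B j) v = (\<Union>j\<in>J. nbh adj (B j) v)" by (auto simp: nbh_def)
  also have "card \<dots> = (\<Sum>j\<in>J. card (nbh adj (B j) v))"
    using assms by (intro card_UN_disjoint) (auto simp: nbh_def disjoint_family_on_def)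
  finally show ?thesis .
qed

lemma card_nbh_compl:
  assumes "finite U"
  shows "card (nbh adj U v) + card {w\<in>U. \<not> adj v w} = card U"
proof -
  have "U = nbh adj U v \<union> {w\<in>U. \<not> adj v w}" by (auto simp: nbh_def)
  moreover have "card (nbh adj U v \<union> {w\<in>U. \<not> adj v w}) = card (nbh adj U v) + card {w\<in>U. \<not> adj v w}"
    using assms by (intro card_Un_disjoint) (auto simp: nbh_def)
  ultimately show ?thesis by simp
qed

text \<open>Union bound over \<open>A\<close>, each member of which spoils at most \<open>m\<close>
  elements of \<open>S\<close>. This is the standard way below to find common neighbours.\<close>

lemma card_common_ge:
  fixes m :: real
  assumes "finite A" "finite S" "\<And>v. v \<in> A \<Longrightarrow> card {w\<in>S. \<not> adj v w} \<le> m"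
  shows "real (card S) \<le> card {w\<in>S. \<forall>v\<in>A. adj v w} + card A * m"
  using assms(1,3)
proof (induction A)
  case empty
  then show ?case by simp
next
  case (insert v A)
  let ?C = "\<lambda>A. {w\<in>S. \<forall>v\<in>A. adj v w}"
  have "?C A \<subseteq> ?C (insert v A) \<union> {w\<in>S. \<not> adj v w}" by auto
  then have "card (?C A) \<le> card (?C (insert v A) \<union> {w\<in>S. \<not> adj v w})"
    using assms(2) by (intro card_mono) auto
  also have "\<dots> \<le> card (?C (insert v A)) + card {w\<in>S. \<not> adj v w}" by (rule card_Un_le)
  finally have "real (card (?C A)) \<le> card (?C (insert v A)) + m"
    using insert.prems[of v] by simp
  moreover have "real (card S) \<le> card (?C A) + card A * m" using insert by simp
  ultimately show ?case using insert.hyps by (simp add: algebra_simps)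
qed

lemma blocks_subset: "blocks adj s J B \<Longrightarrow> I \<subseteq> J \<Longrightarrow> blocks adj s I B"
  unfolding blocks_def by blast

lemma finite_maximizer:
  fixes f :: "'c \<Rightarrow> 'd :: linorder"
  assumes "finite A" "A \<noteq> {}"
  obtains x where "x \<in> A" "\<And>y. y \<in> A \<Longrightarrow> f y \<le> f x"
proof -
  have "Max (f ` A) \<in> f ` A" using assms by (intro Max_in) auto
  then obtain x where "x \<in> A" "f x = Max (f ` A)" by auto
  then show thesis using assms(1) by (intro that[of x]) auto
qed

context adjacency
begin

lemma blocks_insert:
  assumes "blocks adj s J B" "j \<notin> J" "finite A" "card A = s"
    "\<And>i x y. i \<in> J \<Longrightarrow> x \<in> A \<Longrightarrow> y \<in> B i \<Longrightarrow> adj x y"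
  shows "blocks adj s (insert j J) (B(j := A))"
proof -
  have "adj y x" if "i \<in> J" "x \<in> A" "y \<in> B i" for i x y using assms(5)[OF that] by (rule sym)
  then show ?thesis using assms unfolding blocks_def by simp
qed

lemma blocks_disjoint: "blocks adj s J B \<Longrightarrow> disjoint_family_on B J"
  using irrefl unfolding blocks_def disjoint_family_on_def by blast

text \<open>Greedy choice: once \<open>t\<close> vertices are fixed in one class, only their common
  neighbours are kept in the others, at a cost of at most t * m each. The hypothesis on sizes
  reserves one such cost for every index and \<open>t\<close> vertices for the choice
  itself.\<close>

lemma blocks_select:
  fixes m :: real and C :: "'i \<Rightarrow> 'b set"
  assumes "finite J" "m \<ge> 0" "\<And>j. j \<in> J \<Longrightarrow> finite (C j)"
    "\<And>j k v. j \<in> J \<Longrightarrow> k \<in> J \<Longrightarrow> j \<noteq> k \<Longrightarrow> v \<in> C j \<Longrightarrow> card {w\<in>C k. \<not> adj v w} \<le> m"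
    "\<And>j. j \<in> J \<Longrightarrow> card J * (t * m) + t \<le> card (C j)"
  shows "\<exists>A. blocks adj t J A \<and> (\<forall>j\<in>J. A j \<subseteq> C j)"
  using assms(1,3-)
proof (induction J arbitrary: C)
  case empty
  then show ?case by (simp add: blocks_def)
next
  case (insert j J)
  have "real t \<le> card (insert j J) * (t * m) + t" using assms(2) by simp
  also have "\<dots> \<le> card (C j)" using insert.prems(3)[of j] by simp
  finally have "t \<le> card (C j)" by simp
  then obtain A0 where A0: "A0 \<subseteq> C j" "card A0 = t" "finite A0"
    by (meson obtain_subset_with_card_n)
  define C' where "C' k = {w\<in>C k. \<forall>v\<in>A0. adj v w}" for k
  have "\<exists>A. blocks adj t J A \<and> (\<forall>j\<in>J. A j \<subseteq> C' j)"
  proof (rule insert.IH)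
    fix k assume k: "k \<in> J"
    show "finite (C' k)" using insert.prems(1)[of k] k by (simp add: C'_def)
    have "real (card (C k)) \<le> card (C' k) + card A0 * m"
      unfolding C'_def using insert.prems(1)[of k] k A0 insert.hyps
      by (intro card_common_ge insert.prems(2)[of j k]) auto
    with insert.prems(3)[of k] k A0 insert.hyps
    show "card J * (t * m) + t \<le> card (C' k)" by (simp add: algebra_simps)
  next
    fix i k v assume *: "i \<in> J" "k \<in> J" "i \<noteq> k" "v \<in> C' i"
    have "card {w\<in>C' k. \<not> adj v w} \<le> card {w\<in>C k. \<not> adj v w}"
      using insert.prems(1)[of k] * by (intro card_mono) (auto simp: C'_def)
    with insert.prems(2)[of i k v] * show "card {w\<in>C' k. \<not> adj v w} \<le> m"
      by (simp add: C'_def)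
  qed
  then obtain A where A: "blocks adj t J A" "\<forall>j\<in>J. A j \<subseteq> C' j" by blast
  have "blocks adj t (insert j J) (A(j := A0))"
    using A A0 insert.hyps by (intro blocks_insert) (auto simp: C'_def)
  moreover have "\<forall>i\<in>insert j J. (A(j := A0)) i \<subseteq> C i"
    using A A0 by (auto simp: C'_def)
  ultimately show ?case by blast
qed

lemma sum_card_nbh_swap:
  assumes "finite X" "finite Y"
  shows "(\<Sum>x\<in>X. card (nbh adj Y x)) = (\<Sum>y\<in>Y. card (nbh adj X y))"
proof -
  have *: "card (nbh adj U v) = (\<Sum>u\<in>U. if adj v u then 1 else 0)" if "finite U" for U v
    using that by (simp add: nbh_def sum.If_cases Int_def)
  have "(\<Sum>x\<in>X. card (nbh adj Y x)) = (\<Sum>y\<in>Y. \<Sum>x\<in>X. if adj x y then 1 else 0)"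
    using assms by (simp add: * sum.swap[of _ Y])
  also have "\<dots> = (\<Sum>y\<in>Y. \<Sum>x\<in>X. if adj y x then 1 else 0)"
    using sym by (intro sum.cong refl if_cong) blast+
  finally show ?thesis using assms by (simp add: *)
qed

lemma degsum_Un:
  assumes "finite A" "finite B" "A \<inter> B = {}"
  shows "degsum adj (A \<union> B) = degsum adj A + degsum adj B + 2 * (\<Sum>a\<in>A. card (nbh adj B a))"
proof -
  have "degsum adj (A \<union> B) = (\<Sum>a\<in>A. card (nbh adj (A \<union> B) a)) + (\<Sum>b\<in>B. card (nbh adj (A \<union> B) b))"
    unfolding degsum_def using assms by (simp add: sum.union_disjoint)
  also have "\<dots> = degsum adj A + (\<Sum>a\<in>A. card (nbh adj B a)) + ((\<Sum>b\<in>B. card (nbh adj A b)) + degsum adj B)"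
    using assms by (simp add: card_nbh_Un degsum_def sum.distrib)
  also have "(\<Sum>b\<in>B. card (nbh adj A b)) = (\<Sum>a\<in>A. card (nbh adj B a))"
    using assms by (intro sum_card_nbh_swap) auto
  finally show ?thesis by simp
qed

lemma degsum_remove:
  assumes "finite V" "v \<in> V"
  shows "degsum adj V = degsum adj (V - {v}) + 2 * card (nbh adj V v)"
proof -
  have "V = {v} \<union> (V - {v})" using assms by auto
  then have "degsum adj V = degsum adj ({v} \<union> (V - {v}))" by simp
  also have "\<dots> = degsum adj {v} + degsum adj (V - {v}) + 2 * (\<Sum>a\<in>{v}. card (nbh adj (V - {v}) a))"
    using assms by (intro degsum_Un) auto
  also have "degsum adj {v} = 0" using irrefl by (auto simp: degsum_def nbh_def)
  finally have "degsum adj V = degsum adj (V - {v}) + 2 * card (nbh adj (V - {v}) v)" by simp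
  moreover have "nbh adj (V - {v}) v = nbh adj V v" using irrefl by (auto simp: nbh_def)
  ultimately show ?thesis by simp
qed

text \<open>Twice the degree sum over \<open>L\<close> exceeds the actual loss by
  \<open>degsum adj L\<close>, because edges inside \<open>L\<close> are met from both ends; this
  term is dropped.\<close>

lemma degsum_diff_le:
  assumes "finite V" "L \<subseteq> V"
  shows "degsum adj V \<le> degsum adj (V - L) + 2 * (\<Sum>v\<in>L. card (nbh adj V v))"
proof -
  have fin: "finite L" using assms finite_subset by blast
  have V: "V = L \<union> (V - L)" using assms by auto
  then have "degsum adj V = degsum adj (L \<union> (V - L))" by simp
  also have "\<dots> = degsum adj L + degsum adj (V - L) + 2 * (\<Sum>a\<in>L. card (nbh adj (V - L) a))"
    using assms fin by (intro degsum_Un) auto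
  finally have 1: "degsum adj V = degsum adj L + degsum adj (V - L) + 2 * (\<Sum>a\<in>L. card (nbh adj (V - L) a))" .
  have "(\<Sum>v\<in>L. card (nbh adj V v)) = (\<Sum>v\<in>L. card (nbh adj (L \<union> (V - L)) v))" using V by simp
  also have "\<dots> = degsum adj L + (\<Sum>a\<in>L. card (nbh adj (V - L) a))"
    unfolding degsum_def using assms fin by (subst card_nbh_Un) (auto simp: sum.distrib)
  finally show ?thesis using 1 by simp
qed

section \<open>Matchings and the extension of blocks by pigeonhole\<close>

lemma matching_card_Union_le:
  assumes "matching adj M"
  shows "card (\<Union>M) \<le> 2 * card M"
proof -
  have "card e \<le> 2" if e: "e \<in> M" for e
  proof -
    obtain x y where "e = {x, y}" using assms e unfolding matching_def by meson
    then show ?thesis by (simp add: card_insert_if)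
  qed
  then have "sum card M \<le> of_nat (card M) * 2" by (intro sum_bounded_above) auto
  with card_Union_le_sum_card[of M] show ?thesis by simp
qed

lemma matching_between:
  assumes "finite A" "finite B" "card A = t" "card B = t" "\<And>x y. x \<in> A \<Longrightarrow> y \<in> B \<Longrightarrow> adj x y"
  shows "\<exists>M. matching adj M \<and> finite M \<and> card M = t \<and> \<Union>M \<subseteq> A \<union> B"
proof -
  obtain h where h: "bij_betw h A B" using finite_same_card_bij assms(1-4) by metis
  have hB: "h x \<in> B" if "x \<in> A" for x using h that by (auto simp: bij_betw_def)
  have disj: "A \<inter> B = {}" using assms(5) irrefl by blast
  define M where "M = (\<lambda>x. {x, h x}) ` A"
  have inj: "inj_on (\<lambda>x. {x, h x}) A"
  proof (rule inj_onI)
    fix x y assume "x \<in> A" "y \<in> A" "{x, h x} = {y, h y}"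
    then have "x \<in> {y, h y}" "x \<noteq> h y" using hB[of y] disj by auto
    then show "x = y" by simp
  qed
  have "disjnt {x, h x} {y, h y}" if "x \<in> A" "y \<in> A" "x \<noteq> y" for x y
  proof -
    have "h x \<noteq> h y" using h that by (auto simp: bij_betw_def inj_on_def)
    moreover have "x \<noteq> h y" "y \<noteq> h x" using hB disj that by auto
    ultimately show ?thesis using that by (simp add: disjnt_def)
  qed
  then have "pairwise disjnt M" unfolding M_def pairwise_def by (auto simp only: image_iff Ball_def)
  moreover have "\<forall>e\<in>M. \<exists>x y. e = {x, y} \<and> adj x y"
    unfolding M_def using assms(5) hB by (intro ballI, elim imageE) blast
  ultimately have "matching adj M" by (simp add: matching_def)
  moreover have "card M = t" unfolding M_def using inj assms(3) by (simp add: card_image)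
  moreover have "\<Union>M \<subseteq> A \<union> B" using hB by (auto simp: M_def)
  ultimately show ?thesis using assms(1) by (intro exI[of _ M]) (simp add: M_def)
qed

text \<open>The ends of a matching of maximum size meet every edge, since a missed edge could be
  added. If it has fewer than \<open>t\<close> edges, its at most 2t ends form
  \<open>C\<close>.\<close>

lemma matching_or_cover:
  assumes "finite U"
  shows "(\<exists>M. matching adj M \<and> card M = t \<and> finite M \<and> \<Union>M \<subseteq> U) \<or>
         (\<exists>C\<subseteq>U. card C \<le> 2 * t \<and> (\<forall>x\<in>U - C. \<forall>y\<in>U - C. \<not> adj x y))"
proof -
  define MM where "MM = {M. matching adj M \<and> \<Union>M \<subseteq> U}"
  have MM_fin: "finite MM" by (rule finite_subset[of _ "Pow (Pow U)"]) (use assms in \<open>auto simp: MM_def\<close>)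
  have "{} \<in> MM" by (auto simp: MM_def matching_def)
  then obtain M where M: "M \<in> MM" and Mmax: "\<And>M'. M' \<in> MM \<Longrightarrow> card M' \<le> card M"
    using finite_maximizer[OF MM_fin, of card] by blast
  have finM: "finite M" by (rule finite_subset[of _ "Pow U"]) (use M assms in \<open>auto simp: MM_def\<close>)
  have MU: "\<Union>M \<subseteq> U" and mM: "matching adj M" using M by (auto simp: MM_def)
  show ?thesis
  proof (cases "card M \<ge> t")
    case True
    then obtain M' where M': "M' \<subseteq> M" "card M' = t" "finite M'"
      by (meson obtain_subset_with_card_n)
    moreover have "matching adj M'"
      using mM M'(1) unfolding matching_def by (meson pairwise_subset subsetD)
    moreover have "\<Union>M' \<subseteq> U" using M'(1) MU by blast
    ultimately show ?thesis by (intro disjI1 exI[of _ M']) simp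
  next
    case False
    have "card (\<Union>M) \<le> 2 * card M" using matching_card_Union_le[OF mM] .
    with False have "card (\<Union>M) \<le> 2 * t" by simp
    moreover have "\<not> adj x y" if "x \<in> U - \<Union>M" "y \<in> U - \<Union>M" for x y
    proof
      assume a: "adj x y"
      have "disjnt {x, y} e" "disjnt e {x, y}" if "e \<in> M" for e
        using that \<open>x \<in> U - \<Union>M\<close> \<open>y \<in> U - \<Union>M\<close> by (auto simp: disjnt_def)
      then have "pairwise disjnt (insert {x, y} M)"
        using mM by (simp add: matching_def pairwise_insert)
      moreover have "\<exists>x' y'. {x, y} = {x', y'} \<and> adj x' y'" using a by blast
      ultimately have "matching adj (insert {x, y} M)"
        using mM by (simp add: matching_def)
      then have "insert {x,y} M \<in> MM" using that MU by (simp add: MM_def)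
      moreover have "{x, y} \<notin> M" using that by auto
      ultimately show False using Mmax[of "insert {x, y} M"] finM by simp
    qed
    ultimately show ?thesis using MU by (intro disjI2 exI[of _ "\<Union>M"]) simp
  qed
qed

text \<open>The traces of vertices on the union of the blocks take at most 2^(|J| s') values, so
  \<open>s\<close> of the given vertices have the same trace \<open>Z\<close>. As \<open>Z\<close>
  has at least \<open>s\<close> elements in every \<open>B i\<close>, it contains the new blocks.
  This is the inductive step of the Erdos-Stone theorem.\<close>

lemma extend_blocks:
  assumes "finite V" "finite J" "blocks adj s' J B" "\<And>i. i \<in> J \<Longrightarrow> B i \<subseteq> V"
    "card {v\<in>V. \<forall>i\<in>J. s \<le> card (nbh adj (B i) v)} \<ge> s * 2 ^ (card J * s')"
  shows "\<exists>A0 A. A0 \<subseteq> V \<and> finite A0 \<and> card A0 = s \<and> blocks adj s J A \<and> (\<forall>i\<in>J. A i \<subseteq> B i) \<and>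
           (\<forall>x\<in>A0. \<forall>i\<in>J. \<forall>y\<in>A i. adj x y)"
proof -
  define X where "X = {v\<in>V. \<forall>i\<in>J. s \<le> card (nbh adj (B i) v)}"
  define UB where "UB = (\<Union>i\<in>J. B i)"
  have finB: "finite (B i)" "card (B i) = s'" if "i \<in> J" for i
    using assms(3) that by (auto simp: blocks_def)
  have finUB: "finite UB" using finB assms(2) by (simp add: UB_def)
  have "card UB = (\<Sum>i\<in>J. card (B i))" unfolding UB_def using finB assms(2) blocks_disjoint[OF assms(3)]
    by (intro card_UN_disjoint) (auto simp: disjoint_family_on_def)
  then have cUB: "card (Pow UB) = 2 ^ (card J * s')" using finB finUB by (simp add: card_Pow)
  have "\<exists>y\<in>Pow UB. card X \<le> card (nbh adj UB -` {y} \<inter> X) * card (Pow UB)"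
    by (rule pigeonhole_card) (use assms(1) finUB in \<open>auto simp: X_def nbh_def\<close>)
  then obtain Z where Z: "Z \<subseteq> UB" "card X \<le> card (nbh adj UB -` {Z} \<inter> X) * card (Pow UB)" by auto
  have "s * 2 ^ (card J * s') \<le> card (nbh adj UB -` {Z} \<inter> X) * 2 ^ (card J * s')"
    using le_trans[OF assms(5)[folded X_def] Z(2)[unfolded cUB]] .
  then have "s \<le> card (nbh adj UB -` {Z} \<inter> X)" by simp
  then obtain A0 where A0: "A0 \<subseteq> nbh adj UB -` {Z} \<inter> X" "card A0 = s" "finite A0"
    by (meson obtain_subset_with_card_n)
  show ?thesis
  \<comment> \<open>A vertex of \<open>A0\<close> is needed to see that \<open>Z\<close> is large in
    each block; there is none if s = 0.\<close>
  proof (cases "s = 0")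
    case True
    then have "blocks adj s J (\<lambda>_. {})" by (simp add: blocks_def)
    then show ?thesis using True by (intro exI[of _ "{}"] exI[of _ "\<lambda>_. {}"]) auto
  next
    case False
    then obtain x0 where x0: "x0 \<in> A0" using A0 by fastforce
    have "\<exists>Ai. Ai \<subseteq> Z \<inter> B i \<and> card Ai = s \<and> finite Ai" if "i \<in> J" for i
    proof -
      have "nbh adj UB x0 = Z" using x0 A0 by auto
      then have "nbh adj (B i) x0 \<subseteq> Z \<inter> B i" using that by (auto simp: nbh_def UB_def)
      then have "card (nbh adj (B i) x0) \<le> card (Z \<inter> B i)" using finB that by (intro card_mono) auto
      moreover have "s \<le> card (nbh adj (B i) x0)" using x0 A0 that by (auto simp: X_def)
      ultimately have "s \<le> card (Z \<inter> B i)" by simp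
      then show ?thesis by (meson obtain_subset_with_card_n)
    qed
    then obtain A where A: "\<And>i. i \<in> J \<Longrightarrow> A i \<subseteq> Z \<inter> B i \<and> card (A i) = s \<and> finite (A i)" by metis
    have "adj x y" if "i \<in> J" "j \<in> J" "i \<noteq> j" "x \<in> A i" "y \<in> A j" for i j x y
    proof -
      have "x \<in> B i" "y \<in> B j" using that A by blast+
      then show ?thesis using assms(3) that unfolding blocks_def by simp
    qed
    then have "blocks adj s J A" using A by (simp add: blocks_def)
    moreover have "adj x y" if "x \<in> A0" "i \<in> J" "y \<in> A i" for x y i
    proof -
      have "y \<in> Z" using A that by blast
      moreover have "nbh adj UB x = Z" using that A0 by auto
      ultimately show ?thesis by (auto simp: nbh_def)
    qed
    moreover have "A0 \<subseteq> V" using A0(1) unfolding X_def by blast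
    moreover have "\<forall>i\<in>J. A i \<subseteq> B i" using A by simp
    ultimately show ?thesis using A0(2,3) by (intro exI[of _ A0] exI[of _ A]) simp
  qed
qed

text \<open>Take \<open>U\<close> maximizing \<open>degsum adj U - \<alpha> |U|\<^sup>2\<close>: deleting a vertex of smaller degree would increase this.\<close>

lemma min_degree_subset:
  fixes \<alpha> :: real
  assumes "finite V" "0 \<le> \<alpha>" "\<alpha> \<le> 1"
  shows "\<exists>U\<subseteq>V. (\<forall>v\<in>U. card (nbh adj U v) \<ge> \<alpha> * card U - 1) \<and>
           real (degsum adj U) - \<alpha> * (card U)\<^sup>2 \<ge> real (degsum adj V) - \<alpha> * (card V)\<^sup>2"
proof -
  define \<phi> where "\<phi> U = real (degsum adj U) - \<alpha> * (card U)\<^sup>2" for U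
  obtain U where U: "U \<in> Pow V" and Umax: "\<And>U'. U' \<in> Pow V \<Longrightarrow> \<phi> U' \<le> \<phi> U"
    using finite_maximizer[of "Pow V" \<phi>] assms(1) by auto
  have finU: "finite U" using U assms(1) finite_subset by blast
  have "card (nbh adj U v) \<ge> \<alpha> * card U - 1" if v: "v \<in> U" for v
  proof -
    have "\<phi> (U - {v}) \<le> \<phi> U" using U by (intro Umax) auto
    moreover have "degsum adj U = degsum adj (U - {v}) + 2 * card (nbh adj U v)"
      by (rule degsum_remove) (use finU v in auto)
    moreover have "card U > 0" using v finU by (auto simp: card_gt_0_iff)
    then have "real (card (U - {v})) = real (card U) - 1" using v finU by (simp add: of_nat_diff)
    ultimately have "2 * real (card (nbh adj U v)) \<ge> \<alpha> * ((card U)\<^sup>2 - (real (card U) - 1)\<^sup>2)"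
      by (simp add: \<phi>_def algebra_simps)
    also have "(card U)\<^sup>2 - (real (card U) - 1)\<^sup>2 = 2 * real (card U) - 1" by (simp add: power2_eq_square algebra_simps)
    finally have "2 * real (card (nbh adj U v)) \<ge> 2 * (\<alpha> * card U) - \<alpha>" by (simp add: algebra_simps)
    \<comment> \<open>The error \<alpha>/2 is rounded up to 1 by means of \<alpha> \<le> 1.\<close>
    then show ?thesis using assms by linarith
  qed
  moreover have "\<phi> V \<le> \<phi> U" by (rule Umax) simp
  ultimately show ?thesis using U by (auto simp: \<phi>_def)
qed

end

section \<open>Complete multipartite blocks in dense graphs\<close>

lemma (in adjacency) card_nbh_blocks_le:
  assumes "finite J" "blocks adj s' J B" "i \<in> J" "card (nbh adj (B i) v) \<le> s"
  shows "card (nbh adj (\<Union>i\<in>J. B i) v) \<le> (card J - 1) * s' + s"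
proof -
  have finB: "finite (B i)" "card (B i) = s'" if "i \<in> J" for i
    using assms(2) that by (auto simp: blocks_def)
  have "card (nbh adj (\<Union>i\<in>J. B i) v) = (\<Sum>i\<in>J. card (nbh adj (B i) v))"
    using assms(1) finB blocks_disjoint[OF assms(2)] by (intro card_nbh_UN) auto
  also have "\<dots> = card (nbh adj (B i) v) + (\<Sum>i\<in>J - {i}. card (nbh adj (B i) v))"
    using assms(1,3) by (simp add: sum.remove)
  also have "(\<Sum>i\<in>J - {i}. card (nbh adj (B i) v)) \<le> of_nat (card (J - {i})) * s'"
  proof (rule sum_bounded_above)
    fix j assume "j \<in> J - {i}"
    then show "card (nbh adj (B j) v) \<le> s'" using card_nbh_le[of "B j" adj v] finB[of j] by simp
  qed
  finally show ?thesis using assms(3,4) by simp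
qed

text \<open>Double counting of the edges between the blocks and \<open>U\<close>: a vertex outside
  \<open>X\<close> misses nearly a whole block, those in \<open>X\<close> are counted with the
  trivial bound.\<close>

lemma (in adjacency) sum_degrees_blocks_le:
  assumes "finite U" "finite J" "blocks adj s' J B" "X \<subseteq> U"
    "\<And>v. v \<in> U - X \<Longrightarrow> \<exists>i\<in>J. card (nbh adj (B i) v) \<le> s"
  shows "(\<Sum>b\<in>(\<Union>i\<in>J. B i). card (nbh adj U b)) \<le> card X * (card J * s') + card U * ((card J - 1) * s' + s)"
proof -
  define UB where "UB = (\<Union>i\<in>J. B i)"
  have finB: "finite (B i)" "card (B i) = s'" if "i \<in> J" for i
    using assms(3) that by (auto simp: blocks_def)
  have finUB: "finite UB" using finB assms(2) by (simp add: UB_def)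
  have "card UB = (\<Sum>i\<in>J. card (B i))" unfolding UB_def
    using assms(2) finB blocks_disjoint[OF assms(3)]
    by (intro card_UN_disjoint) (auto simp: disjoint_family_on_def)
  then have cUB: "card UB = card J * s'" using finB by simp
  have "(\<Sum>b\<in>UB. card (nbh adj U b)) = (\<Sum>v\<in>U. card (nbh adj UB v))"
    using finUB assms(1) by (intro sum_card_nbh_swap)
  also have "\<dots> = (\<Sum>v\<in>X. card (nbh adj UB v)) + (\<Sum>v\<in>U-X. card (nbh adj UB v))"
    using assms(1,4) by (simp add: sum.subset_diff add.commute)
  also have "(\<Sum>v\<in>X. card (nbh adj UB v)) \<le> of_nat (card X) * (card J * s')"
    using card_nbh_le[OF finUB] cUB by (intro sum_bounded_above) metis
  also have "(\<Sum>v\<in>U-X. card (nbh adj UB v)) \<le> of_nat (card (U - X)) * ((card J - 1) * s' + s)"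
    unfolding UB_def using assms(5) card_nbh_blocks_le[OF assms(2,3)] by (intro sum_bounded_above) blast
  also have "\<dots> \<le> card U * ((card J - 1) * s' + s)"
    using assms(1) by (intro mult_right_mono) (auto intro: card_mono)
  finally show ?thesis by (simp add: UB_def)
qed

text \<open>The Erdos-Stone theorem, with the density hypothesis multiplied by \<open>k\<close> so that \<open>k = 0\<close> can serve as
  the base case of the induction (in HOL, \<open>1 / 0 = 0\<close>).\<close>

theorem erdos_stone:
  fixes \<delta> :: real
  assumes "\<delta> > 0"
  shows "\<exists>N. \<forall>(adj :: 'b \<Rightarrow> 'b \<Rightarrow> bool) V. adjacency adj \<longrightarrow> finite V \<longrightarrow> N \<le> card V \<longrightarrow>
    real k * degsum adj V \<ge> (real k - 1 + \<delta>) * (card V)\<^sup>2 \<longrightarrow>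
    (\<exists>B. blocks adj s {1..k+1} B \<and> (\<forall>i\<in>{1..k+1}. B i \<subseteq> V))"
  using assms
proof (induction k arbitrary: s \<delta>)
  case 0
  show ?case
  proof (intro exI[of _ s] allI impI)
    fix adj :: "'b \<Rightarrow> 'b \<Rightarrow> bool" and V :: "'b set"
    assume "finite V" "s \<le> card V"
    then obtain A where "A \<subseteq> V" "card A = s" "finite A" by (meson obtain_subset_with_card_n)
    moreover have "{1..0+1::nat} = {1}" by auto
    ultimately show "\<exists>B. blocks adj s {1..0+1::nat} B \<and> (\<forall>i\<in>{1..0+1::nat}. B i \<subseteq> V)"
      by (intro exI[of _ "\<lambda>_. A"]) (simp only: blocks_def, simp)
  qed
next
  case (Suc k)
  define K where "K = real k + 1"
  have K: "K \<ge> 1" by (simp add: K_def)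
  \<comment> \<open>Blocks of this size make the gain s' \<delta>/2 per vertex in the final double
    counting exceed the loss \<open>s\<close> by at least 1.\<close>
  define s' where "s' = s + nat \<lceil>2 * (real s + 1) / \<delta>\<rceil>"
  have s': "real s' * \<delta> / 2 \<ge> real s + 1" "s \<le> s'"
  proof -
    have "2 * (real s + 1) / \<delta> \<le> s'" unfolding s'_def by linarith
    then show "real s' * \<delta> / 2 \<ge> real s + 1" using Suc.prems by (simp add: field_simps)
  qed (simp add: s'_def)
  \<comment> \<open>The case \<open>k\<close> is used with surplus 1/K: the density of
    \<open>U\<close> is at least \<alpha>, and k \<alpha> \<ge> k^2/K = k - 1 + 1/K.\<close>
  have "1 / K > 0" using K by simp
  then obtain N0 where N0: "\<forall>(adj :: 'b \<Rightarrow> 'b \<Rightarrow> bool) V. adjacency adj \<longrightarrow> finite V \<longrightarrow> N0 \<le> card V \<longrightarrow>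
    real k * degsum adj V \<ge> (real k - 1 + 1 / K) * (card V)\<^sup>2 \<longrightarrow>
    (\<exists>B. blocks adj s' {1..k+1} B \<and> (\<forall>i\<in>{1..k+1}. B i \<subseteq> V))"
    by (rule exE[OF Suc.IH])
  \<comment> \<open>By \<open>extend_blocks\<close>, this many vertices with \<open>s\<close>
    neighbours in each of the k + 1 blocks would yield the missing block.\<close>
  define P where "P = s * 2 ^ ((k+1) * s')"
  define N1 where "N1 = real N0 + K * s' * (P + 1) + 1"
  \<comment> \<open>Half of the surplus \<delta>/K of density goes into \<alpha>; the other half
    \<open>c\<close> yields |U| \<ge> sqrt c * |V|, so that \<open>U\<close> is large enough for the
    induction hypothesis.\<close>
  define c where "c = \<delta> / (2 * K)"
  have c: "c > 0" using Suc.prems K by (simp add: c_def)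
  define N where "N = nat \<lceil>N1 / sqrt c\<rceil>"
  show ?case
  proof (intro exI[of _ N] allI impI)
    fix adj :: "'b \<Rightarrow> 'b \<Rightarrow> bool" and V :: "'b set"
    assume adj: "adjacency adj" and V: "finite V" "N \<le> card V"
      and D: "real (Suc k) * degsum adj V \<ge> (real (Suc k) - 1 + \<delta>) * (card V)\<^sup>2"
    interpret adjacency adj by (rule adj)
    show "\<exists>B. blocks adj s {1..Suc k+1} B \<and> (\<forall>i\<in>{1..Suc k+1}. B i \<subseteq> V)"
    proof (rule ccontr)
      assume no: "\<nexists>B. blocks adj s {1..Suc k+1} B \<and> (\<forall>i\<in>{1..Suc k+1}. B i \<subseteq> V)"
      define \<alpha> where "\<alpha> = (real k + \<delta>/2) / K"
      have DK: "K * degsum adj V \<ge> (real k + \<delta>) * (card V)\<^sup>2" using D by (simp add: K_def add.commute)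
      have N1V: "N1 \<le> sqrt c * card V"
      proof -
        have "N1 / sqrt c \<le> N" unfolding N_def by linarith
        also have "\<dots> \<le> card V" using V by simp
        finally show ?thesis using c by (simp add: field_simps)
      qed
      have N1: "N1 \<ge> 1" using K by (simp add: N1_def)
      then have Vpos: "card V > 0" using N1V by (cases "card V = 0") auto
      \<comment> \<open>As \<open>degsum adj V\<close> is at most |V|^2, a larger \<delta> would
        contradict the density hypothesis. This provides \<alpha> \<le> 1 for
        \<open>min_degree_subset\<close>.\<close>
      have "(real k + \<delta>) \<le> K"
      proof -
        have "degsum adj V \<le> card V * card V" unfolding degsum_def
          using sum_bounded_above[of V "\<lambda>v. card (nbh adj V v)" "card V"] card_nbh_le[OF V(1)] by simp
        then have "real (degsum adj V) \<le> (card V)\<^sup>2" by (simp add: power2_eq_square flip: of_nat_mult)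
        then have "K * degsum adj V \<le> K * (card V)\<^sup>2" using K by (intro mult_left_mono) auto
        then have "(real k + \<delta>) * (card V)\<^sup>2 \<le> K * (card V)\<^sup>2" using DK by linarith
        then show ?thesis using Vpos by simp
      qed
      then have \<alpha>: "0 \<le> \<alpha>" "\<alpha> \<le> 1" using Suc.prems K by (auto simp: \<alpha>_def field_simps)
      obtain U where U: "U \<subseteq> V" "\<And>v. v \<in> U \<Longrightarrow> card (nbh adj U v) \<ge> \<alpha> * card U - 1"
        "real (degsum adj U) - \<alpha> * (card U)\<^sup>2 \<ge> real (degsum adj V) - \<alpha> * (card V)\<^sup>2"
        using min_degree_subset[OF V(1) \<alpha>] by blast
      have finU: "finite U" using U(1) V(1) finite_subset by blast
      have "real (degsum adj V) \<ge> (real k + \<delta>) / K * (card V)\<^sup>2" using DK K by (simp add: field_simps)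
      then have "real (degsum adj V) - \<alpha> * (card V)\<^sup>2 \<ge> c * (card V)\<^sup>2"
        using K by (simp add: \<alpha>_def c_def field_simps)
      then have DU: "real (degsum adj U) \<ge> \<alpha> * (card U)\<^sup>2 + c * (card V)\<^sup>2" using U(3) by linarith
      have "N1 \<le> card U"
      proof -
        have "degsum adj U \<le> card U * card U" unfolding degsum_def
          using sum_bounded_above[of U "\<lambda>v. card (nbh adj U v)" "card U"] card_nbh_le[OF finU] by simp
        then have "real (degsum adj U) \<le> (real (card U))\<^sup>2"
          by (simp add: power2_eq_square flip: of_nat_mult)
        moreover have "0 \<le> \<alpha> * (card U)\<^sup>2" using \<alpha> by simp
        ultimately have "c * (card V)\<^sup>2 \<le> (real (card U))\<^sup>2" using DU by linarith
        then have "(sqrt c * card V)\<^sup>2 \<le> (real (card U))\<^sup>2" using c by (simp add: power_mult_distrib)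
        then have "sqrt c * card V \<le> card U" by (rule power2_le_imp_le) simp
        then show ?thesis using N1V by linarith
      qed
      moreover have "0 \<le> K * s' * (P + 1)" using K by simp
      ultimately have cU: "N0 \<le> card U" "real (card U) \<ge> K * s' * (P + 1) + 1"
        unfolding N1_def by linarith+
      have "real k * degsum adj U \<ge> (real k - 1 + 1/K) * (card U)\<^sup>2"
      proof -
        have "0 \<le> c * (card V)\<^sup>2" using c by simp
        then have "\<alpha> * (card U)\<^sup>2 \<le> degsum adj U" using DU by linarith
        then have "real k * degsum adj U \<ge> real k * (\<alpha> * (card U)\<^sup>2)"
          by (intro mult_left_mono) auto
        moreover have "real k * \<alpha> \<ge> real k - 1 + 1/K"
          using K Suc.prems unfolding \<alpha>_def by (simp add: field_simps K_def)
        then have "real k * \<alpha> * (card U)\<^sup>2 \<ge> (real k - 1 + 1/K) * (card U)\<^sup>2"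
          by (intro mult_right_mono) auto
        ultimately show ?thesis by (simp add: mult.assoc)
      qed
      from N0[rule_format, OF adj finU cU(1) this] obtain B where
        B: "blocks adj s' {1..k+1} B" "\<And>i. i \<in> {1..k+1} \<Longrightarrow> B i \<subseteq> U" by blast
      define X where "X = {v\<in>U. \<forall>i\<in>{1..k+1}. s \<le> card (nbh adj (B i) v)}"
      have "card X < P"
      proof (rule ccontr)
        assume "\<not> card X < P"
        then obtain A0 A where A: "A0 \<subseteq> U" "finite A0" "card A0 = s" "blocks adj s {1..k+1} A"
          "\<forall>i\<in>{1..k+1}. A i \<subseteq> B i" "\<forall>x\<in>A0. \<forall>i\<in>{1..k+1}. \<forall>y\<in>A i. adj x y"
          using extend_blocks[OF finU _ B(1,2), of s] unfolding X_def P_def by auto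
        have "blocks adj s (insert (k+2) {1..k+1}) (A(k+2 := A0))"
          using A by (intro blocks_insert) auto
        moreover have "insert (k+2) {1..k+1} = {1..Suc k+1}" by auto
        moreover have "\<forall>i\<in>{1..Suc k+1}. (A(k+2 := A0)) i \<subseteq> V"
        proof
          fix i assume i: "i \<in> {1..Suc k+1}"
          show "(A(k+2 := A0)) i \<subseteq> V"
          proof (cases "i = k + 2")
            case True
            then show ?thesis using A(1) U(1) by simp
          next
            case False
            then have "i \<in> {1..k+1}" using i by auto
            then show ?thesis using False A(5) B(2)[of i] U(1) by fastforce
          qed
        qed
        ultimately show False using no by (simp only:) blast
      qed
      \<comment> \<open>Edges between the blocks and \<open>U\<close>: seen from \<open>U\<close>,
        all but fewer than \<open>P\<close> vertices have at most k s' + s neighbours in the blocks;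
        seen from the blocks, every vertex has at least \<alpha> |U| - 1 neighbours. The two counts
        are incompatible for large \<open>U\<close>.\<close>
      have "(\<Sum>b\<in>(\<Union>i\<in>{1..k+1}. B i). card (nbh adj U b))
          \<le> card X * (card {1..k+1} * s') + card U * ((card {1..k+1} - 1) * s' + s)"
        using B(1) finU by (intro sum_degrees_blocks_le) (auto simp: X_def not_le intro: less_imp_le)
      from of_nat_mono[OF this, where 'a = real]
      have up: "real (\<Sum>b\<in>(\<Union>i\<in>{1..k+1}. B i). card (nbh adj U b))
          \<le> card X * (K * s') + card U * (real k * s' + s)"
        by (simp add: K_def algebra_simps)
      have "card (\<Union>i\<in>{1..k+1}. B i) = (\<Sum>i\<in>{1..k+1}. card (B i))"
        using blocks_disjoint[OF B(1)] B(1)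
        by (intro card_UN_disjoint) (auto simp: disjoint_family_on_def blocks_def)
      then have "card (\<Union>i\<in>{1..k+1}. B i) = (k+1) * s'" using B(1) by (simp add: blocks_def)
      then have "real (card (\<Union>i\<in>{1..k+1}. B i)) = K * s'" by (simp add: K_def distrib_right)
      then have "K * s' * (\<alpha> * card U - 1) = (\<Sum>b\<in>(\<Union>i\<in>{1..k+1}. B i). \<alpha> * card U - 1)"
        by simp
      also have "\<dots> \<le> (\<Sum>b\<in>(\<Union>i\<in>{1..k+1}. B i). real (card (nbh adj U b)))"
      proof (rule sum_mono)
        fix b assume "b \<in> (\<Union>i\<in>{1..k+1}. B i)"
        then have "b \<in> U" using B(2) by blast
        then show "\<alpha> * card U - 1 \<le> real (card (nbh adj U b))" by (rule U(2))
      qed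
      finally have "K * s' * (\<alpha> * card U - 1) \<le> card X * (K * s') + card U * (real k * s' + s)"
        using up by simp
      moreover have "K * s' * (\<alpha> * card U - 1) = (real k + \<delta>/2) * s' * card U - K * s'"
      proof -
        have "K * \<alpha> = real k + \<delta>/2" using K by (simp add: \<alpha>_def)
        moreover have "K * s' * (\<alpha> * card U - 1) = (K * \<alpha>) * s' * card U - K * s'"
          by (simp add: right_diff_distrib)
        ultimately show ?thesis by simp
      qed
      moreover have "(real k + \<delta>/2) * s' * card U = card U * (real k * s') + (s' * \<delta> / 2) * card U"
        by (simp add: distrib_right)
      moreover have "card U * (real k * s' + s) = card U * (real k * s') + real s * card U"
        by (simp add: distrib_left)
      ultimately have "(s' * \<delta> / 2) * card U \<le> card X * (K * s') + K * s' + real s * card U"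
        by linarith
      moreover have "(s' * \<delta> / 2) * card U \<ge> (real s + 1) * card U"
        using s' by (intro mult_right_mono) auto
      moreover have "(real s + 1) * card U = real s * card U + card U" by (simp add: distrib_right)
      moreover have "card X * (K * s') + K * s' = (K * s') * (card X + 1)" by (simp add: distrib_left)
      ultimately have "card U \<le> (K * s') * (card X + 1)" by linarith
      also have "\<dots> \<le> (K * s') * (P + 1)" using \<open>card X < P\<close> K by (intro mult_left_mono) auto
      finally show False using cU by simp
    qed
  qed
qed

section \<open>Graphs of large minimum degree\<close>

text \<open>The forbidden graph is the join of t K_2 with a complete (r-1)-partite graph. The index
  set \<open>J\<close> is left open, because the class from which the matching is taken is removed
  from the indices and varies with the application.\<close>

definition no_matching_join :: "('b \<Rightarrow> 'b \<Rightarrow> bool) \<Rightarrow> nat \<Rightarrow> nat \<Rightarrow> 'b set \<Rightarrow> bool" where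
  "no_matching_join adj r t V \<longleftrightarrow> (\<forall>M (J :: nat set) A.
     matching adj M \<longrightarrow> card M = t \<longrightarrow> \<Union>M \<subseteq> V \<longrightarrow> finite J \<longrightarrow> card J = r - 1 \<longrightarrow>
     blocks adj t J A \<longrightarrow> (\<forall>j\<in>J. A j \<subseteq> V) \<longrightarrow> \<not> (\<forall>j\<in>J. \<forall>x\<in>\<Union>M. \<forall>y\<in>A j. adj x y))"

lemma blocks_adj:
  "blocks adj s J B \<Longrightarrow> i \<in> J \<Longrightarrow> j \<in> J \<Longrightarrow> i \<noteq> j \<Longrightarrow> x \<in> B i \<Longrightarrow> y \<in> B j \<Longrightarrow> adj x y"
  unfolding blocks_def by blast

lemma no_matching_joinD:
  fixes J :: "nat set"
  assumes "no_matching_join adj r t V" "matching adj M" "card M = t" "\<Union>M \<subseteq> V" "finite J"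
    "card J = r - 1" "blocks adj t J A" "\<And>j. j \<in> J \<Longrightarrow> A j \<subseteq> V"
    "\<And>j x y. j \<in> J \<Longrightarrow> x \<in> \<Union>M \<Longrightarrow> y \<in> A j \<Longrightarrow> adj x y"
  shows False
proof -
  have A: "\<forall>j\<in>J. A j \<subseteq> V" using assms(8) by blast
  have "\<not> (\<forall>j\<in>J. \<forall>x\<in>\<Union>M. \<forall>y\<in>A j. adj x y)"
    by (rule assms(1)[unfolded no_matching_join_def, THEN spec, THEN spec, THEN spec, THEN mp, THEN mp,
      THEN mp, THEN mp, THEN mp, THEN mp, THEN mp, OF assms(2-7) A])
  then show False using assms(9) by simp
qed

lemma no_matching_join_subset:
  assumes "no_matching_join adj r t V" "U \<subseteq> V"
  shows "no_matching_join adj r t U"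
  unfolding no_matching_join_def
proof (intro allI impI notI)
  fix M :: "'a set set" and J :: "nat set" and A
  assume *: "matching adj M" "card M = t" "\<Union>M \<subseteq> U" "finite J" "card J = r - 1"
    "blocks adj t J A" "\<forall>j\<in>J. A j \<subseteq> U" "\<forall>j\<in>J. \<forall>x\<in>\<Union>M. \<forall>y\<in>A j. adj x y"
  show False
    by (rule no_matching_joinD[OF assms(1) *(1,2) _ *(4,5,6)]) (use * assms(2) in \<open>blast+\<close>)
qed

definition indep :: "('b \<Rightarrow> 'b \<Rightarrow> bool) \<Rightarrow> 'b set \<Rightarrow> bool" where
  "indep adj S \<longleftrightarrow> (\<forall>x\<in>S. \<forall>y\<in>S. \<not> adj x y)"

text \<open>Enough such vertices would give one more block, and between two completely joined sets
  of size \<open>t\<close> there is a \<open>t\<close>-matching; it is joined to the remaining r - 1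
  blocks, contrary to the hypothesis.\<close>

lemma (in adjacency) few_vertices_see_all_blocks:
  assumes "finite V" "2 \<le> r" "no_matching_join adj r t V" "blocks adj s' {1..r} B"
    "\<And>i. i \<in> {1..r} \<Longrightarrow> B i \<subseteq> V"
  shows "card {v\<in>V. \<forall>i\<in>{1..r}. t \<le> card (nbh adj (B i) v)} < t * 2 ^ (r * s')"
proof (rule ccontr)
  assume "\<not> ?thesis"
  then obtain A0 A where A: "A0 \<subseteq> V" "finite A0" "card A0 = t" "blocks adj t {1..r} A"
    "\<forall>i\<in>{1..r}. A i \<subseteq> B i" "\<forall>x\<in>A0. \<forall>i\<in>{1..r}. \<forall>y\<in>A i. adj x y"
    using extend_blocks[OF assms(1) _ assms(4,5), of t] by auto
  have A1: "finite (A i)" "card (A i) = t" "A i \<subseteq> V" if "i \<in> {1..r}" for i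
    using A(4,5) assms(5) that unfolding blocks_def by blast+
  have "1 \<in> {1..r}" using assms(2) by simp
  then obtain M where M: "matching adj M" "finite M" "card M = t" "\<Union>M \<subseteq> A0 \<union> A 1"
    using matching_between[OF A(2) A1(1) A(3) A1(2), of 1] A(6) by blast
  show False
  proof (rule no_matching_joinD[OF assms(3) M(1,3)])
    show "\<Union>M \<subseteq> V" using M(4) A(1) A1(3)[OF \<open>1 \<in> {1..r}\<close>] by blast
    show "blocks adj t {2..r} A" by (rule blocks_subset[OF A(4)]) auto
    show "A j \<subseteq> V" if "j \<in> {2..r}" for j using A1(3) that by simp
    show "adj x y" if "j \<in> {2..r}" "x \<in> \<Union>M" "y \<in> A j" for j x y
    proof -
      have j: "j \<in> {1..r}" "j \<noteq> 1" using that by auto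
      have "x \<in> A0 \<union> A 1" using M(4) that(2) by blast
      then consider "x \<in> A0" | "x \<in> A 1" by blast
      then show ?thesis
      proof cases
        case 1
        then show ?thesis using A(6) j that by blast
      next
        case 2
        then show ?thesis using blocks_adj[OF A(4), of 1 j] j that \<open>1 \<in> {1..r}\<close> by simp
      qed
    qed
  qed auto
qed

text \<open>A vertex goes to class \<open>i\<close> if it has few neighbours in the block \<open>B i\<close> and few non-neighbours in the
  others. Then the ends of a \<open>t\<close>-matching inside a class have \<open>t\<close> common neighbours in every other block.\<close>

lemma (in adjacency) structure_of_blocks:
  fixes \<epsilon> :: real and r t :: nat
  assumes "finite V" "2 \<le> r" "1 \<le> t" "no_matching_join adj r t V" "blocks adj s' {1..r} B"
    "\<And>i. i \<in> {1..r} \<Longrightarrow> B i \<subseteq> V" "4 * t \<le> s'"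
    "\<And>v. v \<in> V \<Longrightarrow> card (nbh adj V v) \<ge> (1 - 1/r - \<epsilon>) * card V"
  shows "\<exists>S. disjoint_family_on S {1..r} \<and> (\<forall>i\<in>{1..r}. S i \<subseteq> V \<and> indep adj (S i)) \<and>
    real (card (V - (\<Union>i\<in>{1..r}. S i))) \<le>
      4 * t * (\<epsilon> * r + t / s') * card V + 8 * t * (t * 2 ^ (r * s')) + 2 * t * r"
proof -
  \<comment> \<open>With the threshold s'/(4t) the at most 2t ends of a matching together miss at
    most half of a block, and at least s'/2 \<ge> t common neighbours remain.\<close>
  define S0 where "S0 i = {v\<in>V. card (nbh adj (B i) v) < t \<and>
     (\<forall>j\<in>{1..r} - {i}. 4 * t * card {b\<in>B j. \<not> adj v b} \<le> s')}" for i
  define P where "P = t * 2 ^ (r * s')"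
  define X where "X = {v\<in>V. \<forall>i\<in>{1..r}. t \<le> card (nbh adj (B i) v)}"
  have cX: "card X < P" unfolding X_def P_def
    using few_vertices_see_all_blocks[OF assms(1,2,4,5,6)] .
  have finB: "finite (B i)" "card (B i) = s'" if "i \<in> {1..r}" for i
    using assms(5) that by (auto simp: blocks_def)
  have s'0: "s' > 0" using assms(3,7) by simp
  have S0V: "S0 i \<subseteq> V" for i by (auto simp: S0_def)
  \<comment> \<open>In \<open>B j\<close> a common element would have fewer than t \<le> s'/4
    neighbours and at most s'/4 non-neighbours.\<close>
  have disj: "S0 i \<inter> S0 j = {}" if "i \<in> {1..r}" "j \<in> {1..r}" "i \<noteq> j" for i j
  proof (rule ccontr)
    assume "S0 i \<inter> S0 j \<noteq> {}"
    then obtain v where v: "v \<in> S0 i" "v \<in> S0 j" by blast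
    have "card (nbh adj (B j) v) < t" "4 * t * card {b\<in>B j. \<not> adj v b} \<le> s'"
      using v that by (auto simp: S0_def)
    moreover have "card (nbh adj (B j) v) + card {b\<in>B j. \<not> adj v b} = s'"
      using card_nbh_compl[of "B j"] finB[OF that(2)] by simp
    moreover have "card {b\<in>B j. \<not> adj v b} \<le> t * card {b\<in>B j. \<not> adj v b}" using assms(3) by simp
    ultimately show False using assms(3,7) by linarith
  qed
  have "\<exists>C\<subseteq>S0 i. card C \<le> 2 * t \<and> (\<forall>x\<in>S0 i - C. \<forall>y\<in>S0 i - C. \<not> adj x y)" if i: "i \<in> {1..r}" for i
  proof (rule ccontr)
    assume "\<not> ?thesis"
    moreover have "finite (S0 i)" using S0V assms(1) finite_subset by blast
    ultimately obtain M where M: "matching adj M" "card M = t" "finite M" "\<Union>M \<subseteq> S0 i"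
      using matching_or_cover[of "S0 i" t] by blast
    have fM: "finite (\<Union>M)" using M(4) \<open>finite (S0 i)\<close> finite_subset by blast
    have cM: "card (\<Union>M) \<le> 2 * t" using matching_card_Union_le[OF M(1)] M(2) by simp
    have "\<exists>Aj. Aj \<subseteq> {b\<in>B j. \<forall>x\<in>\<Union>M. adj x b} \<and> card Aj = t \<and> finite Aj" if j: "j \<in> {1..r} - {i}" for j
    proof -
      have "real (card (B j)) \<le> card {b\<in>B j. \<forall>x\<in>\<Union>M. adj x b} + card (\<Union>M) * (s' / (4 * t))"
      proof (rule card_common_ge[OF fM])
        show "finite (B j)" using finB j by simp
        fix x assume "x \<in> \<Union>M"
        then have "4 * t * card {b\<in>B j. \<not> adj x b} \<le> s'" using M(4) j by (auto simp: S0_def)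
        then have "real (4 * t * card {b\<in>B j. \<not> adj x b}) \<le> s'" by (rule of_nat_mono)
        then show "real (card {b\<in>B j. \<not> adj x b}) \<le> s' / (4 * t)" using assms(3) by (simp add: field_simps)
      qed
      also have "card (\<Union>M) * (s' / (4 * t)) \<le> real (2 * t) * (s' / (4 * t))"
        using cM by (intro mult_right_mono) (auto simp del: of_nat_mult)
      also have "\<dots> = s' / 2" using assms(3) by simp
      finally have "t \<le> card {b\<in>B j. \<forall>x\<in>\<Union>M. adj x b}" using assms(7) finB j by simp
      then show ?thesis by (meson obtain_subset_with_card_n)
    qed
    then obtain A where A: "\<And>j. j \<in> {1..r} - {i} \<Longrightarrow> A j \<subseteq> {b\<in>B j. \<forall>x\<in>\<Union>M. adj x b} \<and> card (A j) = t \<and> finite (A j)"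
      using bchoice[of "{1..r} - {i}" "\<lambda>j Aj. Aj \<subseteq> {b\<in>B j. \<forall>x\<in>\<Union>M. adj x b} \<and> card Aj = t \<and> finite Aj"]
      by meson
    show False
    proof (rule no_matching_joinD[OF assms(4) M(1,2)])
      show "\<Union>M \<subseteq> V" using M(4) S0V by blast
      show "card ({1..r} - {i}) = r - 1" using i by simp
      have "adj x y" if "j \<in> {1..r} - {i}" "k \<in> {1..r} - {i}" "j \<noteq> k" "x \<in> A j" "y \<in> A k" for j k x y
      proof -
        have "x \<in> B j" "y \<in> B k" using A that by blast+
        then show ?thesis using blocks_adj[OF assms(5), of j k] that by simp
      qed
      then show "blocks adj t ({1..r} - {i}) A" using A by (simp add: blocks_def)
      show "A j \<subseteq> V" if "j \<in> {1..r} - {i}" for j using A[OF that] assms(6)[of j] that by blast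
      show "adj x y" if "j \<in> {1..r} - {i}" "x \<in> \<Union>M" "y \<in> A j" for j x y
        using A[OF that(1)] that(2,3) by blast
    qed auto
  qed
  then obtain C where C: "\<And>i. i \<in> {1..r} \<Longrightarrow> C i \<subseteq> S0 i \<and> card (C i) \<le> 2 * t \<and>
      (\<forall>x\<in>S0 i - C i. \<forall>y\<in>S0 i - C i. \<not> adj x y)" by metis
  define S where "S i = S0 i - C i" for i
  define Bad where "Bad = V - (\<Union>i\<in>{1..r}. S0 i)"
  define UB where "UB = (\<Union>i\<in>{1..r}. B i)"
  have finUB: "finite UB" using finB by (simp add: UB_def)
  have UBV: "UB \<subseteq> V" unfolding UB_def using assms(6) by (rule UN_least)
  have disjB: "disjoint_family_on B {1..r}" by (rule blocks_disjoint[OF assms(5)])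
  have "card UB = (\<Sum>i\<in>{1..r}. card (B i))" unfolding UB_def
    using finB disjB by (intro card_UN_disjoint) (auto simp: disjoint_family_on_def)
  then have cUB: "card UB = r * s'" using finB by simp
  have cnb: "card (nbh adj UB v) = (\<Sum>i\<in>{1..r}. card (nbh adj (B i) v))" for v
    unfolding UB_def using finB disjB by (intro card_nbh_UN) auto
  have cB: "card (nbh adj (B j) v) + card {b\<in>B j. \<not> adj v b} = s'" if "j \<in> {1..r}" for j v
    using card_nbh_compl[of "B j"] finB[OF that] by simp
  \<comment> \<open>Outside \<open>X\<close> some block contributes fewer than \<open>t\<close>
    neighbours, and a bad vertex also misses more than s'/(4t) vertices of another block. The
    allowance 2s' for \<open>X\<close> is generous enough for vertices lying in both
    \<open>X\<close> and \<open>Bad\<close>.\<close>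
  have key: "real (card (nbh adj UB v)) \<le> (real r - 1) * s' + t + (if v \<in> X then 2 * real s' else 0)
      - (if v \<in> Bad then s' / (4 * t) else 0)" if v: "v \<in> V" for v
  proof (cases "v \<in> X")
    case True
    have "card (nbh adj UB v) \<le> r * s'" using card_nbh_le[OF finUB, of adj v] cUB by simp
    then have "real (card (nbh adj UB v)) \<le> real r * s'" by (metis of_nat_le_iff of_nat_mult)
    moreover have "s' / (4 * t) \<le> real s'"
      using divide_left_mono[of 1 "4 * real t" "real s'"] assms(3) by simp
    moreover have "(real r - 1) * s' = real r * s' - s'" by (simp add: left_diff_distrib)
    ultimately show ?thesis using True by auto
  next
    case False
    then obtain i where i: "i \<in> {1..r}" "card (nbh adj (B i) v) < t" using v by (auto simp: X_def not_le)
    have sum1: "card (nbh adj UB v) = card (nbh adj (B i) v) + (\<Sum>j\<in>{1..r}-{i}. card (nbh adj (B j) v))"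
      unfolding cnb using i by (simp add: sum.remove)
    show ?thesis
    proof (cases "v \<in> Bad")
      case True
      then have "v \<notin> S0 i" using i by (auto simp: Bad_def)
      then have "\<not> (\<forall>j\<in>{1..r} - {i}. 4 * t * card {b\<in>B j. \<not> adj v b} \<le> s')"
        using v i(2) unfolding S0_def by blast
      then obtain j where j: "j \<in> {1..r} - {i}" "4 * t * card {b\<in>B j. \<not> adj v b} > s'"
        by (meson not_le)
      have "real s' < real (4 * t * card {b\<in>B j. \<not> adj v b})" using j(2) by (rule of_nat_less_iff[THEN iffD2])
      then have "real (card {b\<in>B j. \<not> adj v b}) > s' / (4 * t)" using assms(3) by (simp add: field_simps)
      then have nj: "real (card (nbh adj (B j) v)) \<le> s' - s' / (4 * t)" using cB[of j v] j by simp
      have "(\<Sum>j\<in>{1..r}-{i}. card (nbh adj (B j) v)) = card (nbh adj (B j) v) + (\<Sum>j\<in>{1..r}-{i}-{j}. card (nbh adj (B j) v))"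
        using j by (simp add: sum.remove)
      also have "(\<Sum>j\<in>{1..r}-{i}-{j}. card (nbh adj (B j) v)) \<le> of_nat (card ({1..r}-{i}-{j})) * s'"
        using cB by (intro sum_bounded_above) (metis DiffD1 le_add1)
      also have "card ({1..r}-{i}-{j}) = r - 2" using i j by simp
      finally have "card (nbh adj UB v) \<le> t + card (nbh adj (B j) v) + (r - 2) * s'" using sum1 i(2) by simp
      then have "real (card (nbh adj UB v)) \<le> real (t + card (nbh adj (B j) v) + (r - 2) * s')" by (rule of_nat_mono)
      also have "\<dots> = t + card (nbh adj (B j) v) + (real r - 2) * s'" using assms(2) by (simp add: of_nat_diff)
      finally have "real (card (nbh adj UB v)) \<le> t + card (nbh adj (B j) v) + (real r - 2) * s'" .
      moreover have "(real r - 2) * s' = real r * s' - 2 * s'" "(real r - 1) * s' = real r * s' - s'"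
        by (simp_all add: left_diff_distrib)
      ultimately have "real (card (nbh adj UB v)) \<le> (real r - 1) * s' + t - s' / (4 * t)" using nj by linarith
      then show ?thesis using True False by simp
    next
      case nb: False
      have "(\<Sum>j\<in>{1..r}-{i}. card (nbh adj (B j) v)) \<le> of_nat (card ({1..r}-{i})) * s'"
        using cB by (intro sum_bounded_above) (metis DiffD1 le_add1)
      also have "card ({1..r}-{i}) = r - 1" using i by simp
      finally have "card (nbh adj UB v) \<le> t + (r - 1) * s'" using sum1 i(2) by simp
      then have "real (card (nbh adj UB v)) \<le> real (t + (r - 1) * s')" by (rule of_nat_mono)
      also have "\<dots> = t + (real r - 1) * s'" using assms(2) by (simp add: of_nat_diff)
      finally show ?thesis using nb False by simp
    qed
  qed
  have BadV: "Bad \<subseteq> V" and XV: "X \<subseteq> V" by (auto simp: Bad_def X_def)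
  define n where "n = real (card V)"
  \<comment> \<open>Double counting between \<open>UB\<close> and \<open>V\<close>: the minimum
    degree forces the average in \<open>key\<close> to be nearly (r - 1) s', which leaves little
    room for bad vertices.\<close>
  have "real (r * s') * ((1 - 1/r - \<epsilon>) * n) = (\<Sum>b\<in>UB. (1 - 1/r - \<epsilon>) * n)" using cUB by simp
  also have "\<dots> \<le> (\<Sum>b\<in>UB. real (card (nbh adj V b)))"
    unfolding n_def using UBV by (intro sum_mono assms(8)) auto
  also have "\<dots> = (\<Sum>v\<in>V. real (card (nbh adj UB v)))"
    using sum_card_nbh_swap[OF finUB assms(1)] by (metis (no_types) of_nat_sum)
  also have "\<dots> \<le> (\<Sum>v\<in>V. (real r - 1) * s' + t + (if v \<in> X then 2 * real s' else 0)
      - (if v \<in> Bad then s' / (4 * t) else 0))" by (intro sum_mono key)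
  also have "\<dots> = n * ((real r - 1) * s' + t) + card X * (2 * real s') - card Bad * (s' / (4 * t))"
    using assms(1) BadV XV by (simp add: sum.distrib sum_subtractf n_def sum.If_cases Int_absorb1)
  finally have 1: "real (r * s') * ((1 - 1/r - \<epsilon>) * n) \<le>
      n * ((real r - 1) * s' + t) + card X * (2 * real s') - card Bad * (s' / (4 * t))" .
  have "real (r * s') * ((1 - 1/r - \<epsilon>) * n) = n * ((real r - 1) * s') - \<epsilon> * r * s' * n"
    using assms(2) by (simp add: field_simps)
  with 1 have "card Bad * (s' / (4 * t)) \<le> n * t + \<epsilon> * r * s' * n + card X * (2 * real s')"
    by (simp add: distrib_left)
  also have "\<dots> \<le> n * t + \<epsilon> * r * s' * n + P * (2 * real s')"
    using cX by (intro add_left_mono mult_right_mono) auto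
  finally have "card Bad * (s' / (4 * t)) * (4 * t / s') \<le> (n * t + \<epsilon> * r * s' * n + P * (2 * real s')) * (4 * t / s')"
    by (intro mult_right_mono) auto
  then have Bad_le: "real (card Bad) \<le> 4 * t * (\<epsilon> * r + t / s') * n + 8 * t * P"
    using s'0 assms(3) by (simp add: field_simps)
  have "V - (\<Union>i\<in>{1..r}. S i) \<subseteq> Bad \<union> (\<Union>i\<in>{1..r}. C i)" by (auto simp: Bad_def S_def)
  moreover have finC: "finite (C i)" if "i \<in> {1..r}" for i
    using C[OF that] S0V assms(1) by (meson finite_subset)
  moreover have "finite Bad" using BadV assms(1) finite_subset by blast
  ultimately have "card (V - (\<Union>i\<in>{1..r}. S i)) \<le> card (Bad \<union> (\<Union>i\<in>{1..r}. C i))"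
    by (intro card_mono) auto
  also have "\<dots> \<le> card Bad + card (\<Union>i\<in>{1..r}. C i)" by (rule card_Un_le)
  also have "card (\<Union>i\<in>{1..r}. C i) \<le> (\<Sum>i\<in>{1..r}. card (C i))" by (rule card_UN_le) simp
  also have "\<dots> \<le> of_nat (card {1..r}) * (2 * t)" using C by (intro sum_bounded_above) blast
  finally have "card (V - (\<Union>i\<in>{1..r}. S i)) \<le> card Bad + r * (2 * t)" by simp
  from of_nat_mono[OF this, where 'a = real]
  have "real (card (V - (\<Union>i\<in>{1..r}. S i))) \<le>
      4 * t * (\<epsilon> * r + t / s') * card V + 8 * t * (t * 2 ^ (r * s')) + 2 * t * r"
    using Bad_le by (simp add: n_def P_def mult_ac)
  moreover have "disjoint_family_on S {1..r}" using disj unfolding disjoint_family_on_def S_def by blast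
  moreover have "\<forall>i\<in>{1..r}. S i \<subseteq> V \<and> indep adj (S i)"
    using C S0V unfolding S_def indep_def by blast
  ultimately show ?thesis by (intro exI[of _ S] conjI)
qed

text \<open>A vertex of an independent class has all its neighbours outside it, so the degree bound
  limits each class from above. Since the classes nearly fill \<open>V\<close>, each is then bounded
  from below, and the missing edges are the difference between the room outside the class and the
  degree.\<close>

lemma (in adjacency) parts_properties:
  fixes \<epsilon> \<gamma> :: real and r :: nat
  assumes "finite V" "disjoint_family_on S {1..r}" "\<And>i. i \<in> {1..r} \<Longrightarrow> S i \<subseteq> V"
    "\<And>i. i \<in> {1..r} \<Longrightarrow> indep adj (S i)" "real (card (V - (\<Union>i\<in>{1..r}. S i))) \<le> \<gamma> * card V"
    "\<And>v. v \<in> V \<Longrightarrow> card (nbh adj V v) \<ge> (1 - 1/r - \<epsilon>) * card V" "0 \<le> \<epsilon>" "i \<in> {1..r}"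
  shows "card (S i) \<le> (1/r + \<epsilon>) * card V"
    and "card (S i) \<ge> (1/r - \<gamma> - r * \<epsilon>) * card V"
    and "v \<in> S i \<Longrightarrow> card {w\<in>V - S i. \<not> adj v w} \<le> (\<gamma> + (r + 1) * \<epsilon>) * card V"
proof -
  define n where "n = real (card V)"
  have r: "real r > 0" using assms(8) by auto
  have finS: "finite (S j)" if "j \<in> {1..r}" for j using assms(1,3) that finite_subset by blast
  have deg: "real (card (V - S j)) - card {w\<in>V - S j. \<not> adj v w} \<ge> (1 - 1/r - \<epsilon>) * n"
    if "j \<in> {1..r}" "v \<in> S j" for j v
  proof -
    have "nbh adj V v = nbh adj (V - S j) v"
      using assms(4)[OF that(1)] that(2) by (auto simp: nbh_def indep_def)
    then have "(1 - 1/r - \<epsilon>) * n \<le> card (nbh adj (V - S j) v)"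
      using assms(6)[of v] assms(3)[OF that(1)] that(2) by (auto simp: n_def)
    then show ?thesis using card_nbh_compl[of "V - S j" adj v] assms(1) by simp
  qed
  have cV: "real (card (V - S j)) = n - card (S j)" if "j \<in> {1..r}" for j
    using assms(1) assms(3)[OF that] finS[OF that]
    by (simp add: card_Diff_subset n_def card_mono of_nat_diff)
  have up: "card (S j) \<le> (1/r + \<epsilon>) * n" if j: "j \<in> {1..r}" for j
  proof (cases "S j = {}")
    case True
    then show ?thesis using assms(7) by (simp add: n_def)
  next
    case False
    then obtain v where v: "v \<in> S j" by blast
    have "(1 - 1/r - \<epsilon>) * n = n - (1/r + \<epsilon>) * n" by (simp add: left_diff_distrib distrib_right)
    then show ?thesis using deg[OF j v] cV[OF j] by linarith
  qed
  then show "card (S i) \<le> (1/r + \<epsilon>) * card V" using assms(8) by (simp add: n_def)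
  have "V = (V - (\<Union>i\<in>{1..r}. S i)) \<union> (\<Union>i\<in>{1..r}. S i)" using assms(3) by blast
  then have "card V \<le> card (V - (\<Union>i\<in>{1..r}. S i)) + card (\<Union>i\<in>{1..r}. S i)" by (metis card_Un_le)
  also have "card (\<Union>i\<in>{1..r}. S i) \<le> (\<Sum>j\<in>{1..r}. card (S j))" by (rule card_UN_le) simp
  also have "\<dots> = card (S i) + (\<Sum>j\<in>{1..r}-{i}. card (S j))" using assms(8) by (simp add: sum.remove)
  finally have "card V \<le> card (V - (\<Union>i\<in>{1..r}. S i)) + (card (S i) + (\<Sum>j\<in>{1..r}-{i}. card (S j)))" by simp
  from of_nat_mono[OF this, where 'a = real]
  have "n \<le> \<gamma> * n + card (S i) + (\<Sum>j\<in>{1..r}-{i}. real (card (S j)))" using assms(5) by (simp add: n_def)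
  also have "(\<Sum>j\<in>{1..r}-{i}. real (card (S j))) \<le> of_nat (card ({1..r}-{i})) * ((1/r + \<epsilon>) * n)"
    using up by (intro sum_bounded_above) auto
  also have "of_nat (card ({1..r}-{i})) = real r - 1" using assms(8) by (simp add: of_nat_diff)
  finally have "n \<le> \<gamma> * n + card (S i) + (real r - 1) * ((1/r + \<epsilon>) * n)" by simp
  moreover have "(real r - 1) * ((1/r + \<epsilon>) * n) = n - (1/r - r * \<epsilon>) * n - \<epsilon> * n" using r by (simp add: field_simps)
  moreover have "0 \<le> \<epsilon> * n" using assms(7) by (simp add: n_def)
  ultimately have low: "card (S i) \<ge> (1/r - \<gamma> - r * \<epsilon>) * n" by (simp add: left_diff_distrib)
  then show "card (S i) \<ge> (1/r - \<gamma> - r * \<epsilon>) * card V" by (simp add: n_def)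
  show "card {w\<in>V - S i. \<not> adj v w} \<le> (\<gamma> + (r + 1) * \<epsilon>) * card V" if "v \<in> S i"
  proof -
    have "real (card {w\<in>V - S i. \<not> adj v w}) \<le> n - (1/r - \<gamma> - r * \<epsilon>) * n - (1 - 1/r - \<epsilon>) * n"
      using deg[OF assms(8) that] cV[OF assms(8)] low by linarith
    also have "\<dots> = (\<gamma> + (r + 1) * \<epsilon>) * card V" by (simp add: algebra_simps n_def)
    finally show ?thesis .
  qed
qed

text \<open>Erdos-Stone with k = r - 1 supplies the blocks for \<open>structure_of_blocks\<close>:
  (r - 1)(1 - 1/r) = r - 2 + 1/r, and the loss (r - 1) \<epsilon> takes up at most half of the
  surplus 1/r.\<close>

theorem min_degree_structure:
  fixes \<gamma> :: real and r t :: nat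
  assumes "2 \<le> r" "1 \<le> t" "\<gamma> > 0"
  shows "\<exists>\<epsilon>>0. \<exists>N. \<forall>(adj :: 'b \<Rightarrow> 'b \<Rightarrow> bool) V. adjacency adj \<longrightarrow> finite V \<longrightarrow> N \<le> card V \<longrightarrow>
    no_matching_join adj r t V \<longrightarrow> (\<forall>v\<in>V. card (nbh adj V v) \<ge> (1 - 1/r - \<epsilon>) * card V) \<longrightarrow>
    (\<exists>S. disjoint_family_on S {1..r} \<and> (\<forall>i\<in>{1..r}. S i \<subseteq> V \<and> indep adj (S i)) \<and>
      real (card (V - (\<Union>i\<in>{1..r}. S i))) \<le> \<gamma> * card V)"
proof -
  \<comment> \<open>The first bound secures the density for Erdos-Stone; the second bound and the
    choice of \<open>s'\<close> make each of the two linear error terms of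
    \<open>structure_of_blocks\<close> at most \<gamma>/4.\<close>
  define \<epsilon> where "\<epsilon> = min (1 / (2 * real r * r)) (\<gamma> / (16 * t * r))"
  have \<epsilon>: "\<epsilon> > 0" "\<epsilon> \<le> 1 / (2 * real r * r)" "4 * t * (\<epsilon> * r) \<le> \<gamma> / 4"
  proof -
    show "\<epsilon> > 0" "\<epsilon> \<le> 1 / (2 * real r * r)" using assms by (auto simp: \<epsilon>_def)
    have "\<epsilon> \<le> \<gamma> / (16 * t * r)" by (simp add: \<epsilon>_def)
    then show "4 * t * (\<epsilon> * r) \<le> \<gamma> / 4" using assms by (simp add: field_simps)
  qed
  define s' where "s' = 4 * t + nat \<lceil>16 * t * t / \<gamma>\<rceil>"
  have s': "4 * t \<le> s'" "4 * t * (t / s') \<le> \<gamma> / 4"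
  proof -
    have "16 * t * t / \<gamma> \<le> s'" unfolding s'_def by linarith
    moreover have "s' > 0" using assms by (simp add: s'_def)
    ultimately show "4 * t * (t / s') \<le> \<gamma> / 4" using assms by (simp add: field_simps)
  qed (simp add: s'_def)
  have "1 / (2 * real r) > 0" using assms by simp
  then obtain N0 where N0: "\<forall>(adj :: 'b \<Rightarrow> 'b \<Rightarrow> bool) V. adjacency adj \<longrightarrow> finite V \<longrightarrow> N0 \<le> card V \<longrightarrow>
    real (r - 1) * degsum adj V \<ge> (real (r - 1) - 1 + 1 / (2 * real r)) * (card V)\<^sup>2 \<longrightarrow>
    (\<exists>B. blocks adj s' {1..r - 1 + 1} B \<and> (\<forall>i\<in>{1..r - 1 + 1}. B i \<subseteq> V))"
    by (rule exE[OF erdos_stone])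
  define Q where "Q = real (8 * t * (t * 2 ^ (r * s'))) + real (2 * t * r)"
  define N where "N = N0 + nat \<lceil>2 * Q / \<gamma>\<rceil>"
  show ?thesis
  proof (intro exI[of _ \<epsilon>] conjI exI[of _ N] allI impI)
    show "\<epsilon> > 0" by (rule \<epsilon>)
    fix adj :: "'b \<Rightarrow> 'b \<Rightarrow> bool" and V :: "'b set"
    assume adj: "adjacency adj" and V: "finite V" "N \<le> card V" and P1: "no_matching_join adj r t V"
      and deg: "\<forall>v\<in>V. card (nbh adj V v) \<ge> (1 - 1/r - \<epsilon>) * card V"
    interpret adjacency adj by (rule adj)
    have NQ: "2 * Q / \<gamma> \<le> card V"
    proof -
      have "2 * Q / \<gamma> \<le> N" unfolding N_def by linarith
      then show ?thesis using V(2) by linarith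
    qed
    have N0V: "N0 \<le> card V" using V(2) by (simp add: N_def)
    have "real (degsum adj V) \<ge> (\<Sum>v\<in>V. (1 - 1/r - \<epsilon>) * card V)"
      unfolding degsum_def of_nat_sum using deg by (intro sum_mono) auto
    then have D: "real (degsum adj V) \<ge> (1 - 1/r - \<epsilon>) * (card V)\<^sup>2"
      by (simp add: power2_eq_square mult_ac)
    have "real (r - 1) * ((1 - 1/r - \<epsilon>) * (card V)\<^sup>2) \<le> real (r - 1) * degsum adj V"
      using D by (intro mult_left_mono) auto
    moreover have "real (r - 1) * (1 - 1/r - \<epsilon>) \<ge> real (r - 1) - 1 + 1 / (2 * real r)"
    proof -
      have rr: "real (r - 1) = real r - 1" using assms by (simp add: of_nat_diff)
      have "(real r - 1) * \<epsilon> \<le> real r * (1 / (2 * real r * r))"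
        using \<epsilon> assms by (intro mult_mono) auto
      moreover have "real r * (1 / (2 * real r * r)) = 1 / (2 * real r)" using assms by simp
      moreover have "(real r - 1) * (1 - 1/r - \<epsilon>) = real r - 2 + 1/r - (real r - 1) * \<epsilon>"
        using assms by (simp add: field_simps)
      moreover have "1 / real r = 1 / (2 * real r) + 1 / (2 * real r)" by (simp add: field_simps)
      ultimately show ?thesis unfolding rr by linarith
    qed
    then have "real (r - 1) * (1 - 1/r - \<epsilon>) * (card V)\<^sup>2 \<ge> (real (r - 1) - 1 + 1 / (2 * real r)) * (card V)\<^sup>2"
      by (intro mult_right_mono) auto
    ultimately have "real (r - 1) * degsum adj V \<ge> (real (r - 1) - 1 + 1 / (2 * real r)) * (card V)\<^sup>2"
      by (simp only: mult.assoc)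
    from N0[rule_format, OF adj V(1) N0V this] assms(1) obtain B where
      B: "blocks adj s' {1..r} B" "\<And>i. i \<in> {1..r} \<Longrightarrow> B i \<subseteq> V" by auto
    from structure_of_blocks[OF V(1) assms(1,2) P1 B s'(1), of \<epsilon>] deg obtain S where
      S: "disjoint_family_on S {1..r}" "\<forall>i\<in>{1..r}. S i \<subseteq> V \<and> indep adj (S i)"
      "real (card (V - (\<Union>i\<in>{1..r}. S i))) \<le>
        4 * t * (\<epsilon> * r + t / s') * card V + 8 * t * (t * 2 ^ (r * s')) + 2 * t * r" by blast
    have "4 * t * (\<epsilon> * r + t / s') * card V \<le> (\<gamma> / 2) * card V"
      using \<epsilon>(3) s'(2) by (intro mult_right_mono) (simp_all add: distrib_left)
    moreover have "Q \<le> (\<gamma> / 2) * card V" using NQ assms(3) by (simp add: field_simps)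
    moreover have "\<gamma> * card V = (\<gamma> / 2) * card V + (\<gamma> / 2) * card V" by simp
    ultimately have "real (card (V - (\<Union>i\<in>{1..r}. S i))) \<le> \<gamma> * card V"
      using S(3) unfolding Q_def by linarith
    then show "\<exists>S. disjoint_family_on S {1..r} \<and> (\<forall>i\<in>{1..r}. S i \<subseteq> V \<and> indep adj (S i)) \<and>
      real (card (V - (\<Union>i\<in>{1..r}. S i))) \<le> \<gamma> * card V" using S(1,2) by blast
  qed
qed

section \<open>Extremal configurations\<close>

text \<open>The combinatorial content of extremality: \<open>no_matching\<close> and \<open>no_star\<close> come from the members \<open>F\<^sub>1\<close> and
  \<open>F\<^sub>2\<close>, \<open>no_independent\<close> from the definition of \<open>q\<close>, and the last two assumptions from the two
  competitors. As \<open>degsum\<close> counts every edge twice, \<open>partition_bound\<close> is stated for twice the number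
  of edges, with the squares moved to the right.\<close>

locale extremal_config = adjacency adj for adj :: "'b \<Rightarrow> 'b \<Rightarrow> bool" +
  fixes V :: "'b set" and r t q :: nat
  assumes finV: "finite V" and r2: "2 \<le> r" and t1: "1 \<le> t" and q1: "1 \<le> q"
    and no_matching: "no_matching_join adj r t V"
    and no_star: "\<And>Q A0 y B0 (J :: nat set) A. Q \<subseteq> V \<Longrightarrow> card Q = q - 1 \<Longrightarrow> A0 \<subseteq> V \<Longrightarrow> card A0 = t \<Longrightarrow>
      y \<in> V \<Longrightarrow> B0 \<subseteq> V \<Longrightarrow> card B0 = t \<Longrightarrow> A0 \<inter> B0 = {} \<Longrightarrow> y \<notin> Q \<Longrightarrow> y \<notin> A0 \<Longrightarrow> Q \<inter> B0 = {} \<Longrightarrow>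
      (\<And>x a. x \<in> Q \<Longrightarrow> a \<in> A0 \<Longrightarrow> adj x a) \<Longrightarrow> (\<And>b. b \<in> B0 \<Longrightarrow> adj y b) \<Longrightarrow>
      finite J \<Longrightarrow> card J = r - 1 \<Longrightarrow> blocks adj t J A \<Longrightarrow> (\<And>j. j \<in> J \<Longrightarrow> A j \<subseteq> V) \<Longrightarrow>
      (\<And>j a x. j \<in> J \<Longrightarrow> a \<in> A j \<Longrightarrow> x \<in> Q \<union> A0 \<union> {y} \<union> B0 \<Longrightarrow> adj x a) \<Longrightarrow> False"
    and no_independent: "\<And>Q (J :: nat set) A. Q \<subseteq> V \<Longrightarrow> card Q = q \<Longrightarrow> finite J \<Longrightarrow> card J = r \<Longrightarrow>
      blocks adj t J A \<Longrightarrow> (\<And>j. j \<in> J \<Longrightarrow> A j \<subseteq> V) \<Longrightarrow>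
      (\<And>j a x. j \<in> J \<Longrightarrow> a \<in> A j \<Longrightarrow> x \<in> Q \<Longrightarrow> adj x a) \<Longrightarrow> False"
    and partition_bound: "\<And>W P. W \<subseteq> V \<Longrightarrow> card W = q - 1 \<Longrightarrow> disjoint_family_on P {1..r} \<Longrightarrow>
      (\<Union>i\<in>{1..r}. P i) = V - W \<Longrightarrow>
      2 * (q - 1) * card (V - W) + (card (V - W))\<^sup>2 \<le> degsum adj V + (\<Sum>i\<in>{1..r}. (card (P i))\<^sup>2)"
    and clone_bound: "\<And>u T. u \<in> V \<Longrightarrow> T \<subseteq> V - {u} \<Longrightarrow> card T = t \<Longrightarrow>
      card {w\<in>V - {u}. \<forall>v\<in>T. adj v w} \<le> card (nbh adj V u)"

lemma real_card_Diff:
  assumes "finite U" "S \<subseteq> U"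
  shows "real (card (U - S)) = real (card U) - card S"
  using card_Diff_subset[OF finite_subset[OF assms(2,1)] assms(2)] card_mono[OF assms] by (simp add: of_nat_diff)

lemma partition_with_sizes:
  assumes "finite J" "finite U" "(\<Sum>j\<in>J. a j) = card U"
  shows "\<exists>P. disjoint_family_on P J \<and> (\<Union>j\<in>J. P j) = U \<and> (\<forall>j\<in>J. card (P j) = a j)"
  using assms
proof (induction J arbitrary: U)
  case empty
  then show ?case by (simp add: disjoint_family_on_def)
next
  case (insert j J)
  then have "a j \<le> card U" by simp
  then obtain A where A: "A \<subseteq> U" "card A = a j" "finite A" by (meson obtain_subset_with_card_n)
  have "(\<Sum>j\<in>J. a j) = card (U - A)" using insert A by (simp add: card_Diff_subset)
  then obtain P where P: "disjoint_family_on P J" "(\<Union>j\<in>J. P j) = U - A" "\<forall>j\<in>J. card (P j) = a j"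
    using insert.IH[of "U - A"] insert.prems by auto
  have same: "\<forall>i\<in>J. (P(j := A)) i = P i" using insert.hyps by auto
  have "disjoint_family_on (P(j := A)) (insert j J)"
    unfolding disjoint_family_on_def
  proof (intro ballI impI)
    fix m n assume mn: "m \<in> insert j J" "n \<in> insert j J" "m \<noteq> n"
    have sub: "P i \<inter> A = {}" if "i \<in> J" for i using P(2) that by blast
    show "(P(j := A)) m \<inter> (P(j := A)) n = {}"
      using mn sub[of m] sub[of n] P(1) unfolding disjoint_family_on_def
      by (cases "m = j"; cases "n = j") (simp_all add: Int_commute)
  qed
  moreover have "(\<Union>i\<in>insert j J. (P(j := A)) i) = U"
  proof -
    have "(\<Union>i\<in>J. (P(j := A)) i) = U - A" using same P(2) by simp
    moreover have "(\<Union>i\<in>insert j J. (P(j := A)) i) = A \<union> (\<Union>i\<in>J. (P(j := A)) i)" by simp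
    ultimately show ?thesis using A(1) by blast
  qed
  moreover have "\<forall>i\<in>insert j J. card ((P(j := A)) i) = a i" using A P(3) same by auto
  ultimately show ?case by (intro exI[of _ "P(j := A)"] conjI)
qed

context extremal_config
begin

text \<open>\<open>partition_bound\<close> for a nearly balanced partition. The class sizes deviate
  from the mean by at most \<open>r\<close> and the deviations add up to 0, so the sum of squares
  exceeds N^2/r by at most r^3.\<close>

lemma degsum_lower:
  assumes "q - 1 \<le> card V"
  shows "real (degsum adj V) \<ge> (1 - 1/r) * (card V)\<^sup>2 + 2 * (real q - 1) * card V / r - (2 * real q ^ 2 + real r ^ 3)"
proof -
  obtain W where W: "W \<subseteq> V" "card W = q - 1" using assms by (meson obtain_subset_with_card_n)
  define N where "N = card (V - W)"
  have finW: "finite W" using W(1) finV finite_subset by blast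
  have NV: "real N = real (card V) - (real q - 1)"
    using W finW assms q1 by (simp add: N_def card_Diff_subset of_nat_diff)
  \<comment> \<open>The first class takes the whole remainder; an imbalance bounded in terms of
    \<open>r\<close> is harmless.\<close>
  define a where "a j = (if j = 1 then N div r + N mod r else N div r)" for j :: nat
  have "(\<Sum>j\<in>{1..r}. a j) = a 1 + (\<Sum>j\<in>{1..r}-{1}. a j)" using r2 by (intro sum.remove) auto
  also have "(\<Sum>j\<in>{1..r}-{1}. a j) = (r - 1) * (N div r)" using r2 by (simp add: a_def card_Diff_singleton)
  also have "a 1 + (r - 1) * (N div r) = r * (N div r) + N mod r" using r2 by (cases r) (auto simp: a_def)
  finally have suma: "(\<Sum>j\<in>{1..r}. a j) = N" by simp
  obtain P where P: "disjoint_family_on P {1..r}" "(\<Union>j\<in>{1..r}. P j) = V - W" "\<forall>j\<in>{1..r}. card (P j) = a j"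
    using partition_with_sizes[of "{1..r}" "V - W" a] suma finV by (auto simp: N_def)
  have "2 * (q - 1) * N + N\<^sup>2 \<le> degsum adj V + (\<Sum>i\<in>{1..r}. (a i)\<^sup>2)"
    using partition_bound[OF W P(1,2)] P(3) by (simp add: N_def)
  from of_nat_mono[OF this, where 'a = real]
  have 1: "2 * (real q - 1) * N + (real N)\<^sup>2 \<le> degsum adj V + (\<Sum>i\<in>{1..r}. (real (a i))\<^sup>2)"
    using q1 by (simp add: of_nat_diff)
  define e where "e i = real (a i) - N / r" for i
  have rpos: "real r > 0" using r2 by simp
  have Nr: "real N = real r * real (N div r) + real (N mod r)"
    by (metis mult_div_mod_eq of_nat_add of_nat_mult)
  then have div: "real (N div r) = N / r - (N mod r) / r"
    using rpos by (simp add: field_simps)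
  have md: "real (N mod r) \<le> r" using r2 by (simp add: less_imp_le)
  then have md1: "(N mod r) / real r \<le> 1" "(N mod r) / real r \<ge> 0" using rpos by simp_all
  have md2: "(N mod r) / real r \<le> N mod r"
    using r2 divide_left_mono[of 1 "real r" "real (N mod r)"] by simp
  have e: "\<bar>e i\<bar> \<le> r" for i
  proof (cases "i = 1")
    case True
    then have "e i = real (N mod r) - (N mod r) / r" using div by (simp add: e_def a_def)
    then show ?thesis using md md1 md2 unfolding abs_le_iff by linarith
  next
    case False
    then have "e i = - ((N mod r) / r)" using div by (simp add: e_def a_def)
    then show ?thesis using md1 r2 unfolding abs_le_iff by linarith
  qed
  have "(\<Sum>i\<in>{1..r}. e i) = real (\<Sum>i\<in>{1..r}. a i) - N" using rpos by (simp add: e_def sum_subtractf)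
  then have sume: "(\<Sum>i\<in>{1..r}. e i) = 0" using suma by (simp only:)
  have "(\<Sum>i\<in>{1..r}. (real (a i))\<^sup>2) = (\<Sum>i\<in>{1..r}. (N/r)\<^sup>2 + 2 * (N/r) * e i + (e i)\<^sup>2)"
  proof (rule sum.cong[OF refl])
    fix i
    have "real (a i) = N/r + e i" by (simp add: e_def)
    then show "(real (a i))\<^sup>2 = (N/r)\<^sup>2 + 2 * (N/r) * e i + (e i)\<^sup>2" by (simp add: power2_sum)
  qed
  also have "\<dots> = r * (N/r)\<^sup>2 + 2 * (N/r) * (\<Sum>i\<in>{1..r}. e i) + (\<Sum>i\<in>{1..r}. (e i)\<^sup>2)"
    by (simp add: sum.distrib sum_distrib_left)
  also have "(\<Sum>i\<in>{1..r}. (e i)\<^sup>2) \<le> of_nat (card {1..r}) * (real r)\<^sup>2"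
    using e by (intro sum_bounded_above) (metis abs_le_square_iff abs_of_nat)
  finally have "(\<Sum>i\<in>{1..r}. (real (a i))\<^sup>2) \<le> (real N)\<^sup>2 / r + real r ^ 3"
    using sume rpos by (simp add: power2_eq_square power3_eq_cube)
  with 1 have 2: "real (degsum adj V) \<ge> 2 * (real q - 1) * N + (1 - 1/r) * (real N)\<^sup>2 - real r ^ 3"
    by (simp add: left_diff_distrib)
  define n p where "n = real (card V)" and "p = real q - 1"
  have p: "0 \<le> p" "p \<le> real q" using q1 by (auto simp: p_def)
  \<comment> \<open>Rewriting N = n - p in terms of n costs at most 2p^2, whence the term
    2q^2.\<close>
  have "2 * p * (n - p) + (1 - 1/r) * (n - p)\<^sup>2 = (1 - 1/r) * n\<^sup>2 + 2 * p * n / r - 2 * p\<^sup>2 + (1 - 1/r) * p\<^sup>2"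
    by (simp add: power2_eq_square algebra_simps)
  moreover have "(1 - 1/r) * p\<^sup>2 \<ge> 0" using r2 by simp
  moreover have "p\<^sup>2 \<le> (real q)\<^sup>2" using p by (intro power_mono) auto
  ultimately have "2 * p * (n - p) + (1 - 1/r) * (n - p)\<^sup>2 \<ge> (1 - 1/r) * n\<^sup>2 + 2 * p * n / r - 2 * (real q)\<^sup>2"
    by linarith
  then show ?thesis using 2 NV by (simp add: n_def p_def)
qed

text \<open>Two of the blocks contain a \<open>t\<close>-matching, which is joined to the other r -
  1.\<close>

lemma no_blocks: "\<not> (blocks adj t {1..r+1} A \<and> (\<forall>i\<in>{1..r+1}. A i \<subseteq> V))"
proof
  assume A: "blocks adj t {1..r+1} A \<and> (\<forall>i\<in>{1..r+1}. A i \<subseteq> V)"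
  have A1: "finite (A i)" "card (A i) = t" "A i \<subseteq> V" if "i \<in> {1..r+1}" for i
    using A that unfolding blocks_def by blast+
  have in1: "1 \<in> {1..r+1}" "r + 1 \<in> {1..r+1}" "1 \<noteq> r + 1" using r2 by auto
  have "adj x y" if "x \<in> A 1" "y \<in> A (r+1)" for x y
    using blocks_adj[of adj t "{1..r+1}" A 1 "r+1"] A in1 that by blast
  then obtain M where M: "matching adj M" "finite M" "card M = t" "\<Union>M \<subseteq> A 1 \<union> A (r+1)"
    using matching_between[of "A 1" "A (r+1)" t] A1[OF in1(1)] A1[OF in1(2)] by blast
  show False
  proof (rule no_matching_joinD[OF no_matching M(1,3)])
    show "\<Union>M \<subseteq> V" using M(4) A1(3)[OF in1(1)] A1(3)[OF in1(2)] by blast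
    show "blocks adj t {2..r} A" by (rule blocks_subset[OF conjunct1[OF A]]) auto
    show "A j \<subseteq> V" if "j \<in> {2..r}" for j using A1(3) that by simp
    show "adj x y" if "j \<in> {2..r}" "x \<in> \<Union>M" "y \<in> A j" for j x y
    proof -
      have j: "j \<in> {1..r+1}" "j \<noteq> 1" "j \<noteq> r + 1" using that by auto
      have "x \<in> A 1 \<union> A (r+1)" using M(4) that(2) by blast
      then show ?thesis
        using blocks_adj[OF conjunct1[OF A] in1(1) j(1) _ _ that(3)]
          blocks_adj[OF conjunct1[OF A] in1(2) j(1) _ _ that(3)] j by auto
    qed
  qed auto
qed

end

text \<open>The vertices of low degree are deleted first, because
  \<open>min_degree_structure\<close> requires all degrees to be large; cloning then bounds the
  degree of every vertex \<open>u\<close>, deleted or not, from below by the number of common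
  neighbours of \<open>t\<close> vertices in one class.\<close>

theorem extremal_min_degree:
  fixes \<epsilon> :: real and r t q :: nat
  assumes "2 \<le> r" "1 \<le> t" "1 \<le> q" "\<epsilon> > 0"
  shows "\<exists>N. \<forall>(adj :: 'b \<Rightarrow> 'b \<Rightarrow> bool) V. extremal_config adj V r t q \<longrightarrow> N \<le> card V \<longrightarrow>
    (\<forall>v\<in>V. card (nbh adj V v) \<ge> (1 - 1/r - \<epsilon>) * card V)"
proof -
  define \<gamma> where "\<gamma> = min (\<epsilon> / (8 * t)) (1 / (4 * r))"
  have \<gamma>: "\<gamma> > 0" "t * \<gamma> \<le> \<epsilon> / 8" "\<gamma> \<le> 1 / (4 * r)"
  proof -
    show "\<gamma> > 0" "\<gamma> \<le> 1 / (4 * r)" using assms by (auto simp: \<gamma>_def)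
    have "\<gamma> \<le> \<epsilon> / (8 * t)" by (simp add: \<gamma>_def)
    then show "t * \<gamma> \<le> \<epsilon> / 8" using assms by (simp add: field_simps)
  qed
  obtain \<epsilon>5 N5 where \<epsilon>5: "\<epsilon>5 > 0" and N5: "\<forall>(adj :: 'b \<Rightarrow> 'b \<Rightarrow> bool) V. adjacency adj \<longrightarrow> finite V \<longrightarrow> N5 \<le> card V \<longrightarrow>
    no_matching_join adj r t V \<longrightarrow> (\<forall>v\<in>V. card (nbh adj V v) \<ge> (1 - 1/r - \<epsilon>5) * card V) \<longrightarrow>
    (\<exists>S. disjoint_family_on S {1..r} \<and> (\<forall>i\<in>{1..r}. S i \<subseteq> V \<and> indep adj (S i)) \<and>
      real (card (V - (\<Union>i\<in>{1..r}. S i))) \<le> \<gamma> * card V)"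
    using min_degree_structure[OF assms(1,2) \<gamma>(1), where 'b = 'b] by (elim exE conjE) (rule that)
  \<comment> \<open>The entries in order: degrees drop by 2\<epsilon>1 on passing to
    \<open>U\<close>; the non-neighbours of \<open>t\<close> vertices of a class; three direct
    losses of \<epsilon>1 n in the last estimate; linear size of class 1; |U| \<ge> n/2.\<close>
  define \<epsilon>1 where "\<epsilon>1 = Min {\<epsilon>5 / 2, \<epsilon> / (16 * t * (r + 1)), \<epsilon> / 24, 1 / (8 * real r * r), 1 / 2}"
  have \<epsilon>1: "\<epsilon>1 > 0" "2 * \<epsilon>1 \<le> \<epsilon>5" "\<epsilon>1 \<le> \<epsilon> / (16 * t * (r + 1))" "3 * \<epsilon>1 \<le> \<epsilon> / 8"
    "\<epsilon>1 \<le> 1 / (8 * real r * r)" "\<epsilon>1 \<le> 1 / 2"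
  proof -
    have "real t > 0" using assms by simp
    then show "\<epsilon>1 > 0" using assms \<epsilon>5 by (simp add: \<epsilon>1_def add_pos_nonneg)
    have "\<epsilon>1 \<le> x" if "x \<in> {\<epsilon>5 / 2, \<epsilon> / (16 * t * (r + 1)), \<epsilon> / 24, 1 / (8 * real r * r), 1 / 2}" for x
      unfolding \<epsilon>1_def using that by (intro Min_le) auto
    from this[of "\<epsilon>5 / 2"] this[of "\<epsilon> / (16 * t * (r + 1))"] this[of "\<epsilon> / 24"] this[of "1 / (8 * real r * r)"] this[of "1/2"]
    show "2 * \<epsilon>1 \<le> \<epsilon>5" "\<epsilon>1 \<le> \<epsilon> / (16 * t * (r + 1))" "3 * \<epsilon>1 \<le> \<epsilon> / 8"
      "\<epsilon>1 \<le> 1 / (8 * real r * r)" "\<epsilon>1 \<le> 1 / 2" by simp_all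
  qed
  have "\<epsilon>1\<^sup>2 / 2 > 0" using \<epsilon>1 by simp
  then obtain N0 where N0: "\<forall>(adj :: 'b \<Rightarrow> 'b \<Rightarrow> bool) V. adjacency adj \<longrightarrow> finite V \<longrightarrow> N0 \<le> card V \<longrightarrow>
    real r * degsum adj V \<ge> (real r - 1 + \<epsilon>1\<^sup>2 / 2) * (card V)\<^sup>2 \<longrightarrow>
    (\<exists>B. blocks adj t {1..r + 1} B \<and> (\<forall>i\<in>{1..r + 1}. B i \<subseteq> V))"
    by (rule exE[OF erdos_stone])
  define C where "C = 2 * real q ^ 2 + real r ^ 3"
  have C: "C \<ge> 0" by (simp add: C_def)
  define N where "N = 2 * N5 + 4 * N0 + q + 4 * r * (t + 1) + 4 + nat \<lceil>(2 * C + 4) / \<epsilon>1\<^sup>2\<rceil> + nat \<lceil>2 / \<epsilon>\<rceil>"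
  show ?thesis
  proof (intro exI[of _ N] allI impI ballI)
    fix adj :: "'b \<Rightarrow> 'b \<Rightarrow> bool" and V :: "'b set" and u
    assume conf: "extremal_config adj V r t q" and NV: "N \<le> card V" and u: "u \<in> V"
    interpret extremal_config adj V r t q by (rule conf)
    have adj: "adjacency adj" by unfold_locales
    define n where "n = real (card V)"
    define a where "a = 1 - 1 / real r"
    have a: "0 \<le> a" "a \<le> 1" using r2 by (auto simp: a_def)
    have "real N \<le> n" using NV by (simp add: n_def)
    moreover have "(2 * C + 4) / \<epsilon>1\<^sup>2 \<le> N" "2 / \<epsilon> \<le> N" unfolding N_def by linarith+
    ultimately have n: "(2 * C + 4) / \<epsilon>1\<^sup>2 \<le> n" "2 / \<epsilon> \<le> n" by linarith+
    have n': "2 * N5 \<le> card V" "4 * N0 \<le> card V" "q \<le> card V" "4 * r * (t + 1) \<le> card V" "4 \<le> card V"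
      using NV unfolding N_def by linarith+
    have n1: "n \<ge> 4" using n'(5) by (simp add: n_def)
    define L where "L = {v\<in>V. card (nbh adj V v) < (1 - 1/r - \<epsilon>1) * card V}"
    have LV: "L \<subseteq> V" by (auto simp: L_def)
    \<comment> \<open>Deleting about \<epsilon>1 n vertices of low degree removes fewer edges than
      the Turan density accounts for, so the density of the rest would rise by about \<epsilon>1^2,
      and Erdos-Stone would give the r + 1 blocks excluded by \<open>no_blocks\<close>.\<close>
    have "card L \<le> \<epsilon>1 * n"
    proof (rule ccontr)
      assume big: "\<not> card L \<le> \<epsilon>1 * n"
      define l where "l = nat \<lceil>\<epsilon>1 * n\<rceil>"
      have l: "\<epsilon>1 * n \<le> l" "l \<le> \<epsilon>1 * n + 1"
        using \<epsilon>1 n1 unfolding l_def by (auto simp: of_nat_ceiling)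
      have "l \<le> card L" using big unfolding l_def by linarith
      then obtain L' where L': "L' \<subseteq> L" "card L' = l" "finite L'" by (meson obtain_subset_with_card_n)
      have L'V: "L' \<subseteq> V" using L' LV by blast
      have cU: "real (card (V - L')) = n - l"
        using L'V L' finV by (simp add: card_Diff_subset n_def card_mono of_nat_diff flip: L'(2))
      have "\<epsilon>1 * n \<le> n / 2" using \<epsilon>1(6) n1 mult_right_mono[of \<epsilon>1 "1/2" n] by simp
      then have "n - l \<ge> n / 4" using l n1 by linarith
      then have "N0 \<le> card (V - L')" using cU n'(2) unfolding n_def by linarith
      moreover have "\<not> (\<exists>B. blocks adj t {1..r + 1} B \<and> (\<forall>i\<in>{1..r + 1}. B i \<subseteq> V - L'))"
        using no_blocks by blast
      ultimately have "\<not> real r * degsum adj (V - L') \<ge> (real r - 1 + \<epsilon>1\<^sup>2 / 2) * (card (V - L'))\<^sup>2"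
        using N0[rule_format, OF adj, of "V - L'"] finV by blast
      then have "real r * degsum adj (V - L') \<le> (real r - 1 + \<epsilon>1\<^sup>2 / 2) * (n - l)\<^sup>2" using cU by simp
      then have "real (degsum adj (V - L')) \<le> (real r - 1 + \<epsilon>1\<^sup>2 / 2) / r * (n - l)\<^sup>2" using r2 by (simp add: field_simps)
      also have "(real r - 1 + \<epsilon>1\<^sup>2 / 2) / r = a + (\<epsilon>1\<^sup>2 / 2) / r" using r2 by (simp add: a_def field_simps)
      also have "(a + (\<epsilon>1\<^sup>2 / 2) / r) * (n - l)\<^sup>2 = a * (n - l)\<^sup>2 + (\<epsilon>1\<^sup>2 / 2) / r * (n - l)\<^sup>2" by (simp add: distrib_right)
      also have "(\<epsilon>1\<^sup>2 / 2) / r * (n - l)\<^sup>2 \<le> (\<epsilon>1\<^sup>2 / 2) * n\<^sup>2"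
      proof (intro mult_mono)
        show "\<epsilon>1\<^sup>2 / 2 / real r \<le> \<epsilon>1\<^sup>2 / 2" using r2 divide_left_mono[of 1 "real r" "\<epsilon>1\<^sup>2 / 2"] by simp
        show "(n - l)\<^sup>2 \<le> n\<^sup>2" using \<open>n - l \<ge> n / 4\<close> n1 by (intro power_mono) auto
      qed auto
      finally have DU: "real (degsum adj (V - L')) \<le> a * (n - l)\<^sup>2 + (\<epsilon>1\<^sup>2 / 2) * n\<^sup>2" by simp
      have "(\<Sum>v\<in>L'. real (card (nbh adj V v))) \<le> of_nat (card L') * ((a - \<epsilon>1) * n)"
        using L'(1) by (intro sum_bounded_above) (auto simp: L_def a_def n_def)
      moreover have "real (degsum adj V) \<le> degsum adj (V - L') + 2 * (\<Sum>v\<in>L'. real (card (nbh adj V v)))"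
        using of_nat_mono[OF degsum_diff_le[OF finV L'V], where 'a = real] by simp
      ultimately have "real (degsum adj V) \<le> a * (n - l)\<^sup>2 + (\<epsilon>1\<^sup>2 / 2) * n\<^sup>2 + 2 * (l * ((a - \<epsilon>1) * n))"
        using DU L'(2) by simp
      moreover have "real (degsum adj V) \<ge> a * n\<^sup>2 - C"
      proof -
        have "2 * (real q - 1) * card V / r \<ge> 0" using q1 by simp
        moreover have "q - 1 \<le> card V" using n'(3) by simp
        ultimately show ?thesis using degsum_lower unfolding a_def n_def C_def of_nat_power by linarith
      qed
      ultimately have "a * n\<^sup>2 - C \<le> a * (n - l)\<^sup>2 + (\<epsilon>1\<^sup>2 / 2) * n\<^sup>2 + 2 * (l * ((a - \<epsilon>1) * n))" by linarith
      moreover have "a * (n - l)\<^sup>2 + 2 * (l * ((a - \<epsilon>1) * n)) = a * n\<^sup>2 + a * (real l)\<^sup>2 - l * (2 * (\<epsilon>1 * n))"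
        by (simp add: power2_eq_square algebra_simps)
      moreover have "a * (real l)\<^sup>2 \<le> l * real l" using a mult_right_mono[of a 1 "(real l)\<^sup>2"] by (simp add: power2_eq_square)
      moreover have "l * (2 * (\<epsilon>1 * n)) - l * real l = l * (2 * (\<epsilon>1 * n) - l)" by (simp add: right_diff_distrib)
      \<comment> \<open>The quadratic l (2x - l) is largest at l = x, where x = \<epsilon>1 n;
        rounding up to an integer loses at most x.\<close>
      moreover have "l * (2 * (\<epsilon>1 * n) - l) \<ge> (\<epsilon>1 * n) * (\<epsilon>1 * n - 1)"
      proof -
        have "l * (2 * (\<epsilon>1 * n) - l) - (\<epsilon>1 * n) * (\<epsilon>1 * n - 1) = (l - \<epsilon>1 * n) * (\<epsilon>1 * n + 1 - l) + (2 * (\<epsilon>1 * n) - l)"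
          by (simp add: algebra_simps)
        moreover have "(l - \<epsilon>1 * n) * (\<epsilon>1 * n + 1 - l) \<ge> 0" using l by (intro mult_nonneg_nonneg) auto
        moreover have "2 * (\<epsilon>1 * n) - l \<ge> \<epsilon>1 * n - 1" using l by linarith
        moreover have "\<epsilon>1 * n \<ge> 1"
        proof -
          have "(2 * C + 4) \<le> n * \<epsilon>1\<^sup>2" using n(1) \<epsilon>1 by (simp add: field_simps)
          also have "n * \<epsilon>1\<^sup>2 = (\<epsilon>1 * n) * \<epsilon>1" by (simp add: power2_eq_square)
          also have "\<dots> \<le> (\<epsilon>1 * n) * (1/2)" using \<epsilon>1 n1 by (intro mult_left_mono) auto
          finally show ?thesis using C by simp
        qed
        ultimately show ?thesis by linarith
      qed
      moreover have "(\<epsilon>1 * n) * (\<epsilon>1 * n - 1) = \<epsilon>1\<^sup>2 * n\<^sup>2 - \<epsilon>1 * n" by (simp add: power2_eq_square algebra_simps)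
      moreover have "(\<epsilon>1\<^sup>2 / 2) * n\<^sup>2 = \<epsilon>1\<^sup>2 * n\<^sup>2 / 2" by simp
      ultimately have "\<epsilon>1\<^sup>2 * n\<^sup>2 / 2 \<le> C + \<epsilon>1 * n" by linarith
      moreover have "\<epsilon>1\<^sup>2 * n\<^sup>2 / 2 \<ge> (C + 2) * n"
      proof -
        have "(C + 2) * n \<le> (\<epsilon>1\<^sup>2 * n / 2) * n"
          using n(1) \<epsilon>1 n1 by (intro mult_right_mono) (auto simp: field_simps)
        then show ?thesis by (simp add: power2_eq_square)
      qed
      moreover have "(C + 2) * n = C * n + 2 * n" by (simp add: distrib_right)
      moreover have "C * n \<ge> C" using C n1 mult_left_mono[of 1 n C] by simp
      moreover have "\<epsilon>1 * n \<le> n / 2" by fact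
      ultimately show False using n1 by linarith
    qed
    define U where "U = V - L"
    have finU: "finite U" and UV: "U \<subseteq> V" using finV by (auto simp: U_def)
    have cU: "real (card U) = n - card L"
      using LV finV by (simp add: U_def card_Diff_subset finite_subset[OF LV] n_def card_mono of_nat_diff)
    have Un: "real (card U) \<le> n" "real (card U) \<ge> n - \<epsilon>1 * n"
      using cU \<open>card L \<le> \<epsilon>1 * n\<close> by linarith+
    have "\<epsilon>1 * n \<le> n / 2" using \<epsilon>1(6) n1 mult_right_mono[of \<epsilon>1 "1/2" n] by simp
    then have U2: "real (card U) \<ge> n / 2" using Un by linarith
    have degU: "card (nbh adj U v) \<ge> (1 - 1/r - 2 * \<epsilon>1) * card U" if v: "v \<in> U" for v
    proof -
      have "card (nbh adj V v) \<le> card (nbh adj U v) + card (nbh adj L v)"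
      proof -
        have "V = U \<union> L" "U \<inter> L = {}" using LV by (auto simp: U_def)
        then show ?thesis using card_nbh_Un[of U L adj v] finU finite_subset[OF LV finV] by simp
      qed
      moreover have "card (nbh adj L v) \<le> card L" by (rule card_nbh_le[OF finite_subset[OF LV finV]])
      moreover have "real (card (nbh adj V v)) \<ge> (1 - 1/r - \<epsilon>1) * n" using v by (auto simp: U_def L_def n_def)
      ultimately have "real (card (nbh adj U v)) \<ge> (1 - 1/r - \<epsilon>1) * n - \<epsilon>1 * n"
        using \<open>card L \<le> \<epsilon>1 * n\<close> by linarith
      also have "(1 - 1/r - \<epsilon>1) * n - \<epsilon>1 * n = (1 - 1/r - 2 * \<epsilon>1) * n" by (simp add: algebra_simps)
      finally have 1: "(1 - 1/r - 2 * \<epsilon>1) * n \<le> real (card (nbh adj U v))" .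
      have "1 - 1/r - 2 * \<epsilon>1 \<ge> 0"
      proof -
        have "1 / (8 * real r * r) \<le> 1 / (8 * 2 * 2)" using r2 by (intro divide_left_mono mult_mono) auto
        moreover have "1 / real r \<le> 1/2" using r2 by (intro divide_left_mono) auto
        ultimately show ?thesis using \<epsilon>1(5) by linarith
      qed
      then have "(1 - 1/r - 2 * \<epsilon>1) * card U \<le> (1 - 1/r - 2 * \<epsilon>1) * n" using Un by (intro mult_left_mono)
      then show ?thesis using 1 by linarith
    qed
    have "card (nbh adj U v) \<ge> (1 - 1/r - \<epsilon>5) * card U" if v: "v \<in> U" for v
    proof -
      have "(1 - 1/r - \<epsilon>5) * card U \<le> (1 - 1/r - 2 * \<epsilon>1) * card U" using \<epsilon>1(2) by (intro mult_right_mono) auto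
      then show ?thesis using degU[OF v] by linarith
    qed
    moreover have "N5 \<le> card U" using U2 n'(1) unfolding n_def by linarith
    ultimately obtain S where S: "disjoint_family_on S {1..r}" "\<forall>i\<in>{1..r}. S i \<subseteq> U \<and> indep adj (S i)"
      "real (card (U - (\<Union>i\<in>{1..r}. S i))) \<le> \<gamma> * card U"
      using N5[rule_format, OF adj finU _ no_matching_join_subset[OF no_matching UV]] by blast
    \<comment> \<open>Any class can supply the vertices to be cloned; class 1 is taken.\<close>
    have one: "1 \<in> {1..r}" using r2 by simp
    have S1U: "S 1 \<subseteq> U" using S(2) one by blast
    note pp = parts_properties[OF finU S(1) _ _ S(3) degU _ one]
    have up: "card (S 1) \<le> (1/r + 2 * \<epsilon>1) * card U"
      and low: "card (S 1) \<ge> (1/r - \<gamma> - r * (2 * \<epsilon>1)) * card U"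
      and miss: "\<And>v. v \<in> S 1 \<Longrightarrow> card {w\<in>U - S 1. \<not> adj v w} \<le> (\<gamma> + (r + 1) * (2 * \<epsilon>1)) * card U"
      using pp S(2) \<epsilon>1(1) by auto
    have "1/r - \<gamma> - r * (2 * \<epsilon>1) \<ge> 1 / (2 * r)"
    proof -
      have "r * (2 * \<epsilon>1) \<le> r * (2 * (1 / (8 * real r * r)))" using \<epsilon>1(5) by (intro mult_left_mono) auto
      also have "\<dots> = 1 / (4 * r)" using r2 by simp
      finally have "r * (2 * \<epsilon>1) \<le> 1 / (4 * r)" .
      moreover have "1 / real r = 1 / (2 * r) + 1 / (4 * r) + 1 / (4 * r)" using r2 by (simp add: field_simps)
      ultimately show ?thesis using \<gamma>(3) by linarith
    qed
    moreover have "1 / (2 * real r) \<ge> 0" by simp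
    ultimately have "(1/r - \<gamma> - r * (2 * \<epsilon>1)) * card U \<ge> 1 / (2 * r) * (n / 2)"
      using U2 n1 by (intro mult_mono) linarith+
    moreover have "1 / (2 * r) * (n / 2) \<ge> t + 1"
    proof -
      have "real (4 * r * (t + 1)) \<le> n" using n'(4) unfolding n_def by (rule of_nat_mono)
      then show ?thesis using r2 by (simp add: field_simps)
    qed
    ultimately have "card (S 1) \<ge> t + 1" using low by linarith
    then have "t \<le> card (S 1 - {u})" using diff_card_le_card_Diff[of "{u}" "S 1"] by simp
    then obtain T where T: "T \<subseteq> S 1 - {u}" "card T = t" "finite T" by (meson obtain_subset_with_card_n)
    have fS: "finite (U - S 1)" using finU by simp
    have "real (card (U - S 1)) \<le> card {w\<in>U - S 1. \<forall>v\<in>T. adj v w} + card T * ((\<gamma> + (r + 1) * (2 * \<epsilon>1)) * card U)"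
      using T(1) by (intro card_common_ge[OF T(3) fS] miss) auto
    moreover have "real (card (U - S 1)) = real (card U) - card (S 1)"
      by (rule real_card_Diff[OF finU S1U])
    \<comment> \<open>The 1 accounts for \<open>u\<close>, which may lie in U - S 1 but is excluded
      in \<open>clone_bound\<close>.\<close>
    moreover have "real (card {w\<in>U - S 1. \<forall>v\<in>T. adj v w}) \<le> card (nbh adj V u) + 1"
    proof -
      have "card {w\<in>U - S 1. \<forall>v\<in>T. adj v w} \<le> card ({w\<in>V - {u}. \<forall>v\<in>T. adj v w} \<union> {u})"
        using UV finV by (intro card_mono) auto
      also have "\<dots> \<le> card {w\<in>V - {u}. \<forall>v\<in>T. adj v w} + card {u}" by (rule card_Un_le)
      also have "card {w\<in>V - {u}. \<forall>v\<in>T. adj v w} \<le> card (nbh adj V u)"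
        using T S1U UV by (intro clone_bound u) auto
      finally show ?thesis by simp
    qed
    moreover have "(1/r + 2 * \<epsilon>1) * card U \<le> (1/r + 2 * \<epsilon>1) * n"
      using Un(1) \<epsilon>1(1) by (intro mult_left_mono) auto
    moreover have "t * ((\<gamma> + (r + 1) * (2 * \<epsilon>1)) * card U) \<le> (\<epsilon> / 4) * n"
    proof -
      have "t * ((r + 1) * (2 * \<epsilon>1)) \<le> t * ((r + 1) * (2 * (\<epsilon> / (16 * t * (r + 1)))))"
        using \<epsilon>1(3) by (intro mult_left_mono) auto
      also have "\<dots> = \<epsilon> / 8" using assms(2) by (simp add: field_simps add_pos_nonneg add_nonneg_eq_0_iff)
      finally have "t * (\<gamma> + (r + 1) * (2 * \<epsilon>1)) \<le> \<epsilon> / 4" using \<gamma>(2) by (simp add: distrib_left)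
      then have "t * (\<gamma> + (r + 1) * (2 * \<epsilon>1)) * card U \<le> (\<epsilon> / 4) * n"
        using Un(1) assms(4) by (intro mult_mono) auto
      then show ?thesis by (simp add: mult.assoc)
    qed
    ultimately have "real (card (nbh adj V u)) \<ge> (n - \<epsilon>1 * n) - (1/r + 2 * \<epsilon>1) * n - (\<epsilon> / 4) * n - 1"
      using up Un(2) T(2) by (simp only:)
    moreover have "(1/r + 2 * \<epsilon>1) * n = 1/r * n + 2 * (\<epsilon>1 * n)" by (simp add: distrib_right)
    moreover have "3 * (\<epsilon>1 * n) \<le> (\<epsilon> / 8) * n" using \<epsilon>1(4) n1 mult_right_mono[of "3 * \<epsilon>1" "\<epsilon> / 8" n] by simp
    moreover have "(1 - 1/r - \<epsilon>) * n = n - 1/r * n - \<epsilon> * n" by (simp add: left_diff_distrib)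
    moreover have "\<epsilon> * n \<ge> 2" using n(2) assms(4) by (simp add: field_simps)
    ultimately show "(1 - 1/r - \<epsilon>) * card V \<le> card (nbh adj V u)" unfolding n_def[symmetric] by linarith
  qed
qed

section \<open>All but boundedly many vertices\<close>

text \<open>Double counting gives at least \<theta>/2 * |S| vertices of \<open>S\<close> with
  \<open>K\<close> neighbours in \<open>X\<close>. Their traces on \<open>X\<close> are among 2^K'
  sets, so one trace \<open>Z\<close> is shared by a positive proportion of \<open>S\<close>, and
  any \<open>K\<close> elements of it serve as \<open>Q\<close>.\<close>

lemma (in adjacency) common_neighbours_one_part:
  fixes \<theta> :: real
  assumes "finite S" "finite X" "card X = K'" "2 * K \<le> \<theta> * K'" "0 < \<theta>" "\<theta> \<le> 1" "0 < K"
    "\<And>x. x \<in> X \<Longrightarrow> card (nbh adj S x) \<ge> \<theta> * card S"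
  shows "\<exists>Q\<subseteq>X. card Q = K \<and> card {v\<in>S. \<forall>x\<in>Q. adj x v} \<ge> \<theta> / 2 / 2 ^ K' * card S"
proof -
  define G where "G = {v\<in>S. K \<le> card (nbh adj X v)}"
  have GS: "G \<subseteq> S" by (auto simp: G_def)
  have finG: "finite G" using GS assms(1) finite_subset by blast
  have "K' * (\<theta> * card S) = (\<Sum>x\<in>X. \<theta> * card S)" using assms(3) by simp
  also have "\<dots> \<le> (\<Sum>x\<in>X. real (card (nbh adj S x)))" by (intro sum_mono assms(8))
  also have "\<dots> = (\<Sum>v\<in>S. real (card (nbh adj X v)))"
    unfolding of_nat_sum[symmetric] using sum_card_nbh_swap[OF assms(2,1)] by simp
  also have "\<dots> \<le> (\<Sum>v\<in>S. (if v \<in> G then real K' else 0) + K)"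
  proof (rule sum_mono)
    fix v assume "v \<in> S"
    then show "real (card (nbh adj X v)) \<le> (if v \<in> G then real K' else 0) + K"
      using card_nbh_le[OF assms(2), of adj v] assms(3) by (auto simp: G_def)
  qed
  also have "\<dots> = card G * real K' + card S * real K"
    using assms(1) GS by (simp add: sum.distrib sum.If_cases Int_absorb1)
  finally have 1: "K' * (\<theta> * card S) \<le> card G * real K' + card S * real K" .
  have K': "real K' > 0" using assms(4,5,7) by (cases "K' = 0") auto
  have "card S * real K \<le> card S * (\<theta> * K' / 2)" using assms(4) by (intro mult_left_mono) auto
  with 1 have "K' * (\<theta> * card S) \<le> card G * real K' + card S * (\<theta> * K' / 2)" by linarith
  then have "(\<theta> / 2 * card S) * K' \<le> card G * real K'" by (simp add: algebra_simps)
  then have G: "\<theta> / 2 * card S \<le> card G" using K' by (simp only: mult_le_cancel_right_pos)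
  define B where "B = {Z\<in>Pow X. K \<le> card Z}"
  have finB: "finite B" using assms(2) by (simp add: B_def)
  have "K \<le> K'"
  proof -
    have "real K \<le> \<theta> * K' / 2" using assms(4) by simp
    also have "\<dots> \<le> K'" using assms(6) K' mult_right_mono[of \<theta> 1 "real K'"] by simp
    finally show ?thesis by simp
  qed
  then have "X \<in> B" using assms(3) by (simp add: B_def)
  have "\<exists>y\<in>B. card G \<le> card (nbh adj X -` {y} \<inter> G) * card B"
  proof (rule pigeonhole_card)
    show "nbh adj X \<in> G \<rightarrow> B" using nbh_subset[of adj X] by (auto simp: G_def B_def)
  qed (use finG finB \<open>X \<in> B\<close> in auto)
  then obtain Z where Z: "Z \<in> B" "card G \<le> card (nbh adj X -` {Z} \<inter> G) * card B" by blast
  have "K \<le> card Z" "Z \<subseteq> X" using Z(1) by (auto simp: B_def)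
  then obtain Q where Q: "Q \<subseteq> Z" "card Q = K" by (meson obtain_subset_with_card_n)
  have cB: "card B \<le> 2 ^ K'"
  proof -
    have "card B \<le> card (Pow X)" using assms(2) by (intro card_mono) (auto simp: B_def)
    then show ?thesis using assms(2,3) by (simp add: card_Pow)
  qed
  have "nbh adj X -` {Z} \<inter> G \<subseteq> {v\<in>S. \<forall>x\<in>Q. adj x v}"
  proof
    fix v assume v: "v \<in> nbh adj X -` {Z} \<inter> G"
    then have "Z = {x\<in>X. adj v x}" by (auto simp: nbh_def)
    then have "\<forall>x\<in>Q. adj x v" using Q(1) sym by blast
    then show "v \<in> {v\<in>S. \<forall>x\<in>Q. adj x v}" using v GS by blast
  qed
  then have "card (nbh adj X -` {Z} \<inter> G) \<le> card {v\<in>S. \<forall>x\<in>Q. adj x v}"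
    using assms(1) by (intro card_mono) auto
  then have "card G \<le> card {v\<in>S. \<forall>x\<in>Q. adj x v} * 2 ^ K'"
    using Z(2) mult_le_mono[OF _ cB] le_trans by blast
  from of_nat_mono[OF this, where 'a = real]
  have "\<theta> / 2 * card S \<le> card {v\<in>S. \<forall>x\<in>Q. adj x v} * 2 ^ K'" using G by simp
  then have "\<theta> / 2 / 2 ^ K' * card S \<le> card {v\<in>S. \<forall>x\<in>Q. adj x v}" by (simp add: field_simps)
  then show ?thesis using Q \<open>Z \<subseteq> X\<close> by (intro exI[of _ Q]) auto
qed

text \<open>The classes are treated one after another. Each application of
  \<open>common_neighbours_one_part\<close> shrinks the set, so K' > K vertices must be left by the
  classes in \<open>J\<close>; hence the induction is for all \<open>K\<close>. What was achieved
  for earlier classes survives, as a smaller set has more common neighbours.\<close>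

theorem common_neighbours_all_parts:
  fixes \<theta> :: real and J :: "'i set"
  assumes "finite J" "0 < \<theta>" "\<theta> \<le> 1" "0 < K"
  shows "\<exists>M (c :: real). 0 < c \<and> (\<forall>(adj :: 'b \<Rightarrow> 'b \<Rightarrow> bool) S X. adjacency adj \<longrightarrow> finite X \<longrightarrow> M \<le> card X \<longrightarrow>
    (\<forall>j\<in>J. finite (S j) \<and> (\<forall>x\<in>X. card (nbh adj (S j) x) \<ge> \<theta> * card (S j))) \<longrightarrow>
    (\<exists>Q\<subseteq>X. card Q = K \<and> (\<forall>j\<in>J. card {v\<in>S j. \<forall>x\<in>Q. adj x v} \<ge> c * card (S j))))"
  using assms(1,4)
proof (induction J arbitrary: K)
  case empty
  show ?case
  proof (intro exI[of _ K] exI[of _ "1::real"] conjI allI impI)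
    fix adj :: "'b \<Rightarrow> 'b \<Rightarrow> bool" and S :: "'i \<Rightarrow> 'b set" and X :: "'b set"
    assume "K \<le> card X"
    then obtain Q where "Q \<subseteq> X" "card Q = K" by (meson obtain_subset_with_card_n)
    then show "\<exists>Q\<subseteq>X. card Q = K \<and> (\<forall>j\<in>{}. card {v\<in>S j. \<forall>x\<in>Q. adj x v} \<ge> 1 * real (card (S j)))"
      by (intro exI[of _ Q]) simp
  qed simp
next
  case (insert j J)
  define K' where "K' = K + nat \<lceil>2 * K / \<theta>\<rceil>"
  have "2 * K / \<theta> \<le> K'" unfolding K'_def by linarith
  then have K': "2 * K \<le> \<theta> * K'" "0 < K'" using assms(2) insert.prems by (simp_all add: field_simps K'_def)
  obtain M and c :: real where c: "0 < c" and M: "\<forall>(adj :: 'b \<Rightarrow> 'b \<Rightarrow> bool) S X. adjacency adj \<longrightarrow> finite X \<longrightarrow> M \<le> card X \<longrightarrow>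
    (\<forall>j\<in>J. finite (S j) \<and> (\<forall>x\<in>X. card (nbh adj (S j) x) \<ge> \<theta> * card (S j))) \<longrightarrow>
    (\<exists>Q\<subseteq>X. card Q = K' \<and> (\<forall>j\<in>J. card {v\<in>S j. \<forall>x\<in>Q. adj x v} \<ge> c * card (S j)))"
    using insert.IH[OF K'(2)] by (elim exE conjE) (rule that)
  define c' where "c' = min c (\<theta> / 2 / 2 ^ K')"
  show ?case
  proof (intro exI[of _ M] exI[of _ c'] conjI allI impI)
    show "0 < c'" using c assms(2) by (simp add: c'_def)
    fix adj :: "'b \<Rightarrow> 'b \<Rightarrow> bool" and S :: "'i \<Rightarrow> 'b set" and X
    assume adj: "adjacency adj" and X: "finite X" "M \<le> card X"
      and S: "\<forall>j\<in>insert j J. finite (S j) \<and> (\<forall>x\<in>X. card (nbh adj (S j) x) \<ge> \<theta> * card (S j))"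
    interpret adjacency adj by (rule adj)
    have SJ: "\<forall>j\<in>J. finite (S j) \<and> (\<forall>x\<in>X. card (nbh adj (S j) x) \<ge> \<theta> * card (S j))" using S by simp
    have "\<exists>Q\<subseteq>X. card Q = K' \<and> (\<forall>j\<in>J. card {v\<in>S j. \<forall>x\<in>Q. adj x v} \<ge> c * card (S j))"
      by (rule M[THEN spec, THEN spec, THEN spec, THEN mp, THEN mp, THEN mp, THEN mp, OF adj X SJ])
    then obtain Q' where Q': "Q' \<subseteq> X" "card Q' = K'"
      "\<forall>j\<in>J. card {v\<in>S j. \<forall>x\<in>Q'. adj x v} \<ge> c * card (S j)" by blast
    have "\<exists>Q\<subseteq>Q'. card Q = K \<and> card {v\<in>S j. \<forall>x\<in>Q. adj x v} \<ge> \<theta> / 2 / 2 ^ K' * card (S j)"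
      using S Q' X K' assms(2,3) insert.prems finite_subset[OF Q'(1) X(1)]
      by (intro common_neighbours_one_part) auto
    then obtain Q where Q: "Q \<subseteq> Q'" "card Q = K"
      "card {v\<in>S j. \<forall>x\<in>Q. adj x v} \<ge> \<theta> / 2 / 2 ^ K' * card (S j)" by blast
    have "c' * card (S i) \<le> card {v\<in>S i. \<forall>x\<in>Q. adj x v}" if i: "i \<in> insert j J" for i
    proof (cases "i = j")
      case True
      have "c' * card (S i) \<le> \<theta> / 2 / 2 ^ K' * card (S i)" by (intro mult_right_mono) (auto simp: c'_def)
      then show ?thesis using Q(3) True by simp
    next
      case False
      then have iJ: "i \<in> J" using i by simp
      have "c' * card (S i) \<le> c * card (S i)" by (intro mult_right_mono) (auto simp: c'_def)
      also have "\<dots> \<le> card {v\<in>S i. \<forall>x\<in>Q'. adj x v}" using Q'(3) iJ by blast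
      also have "\<dots> \<le> card {v\<in>S i. \<forall>x\<in>Q. adj x v}"
        using Q(1) S iJ by (intro of_nat_mono card_mono) auto
      finally show ?thesis .
    qed
    then show "\<exists>Q\<subseteq>X. card Q = K \<and> (\<forall>i\<in>insert j J. c' * card (S i) \<le> card {v\<in>S i. \<forall>x\<in>Q. adj x v})"
      using Q(1,2) Q'(1) by (intro exI[of _ Q]) auto
  qed
qed

context extremal_config
begin

text \<open>Vertices outside the \<open>S0 i\<close> with few neighbours in some \<open>S0 i\<close> join that class. Those with linearly many
  neighbours in every class are bounded in number, since otherwise \<open>q\<close> of them would have linearly many
  common neighbours in every class.\<close>

lemma bounded_exceptional_set:
  fixes \<mu> \<theta> c :: real
  defines "n \<equiv> real (card V)"
  assumes S0: "disjoint_family_on S0 {1..r}" "\<And>i. i \<in> {1..r} \<Longrightarrow> S0 i \<subseteq> V"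
    and size: "\<And>i. i \<in> {1..r} \<Longrightarrow> card (S0 i) \<ge> (1/r - \<mu>) * n"
    and miss: "\<And>i v. i \<in> {1..r} \<Longrightarrow> v \<in> S0 i \<Longrightarrow> card {w\<in>V - S0 i. \<not> adj v w} \<le> \<mu> * n"
    and deg: "\<And>v. v \<in> V \<Longrightarrow> card (nbh adj V v) \<ge> (1 - 1/r - \<mu>) * n"
    and \<theta>: "\<theta> = 1 / (8 * t * r)" and \<mu>0: "0 \<le> \<mu>" and \<mu>1: "\<mu> * (1 + 4 * t) \<le> 1 / (4 * r)"
    and \<mu>2: "r * (t * (\<mu> * n)) + t \<le> n / (4 * r)" and \<mu>3: "r * (t * (\<mu> * n)) + t \<le> c * (n / (2 * r))" and c: "0 \<le> c"
    and common: "\<And>X. finite X \<Longrightarrow> M0 \<le> card X \<Longrightarrow>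
      (\<forall>j\<in>{1..r}. finite (S0 j) \<and> (\<forall>x\<in>X. card (nbh adj (S0 j) x) \<ge> \<theta> * card (S0 j))) \<Longrightarrow>
      (\<exists>Q\<subseteq>X. card Q = q \<and> (\<forall>j\<in>{1..r}. card {v\<in>S0 j. \<forall>x\<in>Q. adj x v} \<ge> c * card (S0 j)))"
  shows "\<exists>S. disjoint_family_on S {1..r} \<and> (\<forall>i\<in>{1..r}. S i \<subseteq> V \<and> indep adj (S i)) \<and>
    card (V - (\<Union>i\<in>{1..r}. S i)) \<le> M0 + r * (2 * t)"
proof -
  define W0 where "W0 = {x \<in> V - (\<Union>i\<in>{1..r}. S0 i). \<forall>i\<in>{1..r}. \<theta> * n \<le> card (nbh adj (S0 i) x)}"
  have finS0: "finite (S0 i)" if "i \<in> {1..r}" for i using S0(2)[OF that] finV finite_subset by blast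
  have n0: "n \<ge> 0" by (simp add: n_def)
  have \<theta>0: "\<theta> \<ge> 0" by (simp add: \<theta>)
  have rpos: "real r > 0" using r2 by simp
  have S0n: "card (S0 i) \<le> n" if "i \<in> {1..r}" for i
    using S0(2)[OF that] finV by (simp add: n_def card_mono)
  have miss0: "card {w\<in>S0 j. \<not> adj v w} \<le> \<mu> * n" if "i \<in> {1..r}" "j \<in> {1..r}" "i \<noteq> j" "v \<in> S0 i" for i j v
  proof -
    have "{w\<in>S0 j. \<not> adj v w} \<subseteq> {w\<in>V - S0 i. \<not> adj v w}"
      using S0 that unfolding disjoint_family_on_def by blast
    then have "card {w\<in>S0 j. \<not> adj v w} \<le> card {w\<in>V - S0 i. \<not> adj v w}" using finV by (intro card_mono) auto
    then show ?thesis using miss[OF that(1,4)] by linarith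
  qed
  have \<mu>r: "\<mu> \<le> 1 / (4 * r)"
  proof -
    have "\<mu> * 1 \<le> \<mu> * (1 + 4 * t)" using \<mu>0 by (intro mult_left_mono) auto
    then show ?thesis using \<mu>1 by linarith
  qed
  have half: "card (S0 i) \<ge> n / (2 * r)" if "i \<in> {1..r}" for i
  proof -
    have "1 / (2 * r) \<le> 1/r - \<mu>" using \<mu>r rpos by (simp add: field_simps)
    then have "1 / (2 * r) * n \<le> (1/r - \<mu>) * n" using n0 by (intro mult_right_mono) auto
    then show ?thesis using size[OF that] by simp
  qed
  have W0: "card W0 < M0"
  proof (rule ccontr)
    assume "\<not> card W0 < M0"
    moreover have "finite W0" using finV by (simp add: W0_def)
    moreover have "\<theta> * card (S0 j) \<le> card (nbh adj (S0 j) x)" if "j \<in> {1..r}" "x \<in> W0" for j x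
    proof -
      have "\<theta> * card (S0 j) \<le> \<theta> * n" using \<theta>0 S0n[OF that(1)] by (intro mult_left_mono) auto
      moreover have "\<theta> * n \<le> card (nbh adj (S0 j) x)" using that unfolding W0_def by blast
      ultimately show ?thesis by linarith
    qed
    ultimately have "\<exists>Q\<subseteq>W0. card Q = q \<and> (\<forall>j\<in>{1..r}. card {v\<in>S0 j. \<forall>x\<in>Q. adj x v} \<ge> c * card (S0 j))"
      using finS0 by (intro common) auto
    then obtain Q where Q: "Q \<subseteq> W0" "card Q = q"
      "\<And>j. j \<in> {1..r} \<Longrightarrow> card {v\<in>S0 j. \<forall>x\<in>Q. adj x v} \<ge> c * card (S0 j)"
      by blast
    define C where "C j = {v\<in>S0 j. \<forall>x\<in>Q. adj x v}" for j
    have "\<exists>A. blocks adj t {1..r} A \<and> (\<forall>j\<in>{1..r}. A j \<subseteq> C j)"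
    proof (rule blocks_select[where m = "\<mu> * n"])
      fix j assume j: "j \<in> {1..r}"
      show "finite (C j)" using finS0[OF j] by (simp add: C_def)
      have "c * (n / (2 * r)) \<le> c * card (S0 j)" using half[OF j] c by (intro mult_left_mono) auto
      then show "real (card {1..r}) * (t * (\<mu> * n)) + t \<le> card (C j)" using Q(3)[OF j] \<mu>3 by (simp add: C_def)
    next
      fix j k v assume *: "j \<in> {1..r}" "k \<in> {1..r}" "j \<noteq> k" "v \<in> C j"
      have "card {w\<in>C k. \<not> adj v w} \<le> card {w\<in>S0 k. \<not> adj v w}"
        using finS0[OF *(2)] by (intro card_mono) (auto simp: C_def)
      then show "card {w\<in>C k. \<not> adj v w} \<le> \<mu> * n" using miss0[of j k v] * by (auto simp: C_def)
    qed (use \<mu>0 n0 in auto)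
    then obtain A where A: "blocks adj t {1..r} A" "\<forall>j\<in>{1..r}. A j \<subseteq> C j" by blast
    show False
    proof (rule no_independent[of Q "{1..r}" A])
      show "Q \<subseteq> V" using Q(1) by (auto simp: W0_def)
      show "A j \<subseteq> V" if "j \<in> {1..r}" for j using A(2) S0(2)[OF that] that unfolding C_def by blast
      show "adj x a" if "j \<in> {1..r}" "a \<in> A j" "x \<in> Q" for j a x
        using A(2) that unfolding C_def by blast
    qed (use A Q in auto)
  qed
  define ii where "ii x = (SOME i. i \<in> {1..r} \<and> \<not> \<theta> * n \<le> card (nbh adj (S0 i) x))" for x
  have ii: "ii x \<in> {1..r} \<and> \<not> \<theta> * n \<le> card (nbh adj (S0 (ii x)) x)"
    if "x \<in> V - (\<Union>i\<in>{1..r}. S0 i)" "x \<notin> W0" for x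
    unfolding ii_def by (rule someI_ex) (use that in \<open>auto simp: W0_def\<close>)
  define U where "U i = S0 i \<union> {x \<in> V - (\<Union>i\<in>{1..r}. S0 i) - W0. ii x = i}" for i
  have UV: "U i \<subseteq> V" if "i \<in> {1..r}" for i using S0(2)[OF that] by (auto simp: U_def)
  have disjU: "U i \<inter> U j = {}" if "i \<in> {1..r}" "j \<in> {1..r}" "i \<noteq> j" for i j
    using S0(1) that unfolding disjoint_family_on_def U_def by blast
  have covU: "V - (\<Union>i\<in>{1..r}. U i) \<subseteq> W0" using ii unfolding U_def by blast
  \<comment> \<open>A vertex has at most about n/r non-neighbours, and one added to class
    \<open>i\<close> spends nearly all of them on \<open>S0 i\<close>; few are left for
    \<open>S0 j\<close>.\<close>
  have missU: "card {w\<in>S0 j. \<not> adj x w} \<le> (2 * \<mu> + \<theta>) * n"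
    if "i \<in> {1..r}" "j \<in> {1..r}" "i \<noteq> j" "x \<in> U i" for i j x
  proof (cases "x \<in> S0 i")
    case True
    have "\<mu> * n \<le> (2 * \<mu> + \<theta>) * n" using \<mu>0 \<theta>0 n0 by (intro mult_right_mono) auto
    then show ?thesis using miss0[OF that(1,2,3) True] by linarith
  next
    case False
    then have x: "x \<in> V - (\<Union>i\<in>{1..r}. S0 i)" "x \<notin> W0" "ii x = i" using that(4) by (auto simp: U_def)
    have few: "card (nbh adj (S0 i) x) < \<theta> * n" using ii[OF x(1,2)] x(3) by simp
    have sub: "{w\<in>S0 i. \<not> adj x w} \<union> {w\<in>S0 j. \<not> adj x w} \<subseteq> {w\<in>V. \<not> adj x w}"
      using S0(2) that(1,2) by blast
    have "card {w\<in>S0 i. \<not> adj x w} + card {w\<in>S0 j. \<not> adj x w} = card ({w\<in>S0 i. \<not> adj x w} \<union> {w\<in>S0 j. \<not> adj x w})"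
    proof (rule card_Un_disjoint[symmetric])
      have "S0 i \<inter> S0 j = {}" using S0(1) that(1-3) unfolding disjoint_family_on_def by simp
      then show "{w\<in>S0 i. \<not> adj x w} \<inter> {w\<in>S0 j. \<not> adj x w} = {}" by blast
    qed (use finS0 that in auto)
    also have "\<dots> \<le> card {w\<in>V. \<not> adj x w}" using sub finV by (intro card_mono) auto
    finally have 1: "card {w\<in>S0 i. \<not> adj x w} + card {w\<in>S0 j. \<not> adj x w} \<le> card {w\<in>V. \<not> adj x w}" .
    have 2: "card (nbh adj V x) + card {w\<in>V. \<not> adj x w} = card V" by (rule card_nbh_compl[OF finV])
    have 3: "card (nbh adj (S0 i) x) + card {w\<in>S0 i. \<not> adj x w} = card (S0 i)"
      by (rule card_nbh_compl[OF finS0[OF that(1)]])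
    have 4: "(1 - 1/r - \<mu>) * n \<le> card (nbh adj V x)" using deg x(1) by blast
    have "real (card {w\<in>S0 j. \<not> adj x w}) \<le> n - (1 - 1/r - \<mu>) * n - ((1/r - \<mu>) * n - \<theta> * n)"
      using 1 2 3 4 few size[OF that(1)] unfolding n_def by linarith
    also have "\<dots> = (2 * \<mu> + \<theta>) * n" by (simp add: algebra_simps)
    finally show ?thesis .
  qed
  have "\<exists>C\<subseteq>U i. card C \<le> 2 * t \<and> (\<forall>x\<in>U i - C. \<forall>y\<in>U i - C. \<not> adj x y)" if i: "i \<in> {1..r}" for i
  proof (rule ccontr)
    assume "\<not> ?thesis"
    moreover have finU: "finite (U i)" using UV[OF i] finV finite_subset by blast
    ultimately obtain M where M: "matching adj M" "card M = t" "finite M" "\<Union>M \<subseteq> U i"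
      using matching_or_cover[of "U i" t] by blast
    have fM: "finite (\<Union>M)" using M(4) finU finite_subset by blast
    have cM: "card (\<Union>M) \<le> 2 * t" using matching_card_Union_le[OF M(1)] M(2) by simp
    define C where "C j = {b\<in>S0 j. \<forall>x\<in>\<Union>M. adj x b}" for j
    have "\<exists>A. blocks adj t ({1..r} - {i}) A \<and> (\<forall>j\<in>{1..r} - {i}. A j \<subseteq> C j)"
    proof (rule blocks_select[where m = "\<mu> * n"])
      fix j assume j: "j \<in> {1..r} - {i}"
      then have j': "j \<in> {1..r}" "i \<noteq> j" by auto
      show "finite (C j)" using finS0[OF j'(1)] by (simp add: C_def)
      have "real (card (S0 j)) \<le> card (C j) + card (\<Union>M) * ((2 * \<mu> + \<theta>) * n)"
        unfolding C_def using finS0[OF j'(1)] M(4) j' i by (intro card_common_ge[OF fM] missU[of i j]) auto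
      also have "card (\<Union>M) * ((2 * \<mu> + \<theta>) * n) \<le> real (2 * t) * ((2 * \<mu> + \<theta>) * n)"
        using cM \<mu>0 \<theta>0 n0 by (intro mult_right_mono) (auto simp del: of_nat_mult)
      finally have "(1/r - \<mu>) * n - real (2 * t) * ((2 * \<mu> + \<theta>) * n) \<le> card (C j)"
        using size[OF j'(1)] by linarith
      moreover have "(1/r - \<mu>) * n - real (2 * t) * ((2 * \<mu> + \<theta>) * n) = (1/r - \<mu> * (1 + 4 * t) - 2 * t * \<theta>) * n"
        by (simp add: algebra_simps)
      \<comment> \<open>The origin of the factor 1/(8t) in \<theta>: through \<theta>, the 2t ends
        of a matching lose at most n/(4r) vertices of another class.\<close>
      moreover have "2 * t * \<theta> = 1 / (4 * r)" using t1 rpos by (simp add: \<theta> field_simps)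
      moreover have "1 / real r = 1 / (2 * r) + 1 / (4 * r) + 1 / (4 * r)" using rpos by (simp add: field_simps)
      then have "1/r - \<mu> * (1 + 4 * t) - 1 / (4 * r) \<ge> 1 / (2 * r)" using \<mu>1 by linarith
      then have "(1/r - \<mu> * (1 + 4 * t) - 1 / (4 * r)) * n \<ge> 1 / (2 * r) * n" using n0 by (intro mult_right_mono)
      ultimately have "n / (2 * r) \<le> card (C j)" by simp
      moreover have "n / (4 * r) \<le> n / (2 * r)" using n0 rpos by (intro divide_left_mono) auto
      moreover have "real (card ({1..r} - {i})) * (t * (\<mu> * n)) \<le> r * (t * (\<mu> * n))"
        using i \<mu>0 n0 by (intro mult_right_mono) auto
      ultimately show "real (card ({1..r} - {i})) * (t * (\<mu> * n)) + t \<le> card (C j)" using \<mu>2 by linarith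
    next
      fix j k v assume *: "j \<in> {1..r} - {i}" "k \<in> {1..r} - {i}" "j \<noteq> k" "v \<in> C j"
      have "card {w\<in>C k. \<not> adj v w} \<le> card {w\<in>S0 k. \<not> adj v w}"
        using finS0[of k] * by (intro card_mono) (auto simp: C_def)
      then show "card {w\<in>C k. \<not> adj v w} \<le> \<mu> * n" using miss0[of j k v] * by (auto simp: C_def)
    qed (use \<mu>0 n0 in auto)
    then obtain A where A: "blocks adj t ({1..r} - {i}) A" "\<forall>j\<in>{1..r} - {i}. A j \<subseteq> C j" by blast
    show False
    proof (rule no_matching_joinD[OF no_matching M(1,2) _ _ _ A(1)])
      show "\<Union>M \<subseteq> V" using M(4) UV[OF i] by blast
      show "card ({1..r} - {i}) = r - 1" using i by simp
      show "A j \<subseteq> V" if "j \<in> {1..r} - {i}" for j using A(2) S0(2)[of j] that unfolding C_def by blast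
      show "adj x y" if "j \<in> {1..r} - {i}" "x \<in> \<Union>M" "y \<in> A j" for j x y
        using A(2) that unfolding C_def by blast
    qed auto
  qed
  then obtain C where C: "\<And>i. i \<in> {1..r} \<Longrightarrow> C i \<subseteq> U i \<and> card (C i) \<le> 2 * t \<and>
      (\<forall>x\<in>U i - C i. \<forall>y\<in>U i - C i. \<not> adj x y)" by metis
  define S where "S i = U i - C i" for i
  have "V - (\<Union>i\<in>{1..r}. S i) \<subseteq> W0 \<union> (\<Union>i\<in>{1..r}. C i)" using covU by (auto simp: S_def)
  moreover have finC: "finite (C i)" if "i \<in> {1..r}" for i
    using C[OF that] UV[OF that] finV by (meson finite_subset)
  moreover have "finite W0" using finV by (simp add: W0_def)
  ultimately have "card (V - (\<Union>i\<in>{1..r}. S i)) \<le> card (W0 \<union> (\<Union>i\<in>{1..r}. C i))"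
    by (intro card_mono) auto
  also have "\<dots> \<le> card W0 + card (\<Union>i\<in>{1..r}. C i)" by (rule card_Un_le)
  also have "card (\<Union>i\<in>{1..r}. C i) \<le> (\<Sum>i\<in>{1..r}. card (C i))" by (rule card_UN_le) simp
  also have "\<dots> \<le> of_nat (card {1..r}) * (2 * t)" using C by (intro sum_bounded_above) blast
  finally have "card (V - (\<Union>i\<in>{1..r}. S i)) \<le> M0 + r * (2 * t)" using W0 by simp
  moreover have "disjoint_family_on S {1..r}" using disjU unfolding disjoint_family_on_def S_def by blast
  moreover have "\<forall>i\<in>{1..r}. S i \<subseteq> V \<and> indep adj (S i)"
    using C UV unfolding S_def indep_def by blast
  ultimately show ?thesis by (intro exI[of _ S] conjI)
qed

end

text \<open>\<open>M\<close> precedes \<gamma>: it is composed of the constant of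
  \<open>common_neighbours_all_parts\<close> and of the covers of size 2t, neither of which depends
  on \<gamma>. The later choice of \<kappa> and \<gamma> in terms of \<open>M\<close> relies on this
  order.\<close>

theorem extremal_structure:
  fixes r t q :: nat
  assumes "2 \<le> r" "1 \<le> t" "1 \<le> q"
  shows "\<exists>M::nat. \<forall>\<gamma>::real. \<gamma> > 0 \<longrightarrow> (\<exists>N. \<forall>(adj :: 'b \<Rightarrow> 'b \<Rightarrow> bool) V. extremal_config adj V r t q \<longrightarrow> N \<le> card V \<longrightarrow>
    (\<exists>S. disjoint_family_on S {1..r} \<and> (\<forall>i\<in>{1..r}. S i \<subseteq> V \<and> indep adj (S i)) \<and>
      card (V - (\<Union>i\<in>{1..r}. S i)) \<le> M \<and>
      (\<forall>i\<in>{1..r}. \<bar>card (S i) - card V / r\<bar> \<le> \<gamma> * card V \<and>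
        (\<forall>v\<in>S i. card {w\<in>V - S i. \<not> adj v w} \<le> \<gamma> * card V))))"
proof -
  define \<theta> where "\<theta> = 1 / (8 * t * real r)"
  have \<theta>: "0 < \<theta>" "\<theta> \<le> 1"
  proof -
    show "0 < \<theta>" using assms by (simp add: \<theta>_def)
    have "1 * 1 \<le> t * real r" using assms by (intro mult_mono) auto
    then have "1 \<le> 8 * t * real r" by simp
    then show "\<theta> \<le> 1" unfolding \<theta>_def by (rule divide_le_eq_1_pos[THEN iffD2, rotated]) (use assms in simp)
  qed
  have "0 < q" using assms by simp
  obtain M0 and c :: real where c: "0 < c" and common: "\<forall>(adj :: 'b \<Rightarrow> 'b \<Rightarrow> bool) S X. adjacency adj \<longrightarrow> finite X \<longrightarrow> M0 \<le> card X \<longrightarrow>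
    (\<forall>j\<in>{1..r}. finite (S j) \<and> (\<forall>x\<in>X. card (nbh adj (S j) x) \<ge> \<theta> * card (S j))) \<longrightarrow>
    (\<exists>Q\<subseteq>X. card Q = q \<and> (\<forall>j\<in>{1..r}. card {v\<in>S j. \<forall>x\<in>Q. adj x v} \<ge> c * card (S j)))"
    using common_neighbours_all_parts[of "{1..r}", OF finite_atLeastAtMost \<theta> \<open>0 < q\<close>, where 'b = 'b]
    by (elim exE conjE) (rule that)
  show ?thesis
  proof (rule exI[of _ "M0 + r * (2 * t)"], intro allI impI)
    fix \<gamma> :: real assume \<gamma>: "\<gamma> > 0"
    \<comment> \<open>The three entries serve the hypotheses \<open>\<mu>1\<close>,
      \<open>\<mu>2\<close>, \<open>\<mu>3\<close> of \<open>bounded_exceptional_set\<close>; in the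
      last two, half of the bound is left to absorb \<open>t\<close> for large n.\<close>
    define \<mu> where "\<mu> = Min {1 / (4 * r * (1 + 4 * real t)), 1 / (8 * real r * r * t), c / (4 * real r * r * t)}"
    have \<mu>: "\<mu> > 0" "\<mu> \<le> 1 / (4 * r * (1 + 4 * real t))" "\<mu> \<le> 1 / (8 * real r * r * t)" "\<mu> \<le> c / (4 * real r * r * t)"
    proof -
      show "\<mu> > 0" using assms c by (simp add: \<mu>_def add_pos_nonneg)
    qed (auto simp: \<mu>_def)
    have \<mu>1: "\<mu> * (1 + 4 * t) \<le> 1 / (4 * r)"
    proof -
      have "\<mu> * (1 + 4 * t) \<le> 1 / (4 * r * (1 + 4 * real t)) * (1 + 4 * t)"
        using \<mu>(2) by (intro mult_right_mono) auto
      also have "\<dots> = 1 / (4 * r)" using assms by (simp add: field_simps add_nonneg_eq_0_iff)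
      finally show ?thesis .
    qed
    have \<mu>2: "r * (t * \<mu>) \<le> 1 / (8 * r)"
    proof -
      have "r * (t * \<mu>) \<le> r * (t * (1 / (8 * real r * r * t)))" using \<mu>(3) by (intro mult_left_mono) auto
      also have "\<dots> = 1 / (8 * r)" using assms by simp
      finally show ?thesis .
    qed
    have \<mu>3: "r * (t * \<mu>) \<le> c / (4 * r)"
    proof -
      have "r * (t * \<mu>) \<le> r * (t * (c / (4 * real r * r * t)))" using \<mu>(4) by (intro mult_left_mono) auto
      also have "\<dots> = c / (4 * r)" using assms by simp
      finally show ?thesis .
    qed
    have "\<mu> / 2 > 0" using \<mu> by simp
    obtain \<epsilon>5 N5 where \<epsilon>5: "\<epsilon>5 > 0" and N5: "\<forall>(adj :: 'b \<Rightarrow> 'b \<Rightarrow> bool) V. adjacency adj \<longrightarrow> finite V \<longrightarrow> N5 \<le> card V \<longrightarrow>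
      no_matching_join adj r t V \<longrightarrow> (\<forall>v\<in>V. card (nbh adj V v) \<ge> (1 - 1/r - \<epsilon>5) * card V) \<longrightarrow>
      (\<exists>S. disjoint_family_on S {1..r} \<and> (\<forall>i\<in>{1..r}. S i \<subseteq> V \<and> indep adj (S i)) \<and>
        real (card (V - (\<Union>i\<in>{1..r}. S i))) \<le> \<mu> / 2 * card V)"
      using min_degree_structure[OF assms(1,2) \<open>\<mu> / 2 > 0\<close>, where 'b = 'b] by (elim exE conjE) (rule that)
    define \<epsilon> where "\<epsilon> = Min {\<epsilon>5, \<mu> / (2 * (real r + 1)), \<gamma> / (2 * (real r + 1))}"
    have \<epsilon>: "\<epsilon> > 0" "\<epsilon> \<le> \<epsilon>5" "(r + 1) * \<epsilon> \<le> \<mu> / 2" "(r + 1) * \<epsilon> \<le> \<gamma> / 2"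
    proof -
      show "\<epsilon> > 0" using \<epsilon>5 \<mu> \<gamma> by (simp add: \<epsilon>_def add_nonneg_pos)
      show "\<epsilon> \<le> \<epsilon>5" by (simp add: \<epsilon>_def)
      have "\<epsilon> \<le> \<mu> / (2 * (real r + 1))" "\<epsilon> \<le> \<gamma> / (2 * (real r + 1))" by (simp_all add: \<epsilon>_def)
      then show "(r + 1) * \<epsilon> \<le> \<mu> / 2" "(r + 1) * \<epsilon> \<le> \<gamma> / 2" by (simp_all add: field_simps)
    qed
    have \<epsilon>r: "r * \<epsilon> \<ge> 0" "\<epsilon> \<ge> 0" "(r + 1) * \<epsilon> = r * \<epsilon> + \<epsilon>" using \<epsilon>(1) by (auto simp: distrib_right)
    obtain N1 where N1: "\<forall>(adj :: 'b \<Rightarrow> 'b \<Rightarrow> bool) V. extremal_config adj V r t q \<longrightarrow> N1 \<le> card V \<longrightarrow>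
      (\<forall>v\<in>V. card (nbh adj V v) \<ge> (1 - 1/r - \<epsilon>) * card V)"
      by (rule exE[OF extremal_min_degree[OF assms \<epsilon>(1), where 'b = 'b]])
    define M where "M = M0 + r * (2 * t)"
    define N where "N = N1 + N5 + 8 * r * t + nat \<lceil>4 * r * t / c\<rceil> + nat \<lceil>2 * M / \<gamma>\<rceil>"
    show "\<exists>N. \<forall>(adj :: 'b \<Rightarrow> 'b \<Rightarrow> bool) V. extremal_config adj V r t q \<longrightarrow> N \<le> card V \<longrightarrow>
      (\<exists>S. disjoint_family_on S {1..r} \<and> (\<forall>i\<in>{1..r}. S i \<subseteq> V \<and> indep adj (S i)) \<and>
        card (V - (\<Union>i\<in>{1..r}. S i)) \<le> M0 + r * (2 * t) \<and>
        (\<forall>i\<in>{1..r}. \<bar>card (S i) - card V / r\<bar> \<le> \<gamma> * card V \<and>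
          (\<forall>v\<in>S i. card {w\<in>V - S i. \<not> adj v w} \<le> \<gamma> * card V)))"
    proof (intro exI[of _ N] allI impI)
      fix adj :: "'b \<Rightarrow> 'b \<Rightarrow> bool" and V :: "'b set"
      assume conf: "extremal_config adj V r t q" and NV: "N \<le> card V"
      interpret extremal_config adj V r t q by (rule conf)
      have adj: "adjacency adj" by unfold_locales
      define n where "n = real (card V)"
      have n0: "n \<ge> 0" by (simp add: n_def)
      have "real N \<le> n" using NV by (simp add: n_def)
      moreover have "4 * r * t / c \<le> N" "2 * M / \<gamma> \<le> N" unfolding N_def by linarith+
      ultimately have n: "4 * r * t / c \<le> n" "2 * M / \<gamma> \<le> n" by linarith+
      have n': "N1 \<le> card V" "N5 \<le> card V" "8 * r * t \<le> card V" using NV unfolding N_def by linarith+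
      have deg: "card (nbh adj V v) \<ge> (1 - 1/r - \<epsilon>) * card V" if "v \<in> V" for v
        using N1[rule_format, OF conf n'(1) that] .
      have "card (nbh adj V v) \<ge> (1 - 1/r - \<epsilon>5) * card V" if "v \<in> V" for v
      proof -
        have "(1 - 1/r - \<epsilon>5) * card V \<le> (1 - 1/r - \<epsilon>) * card V" using \<epsilon>(2) by (intro mult_right_mono) auto
        then show ?thesis using deg[OF that] by linarith
      qed
      then obtain S0 where S0: "disjoint_family_on S0 {1..r}" "\<forall>i\<in>{1..r}. S0 i \<subseteq> V \<and> indep adj (S0 i)"
        "real (card (V - (\<Union>i\<in>{1..r}. S0 i))) \<le> \<mu> / 2 * card V"
        using N5[rule_format, OF adj finV n'(2) no_matching] by blast
      have S0V: "S0 i \<subseteq> V" and S0i: "indep adj (S0 i)" if "i \<in> {1..r}" for i using S0(2) that by auto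
      note pp0 = parts_properties[OF finV S0(1) S0V S0i S0(3) deg \<epsilon>r(2)]
      have "\<exists>S. disjoint_family_on S {1..r} \<and> (\<forall>i\<in>{1..r}. S i \<subseteq> V \<and> indep adj (S i)) \<and>
        card (V - (\<Union>i\<in>{1..r}. S i)) \<le> M0 + r * (2 * t)"
      proof (rule bounded_exceptional_set[OF S0(1) S0V, of \<mu> \<theta> c])
        fix i assume i: "i \<in> {1..r}"
        have "(1/r - \<mu>) * card V \<le> (1/r - \<mu> / 2 - r * \<epsilon>) * card V"
          using \<epsilon>(3) \<epsilon>r by (intro mult_right_mono) auto
        then show "(1/r - \<mu>) * card V \<le> card (S0 i)" using pp0(2)[OF _ _ _ i] by fastforce
        fix v assume v: "v \<in> S0 i"
        have "(\<mu> / 2 + (r + 1) * \<epsilon>) * card V \<le> \<mu> * card V"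
          using \<epsilon>(3) by (intro mult_right_mono) auto
        then show "card {w\<in>V - S0 i. \<not> adj v w} \<le> \<mu> * card V" using pp0(3)[OF _ _ _ i v] by fastforce
      next
        fix v assume v: "v \<in> V"
        have "\<epsilon> \<le> \<mu>" using \<epsilon>(3) \<epsilon>r \<mu>(1) by linarith
        then have "(1 - 1/r - \<mu>) * card V \<le> (1 - 1/r - \<epsilon>) * card V"
          by (intro mult_right_mono) auto
        then show "(1 - 1/r - \<mu>) * card V \<le> card (nbh adj V v)" using deg[OF v] by linarith
      next
        show "\<theta> = 1 / (8 * t * r)" by (simp add: \<theta>_def)
        have "r * (t * (\<mu> * n)) = (r * (t * \<mu>)) * n" by simp
        also have "\<dots> \<le> 1 / (8 * r) * n" using \<mu>2 n0 by (intro mult_right_mono)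
        finally have "r * (t * (\<mu> * n)) \<le> n / (8 * r)" by simp
        moreover have "t \<le> n / (8 * r)"
        proof -
          have "real (8 * r * t) \<le> n" using n'(3) unfolding n_def by (rule of_nat_mono)
          then show ?thesis using assms(1) by (simp add: field_simps)
        qed
        moreover have "n / (4 * r) = n / (8 * r) + n / (8 * r)" by simp
        ultimately show "r * (t * (\<mu> * card V)) + t \<le> card V / (4 * r)" unfolding n_def by linarith
        have "r * (t * (\<mu> * n)) = (r * (t * \<mu>)) * n" by simp
        also have "\<dots> \<le> c / (4 * r) * n" using \<mu>3 n0 by (intro mult_right_mono)
        finally have "r * (t * (\<mu> * n)) \<le> c * n / (4 * r)" by simp
        moreover have "t \<le> c * n / (4 * r)"
          using n(1) c assms(1) by (simp add: field_simps)
        moreover have "c * (n / (2 * r)) = c * n / (4 * r) + c * n / (4 * r)" by simp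
        ultimately show "r * (t * (\<mu> * card V)) + t \<le> c * (card V / (2 * r))" unfolding n_def by linarith
        show "\<exists>Q\<subseteq>X. card Q = q \<and> (\<forall>j\<in>{1..r}. card {v\<in>S0 j. \<forall>x\<in>Q. adj x v} \<ge> c * card (S0 j))"
          if "finite X" "M0 \<le> card X" "\<forall>j\<in>{1..r}. finite (S0 j) \<and> (\<forall>x\<in>X. card (nbh adj (S0 j) x) \<ge> \<theta> * card (S0 j))" for X
          using common[THEN spec, THEN spec, THEN spec, THEN mp, THEN mp, THEN mp, THEN mp, OF adj that] .
      qed (use \<mu>(1) \<mu>1 c in auto)
      then obtain S where S: "disjoint_family_on S {1..r}" "\<forall>i\<in>{1..r}. S i \<subseteq> V \<and> indep adj (S i)"
        "card (V - (\<Union>i\<in>{1..r}. S i)) \<le> M" unfolding M_def by blast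
      have SV: "S i \<subseteq> V" and Si: "indep adj (S i)" if "i \<in> {1..r}" for i using S(2) that by auto
      have "M \<le> \<gamma> / 2 * n" using n(2) \<gamma> by (simp add: field_simps)
      \<comment> \<open>Being bounded, the leftover is below \<gamma>/2 * n for large n, so that
        \<open>parts_properties\<close> can be applied once more, to the new classes.\<close>
      then have left: "real (card (V - (\<Union>i\<in>{1..r}. S i))) \<le> \<gamma> / 2 * card V" using S(3) unfolding n_def by linarith
      note pp = parts_properties[OF finV S(1) SV Si left deg \<epsilon>r(2)]
      have "\<bar>card (S i) - card V / r\<bar> \<le> \<gamma> * card V \<and> (\<forall>v\<in>S i. card {w\<in>V - S i. \<not> adj v w} \<le> \<gamma> * card V)"
        if i: "i \<in> {1..r}" for i
      proof (intro conjI ballI)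
        have up: "card (S i) \<le> (1/r + \<epsilon>) * card V" using pp(1)[OF _ _ _ i] by simp
        have low: "(1/r - \<gamma> / 2 - r * \<epsilon>) * card V \<le> card (S i)" using pp(2)[OF _ _ _ i] by simp
        have "\<epsilon> \<le> \<gamma>" using \<epsilon>(4) \<epsilon>r \<gamma> by linarith
        then have "(1/r + \<epsilon>) * card V \<le> (1/r + \<gamma>) * card V"
          by (intro mult_right_mono) auto
        also have "\<dots> = card V / r + \<gamma> * card V" by (simp add: distrib_right)
        finally have "(1/r + \<epsilon>) * card V \<le> card V / r + \<gamma> * card V" .
        with up have 1: "card (S i) \<le> card V / r + \<gamma> * card V" by (rule order_trans)
        have "card V / r - \<gamma> * card V = (1/r - \<gamma>) * card V" by (simp add: left_diff_distrib)
        also have "\<dots> \<le> (1/r - \<gamma> / 2 - r * \<epsilon>) * card V"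
          using \<epsilon>(4) \<epsilon>r by (intro mult_right_mono) auto
        finally have "card V / r - \<gamma> * card V \<le> card (S i)" using low by (rule order_trans)
        with 1 show "\<bar>card (S i) - card V / r\<bar> \<le> \<gamma> * card V" unfolding abs_le_iff by linarith
        fix v assume v: "v \<in> S i"
        have "(\<gamma> / 2 + (r + 1) * \<epsilon>) * card V \<le> \<gamma> * card V"
          using \<epsilon>(4) by (intro mult_right_mono) auto
        then show "card {w\<in>V - S i. \<not> adj v w} \<le> \<gamma> * card V" using pp(3)[OF _ _ _ i v] by fastforce
      qed
      then show "\<exists>S. disjoint_family_on S {1..r} \<and> (\<forall>i\<in>{1..r}. S i \<subseteq> V \<and> indep adj (S i)) \<and>
        card (V - (\<Union>i\<in>{1..r}. S i)) \<le> M0 + r * (2 * t) \<and>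
        (\<forall>i\<in>{1..r}. \<bar>card (S i) - card V / r\<bar> \<le> \<gamma> * card V \<and>
          (\<forall>v\<in>S i. card {w\<in>V - S i. \<not> adj v w} \<le> \<gamma> * card V))"
        using S unfolding M_def by (intro exI[of _ S]) blast
    qed
  qed
qed

section \<open>Types of vertices over the exceptional set\<close>

text \<open>The variance about the mean is nonnegative.\<close>

lemma sum_squares_ge:
  fixes f :: "'i \<Rightarrow> real"
  assumes "finite J" "J \<noteq> {}"
  shows "(\<Sum>j\<in>J. f j)\<^sup>2 / card J \<le> (\<Sum>j\<in>J. (f j)\<^sup>2)"
proof -
  define m where "m = (\<Sum>j\<in>J. f j) / card J"
  have c: "real (card J) > 0" using assms by (simp add: card_gt_0_iff)
  have "0 \<le> (\<Sum>j\<in>J. (f j - m)\<^sup>2)" by (intro sum_nonneg) auto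
  also have "\<dots> = (\<Sum>j\<in>J. (f j)\<^sup>2 - 2 * m * f j + m\<^sup>2)"
    by (intro sum.cong refl) (simp add: power2_diff mult_ac)
  also have "\<dots> = (\<Sum>j\<in>J. (f j)\<^sup>2) - 2 * m * (\<Sum>j\<in>J. f j) + card J * m\<^sup>2"
    by (simp add: sum.distrib sum_subtractf sum_distrib_left)
  also have "\<dots> = (\<Sum>j\<in>J. (f j)\<^sup>2) - (\<Sum>j\<in>J. f j)\<^sup>2 / card J"
    using c by (simp add: m_def power2_eq_square)
  finally show ?thesis by simp
qed

text \<open>Union bound over the possible values. With types as values it shows that rare types
  account for few vertices.\<close>

lemma card_small_fibres_le:
  fixes k :: real
  assumes "finite P" "finite B" "\<And>v. v \<in> P \<Longrightarrow> f v \<in> B" "0 \<le> k"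
  shows "real (card {v\<in>P. card {w\<in>P. f w = f v} < k}) \<le> card B * k"
proof -
  define B' where "B' = {b\<in>B. card {w\<in>P. f w = b} < k}"
  have finB': "finite B'" and B'B: "B' \<subseteq> B" using assms(2) by (auto simp: B'_def)
  have "{v\<in>P. card {w\<in>P. f w = f v} < k} \<subseteq> (\<Union>b\<in>B'. {w\<in>P. f w = b})"
    using assms(3) by (auto simp: B'_def)
  then have "card {v\<in>P. card {w\<in>P. f w = f v} < k} \<le> card (\<Union>b\<in>B'. {w\<in>P. f w = b})"
    using assms(1) finB' by (intro card_mono) auto
  also have "\<dots> \<le> (\<Sum>b\<in>B'. card {w\<in>P. f w = b})" by (rule card_UN_le[OF finB'])
  finally have "real (card {v\<in>P. card {w\<in>P. f w = f v} < k}) \<le> real (\<Sum>b\<in>B'. card {w\<in>P. f w = b})"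
    by (rule of_nat_mono)
  also have "\<dots> = (\<Sum>b\<in>B'. real (card {w\<in>P. f w = b}))" by simp
  also have "\<dots> \<le> of_nat (card B') * k" by (intro sum_bounded_above) (auto simp: B'_def)
  also have "\<dots> \<le> card B * k" using card_mono[OF assms(2) B'B] assms(4) by (intro mult_right_mono) auto
  finally show ?thesis .
qed

text \<open>Equality in the union bound leaves no room for an overlap.\<close>

lemma disjoint_family_of_card:
  assumes "finite J" "\<And>j. j \<in> J \<Longrightarrow> finite (A j)" "(\<Sum>j\<in>J. card (A j)) \<le> card (\<Union>j\<in>J. A j)"
  shows "disjoint_family_on A J"
  unfolding disjoint_family_on_def
proof (intro ballI impI)
  fix i k assume ik: "i \<in> J" "k \<in> J" "i \<noteq> k"
  define X where "X = (\<Union>j\<in>J - {i}. A j)"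
  have finX: "finite X" using assms(1,2) by (auto simp: X_def)
  have "(\<Union>j\<in>J. A j) = A i \<union> X" using ik(1) by (auto simp: X_def)
  moreover have "card (A i \<union> X) + card (A i \<inter> X) = card (A i) + card X"
    using card_Un_Int[OF assms(2)[OF ik(1)] finX] by simp
  moreover have "card X \<le> (\<Sum>j\<in>J - {i}. card (A j))" unfolding X_def using assms(1) by (intro card_UN_le) auto
  moreover have "(\<Sum>j\<in>J. card (A j)) = card (A i) + (\<Sum>j\<in>J - {i}. card (A j))"
    using assms(1) ik(1) by (simp add: sum.remove)
  ultimately have "card (A i \<inter> X) = 0" using assms(3) by simp
  then have "A i \<inter> X = {}" using finX by simp
  then show "A i \<inter> A k = {}" using ik by (auto simp: X_def)
qed

text \<open>The constants form a hierarchy: \<open>M\<close> bounds the exceptional set, a type is large if it occurs at least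
  \<open>\<kappa> |V|\<close> times, and \<open>\<gamma>\<close> is small compared with \<open>\<kappa>\<close>, so that complete blocks can be selected in large
  classes.\<close>

locale typed_config = extremal_config adj V r t q for adj :: "'b \<Rightarrow> 'b \<Rightarrow> bool" and V r t q +
  fixes P :: "nat \<Rightarrow> 'b set" and M :: nat and \<gamma> \<kappa> :: real
  assumes disjP: "disjoint_family_on P {1..r}"
    and PV: "i \<in> {1..r} \<Longrightarrow> P i \<subseteq> V"
    and indepP: "i \<in> {1..r} \<Longrightarrow> indep adj (P i)"
    and card_exc: "card (V - (\<Union>i\<in>{1..r}. P i)) \<le> M"
    and sizeP: "i \<in> {1..r} \<Longrightarrow> \<bar>card (P i) - card V / r\<bar> \<le> \<gamma> * card V"
    and missP: "i \<in> {1..r} \<Longrightarrow> v \<in> P i \<Longrightarrow> card {w\<in>V - P i. \<not> adj v w} \<le> \<gamma> * card V"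
    and \<gamma>0: "0 \<le> \<gamma>" and \<gamma>1: "\<gamma> \<le> 1 / (4 * real r)"
    and \<kappa>0: "0 < \<kappa>" and \<kappa>1: "2 ^ M * \<kappa> \<le> 1 / (4 * real r)"
    and select: "r * (t * (\<gamma> * card V)) + 2 * t * (\<gamma> * card V) + t \<le> \<kappa> * card V"
    and small: "2 * r * M * 2 ^ M * \<kappa> + 2 * r * M * \<gamma> \<le> 1 / r"
    and large: "2 * real q ^ 2 + real r ^ 3 + 2 * M\<^sup>2 < card V / r"
    and Vq: "q - 1 \<le> card V"
begin

text \<open>\<open>exc\<close> is the set \<open>E\<close> of the overview and \<open>tau v\<close>
  the type of \<open>v\<close>. For \<open>v\<close> in \<open>P i\<close>, \<open>mis i v\<close>
  concerns only missing edges to the other classes; those to \<open>exc\<close> are recorded by the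
  type.\<close>

definition "exc = V - (\<Union>i\<in>{1..r}. P i)"
definition "tau v = nbh adj exc v"
definition "cls i T = {v\<in>P i. tau v = T}"
definition "mis i v = card {w\<in>(\<Union>j\<in>{1..r}. P j) - P i. \<not> adj v w}"

lemma finP: "i \<in> {1..r} \<Longrightarrow> finite (P i)"
  using PV finV finite_subset by blast

lemma finexc: "finite exc"
  using finV by (simp add: exc_def)

lemma finUP: "finite (\<Union>i\<in>{1..r}. P i)"
  using finP by simp

lemma Vpos: "card V > 0"
proof (rule ccontr)
  assume "\<not> card V > 0"
  then have "card V / r = 0" by simp
  moreover have "2 * real q ^ 2 + real r ^ 3 + 2 * M\<^sup>2 \<ge> 0" by simp
  ultimately show False using large by linarith
qed

lemma tau_subset: "tau v \<subseteq> exc"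
  by (simp add: tau_def nbh_subset)

lemma cls_subset: "cls i T \<subseteq> P i"
  by (auto simp: cls_def)

lemma card_tau_le: "card (tau v) \<le> card exc"
  by (intro card_mono finexc tau_subset)

lemma adj_of_cls: "v \<in> cls i T \<Longrightarrow> x \<in> T \<Longrightarrow> adj x v"
  using sym by (auto simp: cls_def tau_def nbh_def)

lemma P_disjoint: "i \<in> {1..r} \<Longrightarrow> j \<in> {1..r} \<Longrightarrow> i \<noteq> j \<Longrightarrow> P i \<inter> P j = {}"
  using disjP unfolding disjoint_family_on_def by blast

lemma missP':
  assumes "i \<in> {1..r}" "j \<in> {1..r}" "i \<noteq> j" "v \<in> P i" "C \<subseteq> P j"
  shows "card {w\<in>C. \<not> adj v w} \<le> \<gamma> * card V"
proof -
  have "{w\<in>C. \<not> adj v w} \<subseteq> {w\<in>V - P i. \<not> adj v w}"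
    using P_disjoint[OF assms(1-3)] PV[OF assms(2)] assms(5) by blast
  then have "card {w\<in>C. \<not> adj v w} \<le> card {w\<in>V - P i. \<not> adj v w}" using finV by (intro card_mono) auto
  then show ?thesis using missP[OF assms(1,4)] by linarith
qed

text \<open>The assumption \<open>select\<close> is the budget for this: a large class loses at most
  2t \<gamma> |V| vertices through \<open>A0\<close>, and \<open>blocks_select\<close> then asks for
  at most r t \<gamma> |V| + t. The bound 2t on \<open>A0\<close> allows for two sets of
  \<open>t\<close> vertices in class \<open>i\<close>.\<close>

lemma select_blocks:
  assumes "i \<in> {1..r}" "A0 \<subseteq> P i" "card A0 \<le> 2 * t" "\<And>j. j \<in> {1..r} - {i} \<Longrightarrow> \<kappa> * card V \<le> card (cls j (T j))"
  shows "\<exists>A. blocks adj t ({1..r} - {i}) A \<and> (\<forall>j\<in>{1..r} - {i}. A j \<subseteq> cls j (T j)) \<and>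
    (\<forall>j\<in>{1..r} - {i}. \<forall>x\<in>A0. \<forall>a\<in>A j. adj x a)"
proof -
  define C where "C j = {w\<in>cls j (T j). \<forall>x\<in>A0. adj x w}" for j
  have fA: "finite A0" using assms(1,2) finP finite_subset by blast
  have CP: "C j \<subseteq> P j" for j using cls_subset by (auto simp: C_def)
  have "\<exists>A. blocks adj t ({1..r} - {i}) A \<and> (\<forall>j\<in>{1..r} - {i}. A j \<subseteq> C j)"
  proof (rule blocks_select[where m = "\<gamma> * card V"])
    fix j assume j: "j \<in> {1..r} - {i}"
    then have j': "j \<in> {1..r}" "i \<noteq> j" by auto
    show "finite (C j)" using CP finP[OF j'(1)] finite_subset by blast
    have "real (card (cls j (T j))) \<le> card (C j) + card A0 * (\<gamma> * card V)"
      unfolding C_def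
    proof (rule card_common_ge[OF fA])
      show "finite (cls j (T j))" using finP[OF j'(1)] cls_subset finite_subset by metis
      show "card {w\<in>cls j (T j). \<not> adj v w} \<le> \<gamma> * card V" if "v \<in> A0" for v
        using that assms(2) by (intro missP'[OF assms(1) j'(1,2)] cls_subset) auto
    qed
    also have "card A0 * (\<gamma> * card V) \<le> real (2 * t) * (\<gamma> * card V)"
      using assms(3) \<gamma>0 by (intro mult_right_mono of_nat_mono) auto
    finally have "\<kappa> * card V \<le> card (C j) + 2 * t * (\<gamma> * card V)" using assms(4)[OF j] by simp
    moreover have "real (card ({1..r} - {i})) * (t * (\<gamma> * card V)) \<le> r * (t * (\<gamma> * card V))"
      using assms(1) \<gamma>0 by (intro mult_right_mono) auto
    ultimately show "real (card ({1..r} - {i})) * (t * (\<gamma> * card V)) + t \<le> card (C j)" using select by linarith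
  next
    fix j k v assume "j \<in> {1..r} - {i}" "k \<in> {1..r} - {i}" "j \<noteq> k" "v \<in> C j"
    then show "card {w\<in>C k. \<not> adj v w} \<le> \<gamma> * card V" using CP by (intro missP'[of j k]) auto
  qed (use \<gamma>0 in auto)
  then obtain A where A: "blocks adj t ({1..r} - {i}) A" "\<forall>j\<in>{1..r} - {i}. A j \<subseteq> C j" by blast
  have "A j \<subseteq> cls j (T j)" if "j \<in> {1..r} - {i}" for j using A(2) that unfolding C_def by blast
  moreover have "adj x a" if "j \<in> {1..r} - {i}" "x \<in> A0" "a \<in> A j" for j x a
    using A(2) that unfolding C_def by blast
  ultimately show ?thesis using A(1) by blast
qed

lemma t_le_\<kappa>: "t \<le> \<kappa> * card V"
proof -
  have "0 \<le> r * (t * (\<gamma> * card V))" "0 \<le> 2 * t * (\<gamma> * card V)" using \<gamma>0 by simp_all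
  then show ?thesis using select by linarith
qed

text \<open>\<open>q\<close> vertices common to all \<open>T j\<close> would be completely joined to
  blocks chosen inside the large classes, against \<open>no_independent\<close>.\<close>

lemma card_common_types_le:
  assumes "\<And>j. j \<in> {1..r} \<Longrightarrow> \<kappa> * card V \<le> card (cls j (T j))"
  shows "card {x\<in>exc. \<forall>j\<in>{1..r}. x \<in> T j} \<le> q - 1"
proof (rule ccontr)
  assume "\<not> ?thesis"
  then have "q \<le> card {x\<in>exc. \<forall>j\<in>{1..r}. x \<in> T j}" by simp
  then obtain Q where Q: "Q \<subseteq> {x\<in>exc. \<forall>j\<in>{1..r}. x \<in> T j}" "card Q = q" by (meson obtain_subset_with_card_n)
  have one: "1 \<in> {1..r}" using r2 by simp
  have "t \<le> card (cls 1 (T 1))" using assms[OF one] t_le_\<kappa> by linarith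
  then obtain A1 where A1: "A1 \<subseteq> cls 1 (T 1)" "card A1 = t" "finite A1" by (meson obtain_subset_with_card_n)
  have "A1 \<subseteq> P 1" using A1 cls_subset by blast
  then obtain A where A: "blocks adj t ({1..r} - {1}) A" "\<forall>j\<in>{1..r} - {1}. A j \<subseteq> cls j (T j)"
    "\<forall>j\<in>{1..r} - {1}. \<forall>x\<in>A1. \<forall>a\<in>A j. adj x a"
    using select_blocks[OF one, of A1 T] A1(2) assms by auto
  have "blocks adj t (insert 1 ({1..r} - {1})) (A(1 := A1))"
    using A(1,3) A1 by (intro blocks_insert) auto
  then have bl: "blocks adj t {1..r} (A(1 := A1))" using one by (simp add: insert_absorb)
  have sub: "(A(1 := A1)) j \<subseteq> cls j (T j)" if "j \<in> {1..r}" for j using A(2) A1(1) that by auto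
  show False
  proof (rule no_independent[OF _ Q(2) _ _ bl])
    show "Q \<subseteq> V" using Q(1) by (auto simp: exc_def)
    show "(A(1 := A1)) j \<subseteq> V" if "j \<in> {1..r}" for j
      using sub[OF that] cls_subset PV[OF that] by blast
    show "adj x a" if "j \<in> {1..r}" "a \<in> (A(1 := A1)) j" "x \<in> Q" for j a x
      using adj_of_cls[of a j "T j" x] sub[OF that(1)] that Q(1) by blast
  qed auto
qed

text \<open>There are at most 2^M types; if each were rare, \<open>P i\<close> would have at most
  |V|/(4r) elements, contrary to \<open>sizeP\<close>.\<close>

lemma exists_large_class:
  assumes "i \<in> {1..r}"
  shows "\<exists>T. \<kappa> * card V \<le> card (cls i T)"
proof (rule ccontr)
  assume no: "\<not> ?thesis"
  have "{v\<in>P i. card {w\<in>P i. tau w = tau v} < \<kappa> * card V} = P i"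
    using no unfolding cls_def by (auto simp: not_le)
  then have "real (card (P i)) \<le> card (Pow exc) * (\<kappa> * card V)"
    using card_small_fibres_le[of "P i" "Pow exc" tau "\<kappa> * card V"] finP[OF assms] finexc tau_subset \<kappa>0 by simp
  also have "\<dots> \<le> 2 ^ M * (\<kappa> * card V)"
  proof (intro mult_right_mono)
    have "(2::nat) ^ card exc \<le> 2 ^ M" using card_exc by (intro power_increasing) (auto simp: exc_def)
    then show "real (card (Pow exc)) \<le> 2 ^ M" using finexc by (simp add: card_Pow)
  qed (use \<kappa>0 in auto)
  also have "\<dots> \<le> 1 / (4 * real r) * card V" using mult_right_mono[OF \<kappa>1, of "card V"] by (simp add: mult.assoc)
  finally have 1: "real (card (P i)) \<le> 1 / (4 * real r) * card V" .
  have "\<gamma> * card V \<le> 1 / (4 * real r) * card V" using \<gamma>1 by (intro mult_right_mono) auto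
  then have "real (card (P i)) \<ge> card V / r - 1 / (4 * real r) * card V"
    using sizeP[OF assms] by linarith
  moreover define x where "x = real (card V) / r"
  have x: "1 / (4 * real r) * card V = x / 4" "x > 0" using Vpos r2 by (auto simp: x_def)
  ultimately show False using 1 unfolding x x_def[symmetric] using x(2) by linarith
qed

lemma obtain_types:
  obtains T where "\<And>i. i \<in> {1..r} \<Longrightarrow> \<kappa> * card V \<le> card (cls i (T i))"
    "\<And>i T'. i \<in> {1..r} \<Longrightarrow> \<kappa> * card V \<le> card (cls i T') \<Longrightarrow> card T' \<le> card (T i)"
proof -
  have ex: "\<exists>T. \<kappa> * card V \<le> card (cls i T) \<and> (\<forall>T'. \<kappa> * card V \<le> card (cls i T') \<longrightarrow> card T' \<le> card T)"
    if i: "i \<in> {1..r}" for i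
  proof -
    define TT where "TT = {T. \<kappa> * card V \<le> card (cls i T)}"
    have "T \<in> Pow exc" if "T \<in> TT" for T
    proof -
      have "0 < \<kappa> * card V" using \<kappa>0 Vpos by simp
      then have "cls i T \<noteq> {}" using that by (auto simp: TT_def)
      then show ?thesis using tau_subset by (auto simp: cls_def)
    qed
    then have "finite TT" using finexc finite_subset[of TT "Pow exc"] by blast
    moreover have "TT \<noteq> {}" using exists_large_class[OF i] by (simp add: TT_def)
    ultimately obtain T where "T \<in> TT" "\<And>T'. T' \<in> TT \<Longrightarrow> card T' \<le> card T"
      using finite_maximizer[of TT card] by blast
    then show ?thesis unfolding TT_def by blast
  qed
  have "\<forall>i\<in>{1..r}. \<exists>T. \<kappa> * card V \<le> card (cls i T) \<and> (\<forall>T'. \<kappa> * card V \<le> card (cls i T') \<longrightarrow> card T' \<le> card T)"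
    using ex by blast
  from bchoice[OF this] obtain T where "\<forall>i\<in>{1..r}. \<kappa> * card V \<le> card (cls i (T i)) \<and>
    (\<forall>T'. \<kappa> * card V \<le> card (cls i T') \<longrightarrow> card T' \<le> card (T i))" ..
  then show thesis by (intro that[of T]) simp_all
qed

lemma V_decomp: "V = (\<Union>i\<in>{1..r}. P i) \<union> exc" "(\<Union>i\<in>{1..r}. P i) \<inter> exc = {}"
  using PV unfolding exc_def by blast+

lemma card_UP: "card (\<Union>i\<in>{1..r}. P i) = (\<Sum>i\<in>{1..r}. card (P i))"
  using finP P_disjoint by (intro card_UN_disjoint) auto

lemma sum_UP: "(\<Sum>v\<in>(\<Union>i\<in>{1..r}. P i). f v) = (\<Sum>i\<in>{1..r}. \<Sum>v\<in>P i. f v)"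
  using finP P_disjoint by (intro sum.UNION_disjoint) auto

lemma card_V: "card V = (\<Sum>i\<in>{1..r}. card (P i)) + card exc"
  using card_Un_disjoint[OF finUP finexc V_decomp(2)] V_decomp(1) card_UP by simp

lemma degsum_V: "degsum adj V = degsum adj (\<Union>i\<in>{1..r}. P i) + degsum adj exc + 2 * (\<Sum>i\<in>{1..r}. \<Sum>v\<in>P i. card (tau v))"
  using degsum_Un[OF finUP finexc V_decomp(2)] V_decomp(1) sum_UP[of "\<lambda>v. card (nbh adj exc v)"]
  by (simp add: tau_def)

text \<open>Since the classes are independent, the graph on their union is the complete
  \<open>r\<close>-partite graph without the pairs counted by \<open>mis\<close>. The subtracted
  terms stand on the left to stay in the natural numbers.\<close>

lemma degsum_UP: "degsum adj (\<Union>i\<in>{1..r}. P i) + (\<Sum>i\<in>{1..r}. \<Sum>v\<in>P i. mis i v) + (\<Sum>i\<in>{1..r}. (card (P i))\<^sup>2)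
    = (card (\<Union>i\<in>{1..r}. P i))\<^sup>2"
proof -
  let ?U = "\<Union>i\<in>{1..r}. P i"
  have *: "card (nbh adj ?U v) + mis i v + card (P i) = card ?U" if i: "i \<in> {1..r}" and v: "v \<in> P i" for i v
  proof -
    have "nbh adj ?U v = nbh adj (?U - P i) v" using indepP[OF i] v by (auto simp: nbh_def indep_def)
    then have "card (nbh adj ?U v) + mis i v = card (?U - P i)"
      using card_nbh_compl[of "?U - P i" adj v] finUP by (simp add: mis_def)
    moreover have "card (?U - P i) + card (P i) = card ?U"
    proof -
      have "P i \<subseteq> ?U" using i by blast
      then show ?thesis using card_Diff_subset[OF finP[OF i]] card_mono[OF finUP] by simp
    qed
    ultimately show ?thesis by simp
  qed
  have "degsum adj ?U = (\<Sum>i\<in>{1..r}. \<Sum>v\<in>P i. card (nbh adj ?U v))" unfolding degsum_def by (rule sum_UP)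
  then have "degsum adj ?U + (\<Sum>i\<in>{1..r}. \<Sum>v\<in>P i. mis i v) + (\<Sum>i\<in>{1..r}. \<Sum>v\<in>P i. card (P i))
    = (\<Sum>i\<in>{1..r}. \<Sum>v\<in>P i. card (nbh adj ?U v) + mis i v + card (P i))"
    by (simp only: sum.distrib)
  also have "\<dots> = (\<Sum>i\<in>{1..r}. \<Sum>v\<in>P i. card ?U)" using * by (intro sum.cong refl)
  also have "\<dots> = (card ?U)\<^sup>2" using card_UP by (simp add: power2_eq_square sum_distrib_right)
  also have "(\<Sum>i\<in>{1..r}. \<Sum>v\<in>P i. card (P i)) = (\<Sum>i\<in>{1..r}. (card (P i))\<^sup>2)" by (simp add: power2_eq_square)
  finally show ?thesis .
qed

lemma degsum_exc_le: "degsum adj exc \<le> (card exc)\<^sup>2"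
  unfolding degsum_def power2_eq_square
  using sum_bounded_above[of exc "\<lambda>v. card (nbh adj exc v)" "card exc"] card_nbh_le[OF finexc] by simp

text \<open>If the sum were smaller by 1, \<open>degsum adj V\<close> would fall short of the main
  terms of \<open>degsum_lower\<close> by 2n/r. Rare types and unequal classes recover at most n/r
  because of \<open>small\<close>, and the bounded terms less than n/r because of
  \<open>large\<close>.\<close>

lemma sum_types_ge:
  assumes T: "\<And>i T'. i \<in> {1..r} \<Longrightarrow> \<kappa> * card V \<le> card (cls i T') \<Longrightarrow> card T' \<le> card (T i)"
    and Texc: "\<And>i. i \<in> {1..r} \<Longrightarrow> T i \<subseteq> exc"
  shows "(r - 1) * card exc + (q - 1) \<le> (\<Sum>i\<in>{1..r}. card (T i))"
proof (rule ccontr)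
  assume "\<not> ?thesis"
  then have lt: "(\<Sum>i\<in>{1..r}. card (T i)) + 1 \<le> (r - 1) * card exc + (q - 1)" by simp
  define n e where "n = real (card V)" and "e = real (card exc)"
  define b where "b i = real (card (T i))" for i
  define Np where "Np = (\<Sum>i\<in>{1..r}. real (card (P i)))"
  have n0: "n \<ge> 0" by (simp add: n_def)
  have rpos: "real r > 0" using r2 by simp
  have eM: "0 \<le> e" "e \<le> M" using card_exc by (auto simp: e_def exc_def)
  have b: "0 \<le> b i" "b i \<le> M" if "i \<in> {1..r}" for i
    using card_mono[OF finexc Texc[OF that]] eM by (auto simp: b_def e_def)
  have sumb: "(\<Sum>i\<in>{1..r}. b i) \<le> (real r - 1) * e + (real q - 2)"
  proof -
    have "real ((\<Sum>i\<in>{1..r}. card (T i)) + 1) \<le> real ((r - 1) * card exc + (q - 1))" using lt by (rule of_nat_mono)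
    then show ?thesis using r2 q1 by (simp add: b_def e_def of_nat_diff)
  qed
  have nN: "n = Np + e" using card_V by (simp add: n_def Np_def e_def)
  have tau_le: "(\<Sum>v\<in>P i. real (card (tau v))) \<le> b i * card (P i) + M * (2 ^ M * (\<kappa> * n))" if i: "i \<in> {1..r}" for i
  proof -
    define X where "X = {v\<in>P i. card {w\<in>P i. tau w = tau v} < \<kappa> * n}"
    have XP: "X \<subseteq> P i" by (auto simp: X_def)
    have "(\<Sum>v\<in>P i. real (card (tau v))) \<le> (\<Sum>v\<in>P i. b i + (if v \<in> X then real M else 0))"
    proof (rule sum_mono)
      fix v assume v: "v \<in> P i"
      show "real (card (tau v)) \<le> b i + (if v \<in> X then real M else 0)"
      proof (cases "v \<in> X")
        case True
        then show ?thesis using card_tau_le[of v] eM b(1)[OF i] by (simp add: e_def)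
      next
        case False
        then have "\<kappa> * card V \<le> card (cls i (tau v))" using v by (simp add: X_def cls_def n_def not_less)
        then show ?thesis using T[OF i] False by (simp add: b_def)
      qed
    qed
    also have "\<dots> = b i * card (P i) + M * card X"
      using finP[OF i] XP by (simp add: sum.distrib sum.If_cases Int_absorb1)
    finally have 1: "(\<Sum>v\<in>P i. real (card (tau v))) \<le> b i * card (P i) + M * real (card X)" by simp
    have "card X \<le> 2 ^ M * (\<kappa> * n)"
    proof -
      have "real (card X) \<le> card (Pow exc) * (\<kappa> * n)" unfolding X_def
        using finP[OF i] finexc tau_subset \<kappa>0 n0 by (intro card_small_fibres_le) auto
      also have "\<dots> \<le> 2 ^ M * (\<kappa> * n)"
      proof (intro mult_right_mono)
        have "real (card (Pow exc)) = 2 ^ card exc" using finexc by (simp add: card_Pow)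
        also have "\<dots> \<le> 2 ^ M" using card_exc by (intro power_increasing) (auto simp: exc_def)
        finally show "real (card (Pow exc)) \<le> 2 ^ M" .
      qed (use \<kappa>0 n0 in auto)
      finally show ?thesis .
    qed
    then have "M * real (card X) \<le> M * (2 ^ M * (\<kappa> * n))" by (intro mult_left_mono) auto
    then show ?thesis using 1 by linarith
  qed
  have "(\<Sum>i\<in>{1..r}. \<Sum>v\<in>P i. real (card (tau v))) \<le> (\<Sum>i\<in>{1..r}. b i * card (P i) + M * (2 ^ M * (\<kappa> * n)))"
    by (intro sum_mono tau_le)
  also have "\<dots> = (\<Sum>i\<in>{1..r}. b i * card (P i)) + r * (M * (2 ^ M * (\<kappa> * n)))" by (simp add: sum.distrib)
  also have "(\<Sum>i\<in>{1..r}. b i * card (P i)) \<le> (\<Sum>i\<in>{1..r}. b i * (n / r) + M * (\<gamma> * n))"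
  proof (rule sum_mono)
    fix i assume i: "i \<in> {1..r}"
    have "card (P i) \<le> n / r + \<gamma> * n" using sizeP[OF i] unfolding n_def by linarith
    then have "b i * card (P i) \<le> b i * (n / r + \<gamma> * n)" using b(1)[OF i] by (intro mult_left_mono)
    also have "\<dots> = b i * (n / r) + b i * (\<gamma> * n)" by (rule distrib_left)
    also have "b i * (\<gamma> * n) \<le> M * (\<gamma> * n)" using b(2)[OF i] \<gamma>0 n0 by (intro mult_right_mono) auto
    finally show "b i * card (P i) \<le> b i * (n / r) + M * (\<gamma> * n)" by simp
  qed
  also have "\<dots> = (\<Sum>i\<in>{1..r}. b i) * (n / r) + r * (M * (\<gamma> * n))"
    by (simp add: sum.distrib sum_distrib_right sum_divide_distrib)
  also have "(\<Sum>i\<in>{1..r}. b i) * (n / r) \<le> ((real r - 1) * e + (real q - 2)) * (n / r)"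
    using sumb n0 by (intro mult_right_mono) auto
  finally have tau_sum: "(\<Sum>i\<in>{1..r}. \<Sum>v\<in>P i. real (card (tau v))) \<le>
    ((real r - 1) * e + (real q - 2)) * (n / r) + r * (M * (\<gamma> * n)) + r * (M * (2 ^ M * (\<kappa> * n)))" by simp
  have "degsum adj (\<Union>i\<in>{1..r}. P i) + (\<Sum>i\<in>{1..r}. (card (P i))\<^sup>2) \<le> (card (\<Union>i\<in>{1..r}. P i))\<^sup>2"
    using degsum_UP by linarith
  from of_nat_mono[OF this, where 'a = real]
  have "real (degsum adj (\<Union>i\<in>{1..r}. P i)) + (\<Sum>i\<in>{1..r}. (real (card (P i)))\<^sup>2) \<le> Np\<^sup>2"
    unfolding card_UP by (simp add: Np_def)
  moreover have "Np\<^sup>2 / r \<le> (\<Sum>i\<in>{1..r}. (real (card (P i)))\<^sup>2)"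
    using sum_squares_ge[of "{1..r}" "\<lambda>i. real (card (P i))"] r2 by (simp add: Np_def)
  ultimately have dP: "real (degsum adj (\<Union>i\<in>{1..r}. P i)) \<le> (n - e)\<^sup>2 - (n - e)\<^sup>2 / r" using nN by simp
  have dE: "real (degsum adj exc) \<le> e\<^sup>2" using of_nat_mono[OF degsum_exc_le, where 'a = real] by (simp add: e_def)
  have "real (degsum adj V) = real (degsum adj (\<Union>i\<in>{1..r}. P i)) + real (degsum adj exc) + 2 * (\<Sum>i\<in>{1..r}. \<Sum>v\<in>P i. real (card (tau v)))"
    using degsum_V by simp
  moreover define Z where "Z = ((real r - 1) * e + (real q - 2)) * (n / r) + r * (M * (\<gamma> * n)) + r * (M * (2 ^ M * (\<kappa> * n)))"
  ultimately have "real (degsum adj V) \<le> (n - e)\<^sup>2 - (n - e)\<^sup>2 / r + e\<^sup>2 + 2 * Z"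
    using dP dE tau_sum[folded Z_def] by linarith
  \<comment> \<open>The terms in e n cancel: leaving out \<open>exc\<close> costs 2 (1 - 1/r) e n,
    and the part (r - 1) e of the sum of the types brings in as much.\<close>
  also have "\<dots> = (1 - 1/r) * n\<^sup>2 + (2 - 1/r) * e\<^sup>2 + 2 * (real q - 1) * n / r - 2 * (n / r) + (2 * r * M * 2 ^ M * \<kappa> + 2 * r * M * \<gamma>) * n"
    using rpos unfolding Z_def by (simp add: power2_eq_square field_simps)
  finally have up: "real (degsum adj V) \<le> (1 - 1/r) * n\<^sup>2 + (2 - 1/r) * e\<^sup>2 + 2 * (real q - 1) * n / r - 2 * (n / r)
    + (2 * r * M * 2 ^ M * \<kappa> + 2 * r * M * \<gamma>) * n" .
  have "(2 * r * M * 2 ^ M * \<kappa> + 2 * r * M * \<gamma>) * n \<le> 1 / r * n" using small n0 by (intro mult_right_mono)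
  moreover have "1 / r * n = n / r" by simp
  moreover have "(2 - 1/r) * e\<^sup>2 \<le> 2 * (real M)\<^sup>2"
    using eM rpos by (intro mult_mono power_mono) auto
  ultimately have "n / r \<le> 2 * real q ^ 2 + real r ^ 3 + 2 * (real M)\<^sup>2"
    using up degsum_lower[OF Vq] unfolding n_def of_nat_power by linarith
  then show False using large by (simp add: n_def)
qed

end

lemma sum_squares_le_square_sum:
  fixes f :: "'i \<Rightarrow> real"
  assumes "finite J" "\<And>j. j \<in> J \<Longrightarrow> 0 \<le> f j"
  shows "(\<Sum>j\<in>J. (f j)\<^sup>2) \<le> (\<Sum>j\<in>J. f j)\<^sup>2"
proof -
  have "(\<Sum>j\<in>J. (f j)\<^sup>2) \<le> (\<Sum>j\<in>J. f j * (\<Sum>j\<in>J. f j))"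
  proof (rule sum_mono)
    fix j assume j: "j \<in> J"
    have "f j \<le> (\<Sum>j\<in>J. f j)" using assms j by (intro member_le_sum) auto
    then show "(f j)\<^sup>2 \<le> f j * (\<Sum>j\<in>J. f j)"
      unfolding power2_eq_square using assms(2)[OF j] by (intro mult_left_mono)
  qed
  then show ?thesis by (simp add: power2_eq_square sum_distrib_right)
qed

context typed_config
begin

text \<open>The terms of the defect bound: \<open>M\<close> for the vertices of \<open>D i\<close>,
  M^2 for the edges inside \<open>exc\<close>, and the rest for vertices whose type occurs fewer
  than \<open>t\<close> times.\<close>

theorem almost_complete_structure:
  "\<exists>W S. V = W \<union> (\<Union>i\<in>{1..r}. S i) \<and> disjoint_family_on S {1..r} \<and> (\<forall>i\<in>{1..r}. W \<inter> S i = {}) \<and>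
     card W = q - 1 \<and>
     (\<forall>i\<in>{1..r}. real (card {v\<in>S i. nbh adj V v \<noteq> V - S i}) \<le> real M + (real M)\<^sup>2 + 2 * r * ((M + 1) * (2 ^ M * t))) \<and>
     (\<forall>i\<in>{1..r}. card V / (2 * r) \<le> card (S i))"
proof -
  obtain T where Tbig: "\<And>i. i \<in> {1..r} \<Longrightarrow> \<kappa> * card V \<le> card (cls i (T i))"
    and Tmax: "\<And>i T'. i \<in> {1..r} \<Longrightarrow> \<kappa> * card V \<le> card (cls i T') \<Longrightarrow> card T' \<le> card (T i)"
    using obtain_types by blast
  have Texc: "T i \<subseteq> exc" if "i \<in> {1..r}" for i
  proof -
    have "0 < \<kappa> * card V" using \<kappa>0 Vpos by simp
    then have "cls i (T i) \<noteq> {}" using Tbig[OF that] by auto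
    then show ?thesis using tau_subset by (auto simp: cls_def)
  qed
  define W where "W = {x\<in>exc. \<forall>j\<in>{1..r}. x \<in> T j}"
  define D where "D i = exc - T i" for i
  have finT: "finite (T i)" if "i \<in> {1..r}" for i using Texc[OF that] finexc finite_subset by blast
  have finD: "finite (D i)" for i using finexc by (simp add: D_def)
  have cD: "card (D i) + card (T i) = card exc" if "i \<in> {1..r}" for i
    using card_Diff_subset[OF finT[OF that] Texc[OF that]] card_mono[OF finexc Texc[OF that]] by (simp add: D_def)
  have cW: "card W \<le> q - 1" unfolding W_def by (rule card_common_types_le[OF Tbig])
  have WD: "W = exc - (\<Union>i\<in>{1..r}. D i)" by (auto simp: W_def D_def)
  have Dexc: "(\<Union>i\<in>{1..r}. D i) \<subseteq> exc" by (auto simp: D_def)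
  have cWD: "card W + card (\<Union>i\<in>{1..r}. D i) = card exc"
    using card_Diff_subset[OF finite_subset[OF Dexc finexc] Dexc] card_mono[OF finexc Dexc] by (simp add: WD)
  have "(\<Sum>i\<in>{1..r}. card (D i)) + (\<Sum>i\<in>{1..r}. card (T i)) = r * card exc"
    using cD by (simp add: sum.distrib[symmetric])
  moreover have "(r - 1) * card exc + (q - 1) \<le> (\<Sum>i\<in>{1..r}. card (T i))" by (rule sum_types_ge[OF Tmax Texc])
  moreover have "r * card exc = (r - 1) * card exc + card exc" using r2 by (cases r) auto
  ultimately have sumD: "(\<Sum>i\<in>{1..r}. card (D i)) + (q - 1) \<le> card exc" by linarith
  \<comment> \<open>The bounds \<open>cW\<close> and \<open>sumD\<close> pull in opposite
    directions: together they force equality in both and the disjointness of the sets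
    \<open>D i\<close>.\<close>
  then have "(\<Sum>i\<in>{1..r}. card (D i)) \<le> card (\<Union>i\<in>{1..r}. D i)" using cWD cW by linarith
  then have disjD: "disjoint_family_on D {1..r}" by (intro disjoint_family_of_card) (auto simp: finD)
  have cUD: "card (\<Union>i\<in>{1..r}. D i) = (\<Sum>i\<in>{1..r}. card (D i))"
    using disjD finD unfolding disjoint_family_on_def by (intro card_UN_disjoint) auto
  have cW': "card W = q - 1" using cWD cW sumD cUD by linarith
  have DT: "x \<in> T j" if "x \<in> D i" "i \<in> {1..r}" "j \<in> {1..r}" "i \<noteq> j" for x i j
    using disjD that unfolding disjoint_family_on_def D_def by blast
  define S where "S i = P i \<union> D i" for i
  have PD: "P i \<inter> D j = {}" if "i \<in> {1..r}" for i j using that by (auto simp: D_def exc_def)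
  have WV: "W \<subseteq> V" by (auto simp: W_def exc_def)
  have excV: "exc \<subseteq> V" by (auto simp: exc_def)
  have excP: "exc \<inter> P i = {}" if "i \<in> {1..r}" for i using that by (auto simp: exc_def)
  have disjS: "disjoint_family_on S {1..r}"
    unfolding disjoint_family_on_def
  proof (intro ballI impI)
    fix i j assume ij: "i \<in> {1..r}" "j \<in> {1..r}" "i \<noteq> j"
    have "D i \<inter> D j = {}" using disjD ij unfolding disjoint_family_on_def by blast
    then show "S i \<inter> S j = {}" using P_disjoint[OF ij] PD[of i j] PD[of j i] ij unfolding S_def by blast
  qed
  have USV: "(\<Union>i\<in>{1..r}. S i) = V - W"
  proof -
    have "(\<Union>i\<in>{1..r}. S i) = (\<Union>i\<in>{1..r}. P i) \<union> (\<Union>i\<in>{1..r}. D i)" by (auto simp: S_def)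
    also have "(\<Union>i\<in>{1..r}. D i) = exc - W" using WD Dexc by blast
    also have "(\<Union>i\<in>{1..r}. P i) \<union> (exc - W) = V - W" using V_decomp WD by blast
    finally show ?thesis .
  qed
  \<comment> \<open>Otherwise some \<open>y\<close> in T' - T i is the centre of a star with
    \<open>t\<close> leaves of type T', while \<open>W\<close> is joined to \<open>t\<close>
    vertices of type \<open>T i\<close>. Since the sets \<open>D j\<close> are disjoint,
    \<open>y\<close> lies in all other \<open>T j\<close> and is joined to the blocks there, against
    \<open>no_star\<close>. In contrast to \<open>Tmax\<close>, only \<open>t\<close> occurrences of
    T' are required.\<close>
  have strict: "card T' < card (T i)" if i: "i \<in> {1..r}" and ne: "T' \<noteq> T i" and big: "t \<le> card (cls i T')" for i T'
  proof (rule ccontr)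
    assume "\<not> card T' < card (T i)"
    then have ge: "card (T i) \<le> card T'" by simp
    have "t > 0" using t1 by simp
    then have "cls i T' \<noteq> {}" using big by auto
    then have T'exc: "T' \<subseteq> exc" using tau_subset by (auto simp: cls_def)
    have "\<not> T' \<subseteq> T i" using ne ge card_seteq[OF finT[OF i]] by blast
    then obtain y where y: "y \<in> T'" "y \<notin> T i" by blast
    have yD: "y \<in> D i" using y T'exc by (auto simp: D_def)
    have "t \<le> card (cls i (T i))" using Tbig[OF i] t_le_\<kappa> by linarith
    then obtain A0 where A0: "A0 \<subseteq> cls i (T i)" "card A0 = t" "finite A0" by (meson obtain_subset_with_card_n)
    obtain B0 where B0: "B0 \<subseteq> cls i T'" "card B0 = t" "finite B0" using big by (meson obtain_subset_with_card_n)
    have sub: "A0 \<union> B0 \<subseteq> P i" using A0 B0 cls_subset by blast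
    have "card (A0 \<union> B0) \<le> 2 * t" using card_Un_le[of A0 B0] A0 B0 by simp
    then obtain A where A: "blocks adj t ({1..r} - {i}) A" "\<forall>j\<in>{1..r} - {i}. A j \<subseteq> cls j (T j)"
      "\<forall>j\<in>{1..r} - {i}. \<forall>x\<in>A0 \<union> B0. \<forall>a\<in>A j. adj x a"
      using select_blocks[OF i sub, of T] Tbig by auto
    have AB: "A0 \<inter> B0 = {}" using A0(1) B0(1) ne by (auto simp: cls_def)
    have yexc: "y \<in> exc" using y T'exc by blast
    show False
    proof (rule no_star[OF WV cW' _ A0(2) _ _ B0(2) AB, of y "{1..r} - {i}" A])
      show "A0 \<subseteq> V" "B0 \<subseteq> V" using sub PV[OF i] by blast+
      show "y \<in> V" using yexc excV by blast
      show "y \<notin> W" using y(2) i by (auto simp: W_def)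
      show "y \<notin> A0" using yexc excP[OF i] sub by blast
      show "W \<inter> B0 = {}" using excP[OF i] sub by (auto simp: W_def)
      show "adj x a" if "x \<in> W" "a \<in> A0" for x a
        using adj_of_cls[of a i "T i" x] A0(1) that i by (auto simp: W_def)
      show "adj y b" if "b \<in> B0" for b using adj_of_cls[of b i T' y] B0(1) that y(1) by blast
      show "card ({1..r} - {i}) = r - 1" using i by simp
      show "A j \<subseteq> V" if "j \<in> {1..r} - {i}" for j
        using A(2) cls_subset[of j "T j"] PV[of j] that by blast
      show "adj x a" if "j \<in> {1..r} - {i}" "a \<in> A j" "x \<in> W \<union> A0 \<union> {y} \<union> B0" for j a x
      proof -
        have a: "a \<in> cls j (T j)" using A(2) that by blast
        have "adj x a" if "x \<in> W" using adj_of_cls[OF a, of x] that \<open>j \<in> {1..r} - {i}\<close> by (auto simp: W_def)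
        moreover have "adj y a" using adj_of_cls[OF a] DT[OF yD i, of j] \<open>j \<in> {1..r} - {i}\<close> by auto
        moreover have "adj x a" if "x \<in> A0 \<union> B0" using A(3) that \<open>j \<in> {1..r} - {i}\<close> \<open>a \<in> A j\<close> by blast
        ultimately show ?thesis using \<open>x \<in> W \<union> A0 \<union> {y} \<union> B0\<close> by blast
      qed
    qed (use A(1) in auto)
  qed
  define e p Np c where "e = real (card exc)" and "p = real (q - 1)"
    and "Np = (\<Sum>i\<in>{1..r}. real (card (P i)))" and "c = (\<Sum>i\<in>{1..r}. real (card (D i)))"
  \<comment> \<open>Rare now means fewer than \<open>t\<close> occurrences. There are at most 2^M *
    t such vertices in a class, and each can exceed the estimate for the other vertices by at most M
    + 1: the size of its type, and 1 for lying in \<open>bad\<close>.\<close>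
  define K where "K = (real M + 1) * (2 ^ M * t)"
  define bad where "bad i = {v\<in>P i. tau v \<noteq> T i}" for i
  have eM: "e \<le> M" using card_exc by (simp add: e_def exc_def)
  have ec: "e = p + c" using cWD cW' cUD by (simp add: e_def p_def c_def flip: of_nat_sum of_nat_add)
  have tau_le: "(\<Sum>v\<in>P i. real (card (tau v))) \<le> (e - card (D i)) * card (P i) - card (bad i) + K" if i: "i \<in> {1..r}" for i
  proof -
    define X where "X = {v\<in>P i. card {w\<in>P i. tau w = tau v} < real t}"
    have XP: "X \<subseteq> P i" "bad i \<subseteq> P i" by (auto simp: X_def bad_def)
    have eD: "real (card (T i)) = e - card (D i)" using cD[OF i] by (simp add: e_def flip: of_nat_add)
    have "(\<Sum>v\<in>P i. real (card (tau v))) \<le>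
      (\<Sum>v\<in>P i. (e - card (D i)) - (if v \<in> bad i then 1 else 0) + (if v \<in> X then real M + 1 else 0))"
    proof (rule sum_mono)
      fix v assume v: "v \<in> P i"
      show "real (card (tau v)) \<le> (e - card (D i)) - (if v \<in> bad i then 1 else 0) + (if v \<in> X then real M + 1 else 0)"
      proof (cases "v \<in> X")
        case True
        have "real (card (tau v)) \<le> M" using card_tau_le[of v] eM by (simp add: e_def)
        moreover have "e - card (D i) \<ge> 0" using eD by (metis of_nat_0_le_iff)
        ultimately show ?thesis using True by simp
      next
        case False
        then have big: "t \<le> card (cls i (tau v))" using v by (simp add: X_def cls_def not_less)
        show ?thesis
        proof (cases "tau v = T i")
          case True
          then show ?thesis using False eD by (simp add: bad_def)
        next
          case ne: False
          have "card (tau v) + 1 \<le> card (T i)" using strict[OF i ne big] by simp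
          then have "real (card (tau v)) + 1 \<le> card (T i)" by (metis of_nat_1 of_nat_add of_nat_le_iff)
          then show ?thesis using False v ne eD by (simp add: bad_def)
        qed
      qed
    qed
    also have "\<dots> = (e - card (D i)) * card (P i) - card (bad i) + (real M + 1) * card X"
      using finP[OF i] XP by (simp add: sum.distrib sum_subtractf sum.If_cases Int_absorb1)
    finally have 1: "(\<Sum>v\<in>P i. real (card (tau v))) \<le> (e - card (D i)) * card (P i) - card (bad i) + (real M + 1) * card X" .
    have "real (card X) \<le> card (Pow exc) * real t" unfolding X_def
      using finP[OF i] finexc tau_subset by (intro card_small_fibres_le) auto
    also have "\<dots> \<le> 2 ^ M * real t"
    proof (intro mult_right_mono)
      have "real (card (Pow exc)) = 2 ^ card exc" using finexc by (simp add: card_Pow)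
      also have "\<dots> \<le> 2 ^ M" using card_exc by (intro power_increasing) (auto simp: exc_def)
      finally show "real (card (Pow exc)) \<le> 2 ^ M" .
    qed auto
    finally have "(real M + 1) * card X \<le> K" unfolding K_def by (intro mult_left_mono) auto
    then show ?thesis using 1 by linarith
  qed
  define Mis where "Mis = (\<Sum>i\<in>{1..r}. \<Sum>v\<in>P i. real (mis i v))"
  define Bad where "Bad = (\<Sum>i\<in>{1..r}. real (card (bad i)))"
  define PP where "PP = (\<Sum>i\<in>{1..r}. (real (card (P i)))\<^sup>2)"
  define DP where "DP = (\<Sum>i\<in>{1..r}. real (card (D i)) * card (P i))"
  define DD where "DD = (\<Sum>i\<in>{1..r}. (real (card (D i)))\<^sup>2)"
  have "(\<Sum>i\<in>{1..r}. \<Sum>v\<in>P i. real (card (tau v))) \<le> (\<Sum>i\<in>{1..r}. (e - card (D i)) * card (P i) - card (bad i) + K)"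
    by (intro sum_mono tau_le)
  also have "\<dots> = e * Np - DP - Bad + r * K"
    by (simp add: sum.distrib sum_subtractf left_diff_distrib Np_def DP_def Bad_def sum_distrib_left)
  finally have tau_sum: "(\<Sum>i\<in>{1..r}. \<Sum>v\<in>P i. real (card (tau v))) \<le> e * Np - DP - Bad + r * K" .
  have dP: "real (degsum adj (\<Union>i\<in>{1..r}. P i)) + Mis + PP = Np\<^sup>2"
    using arg_cong[OF degsum_UP, of real] unfolding card_UP by (simp add: Mis_def PP_def Np_def)
  have dE: "real (degsum adj exc) \<le> e\<^sup>2" using of_nat_mono[OF degsum_exc_le, where 'a = real] by (simp add: e_def)
  have dV: "real (degsum adj V) = real (degsum adj (\<Union>i\<in>{1..r}. P i)) + real (degsum adj exc) + 2 * (\<Sum>i\<in>{1..r}. \<Sum>v\<in>P i. real (card (tau v)))"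
    using degsum_V by simp
  have cS: "real (card (S i)) = card (P i) + card (D i)" if i: "i \<in> {1..r}" for i
    unfolding S_def using card_Un_disjoint[OF finP[OF i] finD PD[OF i]] by simp
  have cVW: "real (card (V - W)) = Np + c"
  proof -
    have "card (V - W) = (\<Sum>i\<in>{1..r}. card (S i))"
      unfolding USV[symmetric] using disjS finP finD unfolding disjoint_family_on_def
      by (intro card_UN_disjoint) (auto simp: S_def)
    then have "real (card (V - W)) = (\<Sum>i\<in>{1..r}. real (card (S i)))" by simp
    also have "\<dots> = (\<Sum>i\<in>{1..r}. real (card (P i)) + card (D i))" using cS by (intro sum.cong) auto
    finally show ?thesis by (simp add: sum.distrib Np_def c_def)
  qed
  have SS: "(\<Sum>i\<in>{1..r}. (real (card (S i)))\<^sup>2) = PP + 2 * DP + DD"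
  proof -
    have "(\<Sum>i\<in>{1..r}. (real (card (S i)))\<^sup>2) = (\<Sum>i\<in>{1..r}. (real (card (P i)))\<^sup>2 + 2 * (card (D i) * card (P i)) + (real (card (D i)))\<^sup>2)"
      using cS by (intro sum.cong refl) (simp add: power2_sum)
    then show ?thesis by (simp add: sum.distrib PP_def DP_def DD_def sum_distrib_left)
  qed
  \<comment> \<open>Comparing with the competitor on the very partition \<open>W, S\<close> makes all terms growing with \<open>|V|\<close> cancel.\<close>
  have "2 * (q - 1) * card (V - W) + (card (V - W))\<^sup>2 \<le> degsum adj V + (\<Sum>i\<in>{1..r}. (card (S i))\<^sup>2)"
    by (rule partition_bound[OF WV cW' disjS USV])
  from of_nat_mono[OF this, where 'a = real]
  have low: "2 * p * (Np + c) + (Np + c)\<^sup>2 \<le> real (degsum adj V) + (PP + 2 * DP + DD)"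
    using cVW SS by (simp add: p_def)
  have "DD \<le> c\<^sup>2" unfolding DD_def c_def by (rule sum_squares_le_square_sum) auto
  moreover have "p * c \<ge> 0" by (simp add: p_def c_def sum_nonneg)
  moreover have "2 * p * (Np + c) + (Np + c)\<^sup>2 = Np\<^sup>2 + 2 * (e * Np) + 2 * (p * c) + c\<^sup>2"
    unfolding ec by (simp add: power2_eq_square algebra_simps)
  ultimately have main: "Mis + 2 * Bad \<le> e\<^sup>2 + 2 * (r * K)"
    using low dV dP dE tau_sum by linarith
  have eM2: "e\<^sup>2 \<le> (real M)\<^sup>2" using eM by (intro power_mono) (auto simp: e_def)
  have bound: "real (card {v\<in>S i. nbh adj V v \<noteq> V - S i}) \<le> real M + (real M)\<^sup>2 + 2 * r * ((M + 1) * (2 ^ M * t))"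
    if i: "i \<in> {1..r}" for i
  proof -
    define Y where "Y = {v\<in>P i. mis i v > 0}"
    have finY: "finite Y" "finite (bad i)" using finP[OF i] by (auto simp: Y_def bad_def)
    \<comment> \<open>A vertex of \<open>P i\<close> of type \<open>T i\<close> that misses nothing
      in the other classes has exactly the neighbours V - S i, because exc - D i = T i.\<close>
    have "{v\<in>S i. nbh adj V v \<noteq> V - S i} \<subseteq> D i \<union> (bad i \<union> Y)"
    proof
      fix v assume v: "v \<in> {v\<in>S i. nbh adj V v \<noteq> V - S i}"
      show "v \<in> D i \<union> (bad i \<union> Y)"
      proof (rule ccontr)
        assume no: "v \<notin> D i \<union> (bad i \<union> Y)"
        then have vP: "v \<in> P i" and tv: "tau v = T i" and mv: "mis i v = 0"
          using v by (auto simp: S_def bad_def Y_def)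
        have "{w\<in>(\<Union>j\<in>{1..r}. P j) - P i. \<not> adj v w} = {}"
          using mv finUP unfolding mis_def by (subst (asm) card_0_eq) auto
        then have 1: "nbh adj (\<Union>j\<in>{1..r}. P j) v = (\<Union>j\<in>{1..r}. P j) - P i"
          using indepP[OF i] vP unfolding nbh_def indep_def by blast
        have "nbh adj V v = nbh adj (\<Union>j\<in>{1..r}. P j) v \<union> tau v"
          using V_decomp(1) unfolding tau_def nbh_def by blast
        also have "\<dots> = ((\<Union>j\<in>{1..r}. P j) - P i) \<union> (exc - D i)"
          using 1 tv Texc[OF i] by (auto simp: D_def)
        also have "\<dots> = V - S i"
          using V_decomp PD[OF i, of i] excP[OF i] i unfolding S_def D_def exc_def by blast
        finally show False using v by simp
      qed
    qed
    then have "card {v\<in>S i. nbh adj V v \<noteq> V - S i} \<le> card (D i \<union> (bad i \<union> Y))"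
      using finY finD by (intro card_mono) auto
    also have "\<dots> \<le> card (D i) + (card (bad i) + card Y)"
      using card_Un_le[of "D i" "bad i \<union> Y"] card_Un_le[of "bad i" Y] by linarith
    finally have 1: "real (card {v\<in>S i. nbh adj V v \<noteq> V - S i}) \<le> real (card (D i)) + (real (card (bad i)) + real (card Y))"
      by (metis of_nat_add of_nat_le_iff)
    have "real (card (D i)) \<le> M"
      using card_mono[OF finexc, of "D i"] eM by (simp add: D_def e_def)
    moreover have "real (card (bad i)) \<le> Bad"
      unfolding Bad_def using i by (intro member_le_sum) auto
    moreover have "real (card Y) \<le> Mis"
    proof -
      have "real (card Y) = (\<Sum>v\<in>Y. 1)" by simp
      also have "\<dots> \<le> (\<Sum>v\<in>Y. real (mis i v))" by (intro sum_mono) (auto simp: Y_def)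
      also have "\<dots> \<le> (\<Sum>v\<in>P i. real (mis i v))"
        using finP[OF i] by (intro sum_mono2) (auto simp: Y_def)
      also have "\<dots> \<le> Mis" unfolding Mis_def using i
        by (intro member_le_sum[of i _ "\<lambda>i. \<Sum>v\<in>P i. real (mis i v)"]) (auto intro: sum_nonneg)
      finally show ?thesis .
    qed
    moreover have "Bad \<ge> 0" by (simp add: Bad_def sum_nonneg)
    moreover have "2 * (r * K) = 2 * r * ((M + 1) * (2 ^ M * t))" by (simp add: K_def distrib_right)
    ultimately show ?thesis using 1 main eM2 by linarith
  qed
  have half: "card V / (2 * r) \<le> card (S i)" if i: "i \<in> {1..r}" for i
  proof -
    define x where "x = real (card V) / r"
    have x: "0 \<le> x" by (simp add: x_def)
    have "\<gamma> * card V \<le> 1 / (4 * real r) * card V" using \<gamma>1 by (intro mult_right_mono) auto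
    also have "\<dots> = x / 4" by (simp add: x_def)
    finally have "x - x / 4 \<le> card (P i)" using sizeP[OF i, folded x_def] by linarith
    moreover have "real (card (S i)) \<ge> card (P i)" using cS[OF i] by simp
    moreover have "card V / (2 * r) = x / 2" by (simp add: x_def)
    ultimately show ?thesis using x by linarith
  qed
  have "V = W \<union> (\<Union>i\<in>{1..r}. S i)" using USV WV by blast
  moreover have "\<forall>i\<in>{1..r}. W \<inter> S i = {}" using USV by blast
  ultimately show ?thesis using disjS cW' bound half by (intro exI[of _ W] exI[of _ S]) blast
qed

end

text \<open>The hierarchy of constants is fixed here: \<open>M\<close> depends on \<open>r\<close>,
  \<open>t\<close>, \<open>q\<close> only, \<kappa> on \<open>M\<close>, \<gamma> on \<kappa>, and
  the bound for |V| comes last. The lower bound on the classes is carried along to guarantee many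
  typical vertices in each of them.\<close>

theorem extremal_structure_bounded_defect:
  fixes r t q :: nat
  assumes "2 \<le> r" "1 \<le> t" "1 \<le> q"
  shows "\<exists>C::real. \<exists>N. \<forall>(adj :: 'b \<Rightarrow> 'b \<Rightarrow> bool) V. extremal_config adj V r t q \<longrightarrow> N \<le> card V \<longrightarrow>
    (\<exists>W S. V = W \<union> (\<Union>i\<in>{1..r}. S i) \<and> disjoint_family_on S {1..r} \<and> (\<forall>i\<in>{1..r}. W \<inter> S i = {}) \<and>
     card W = q - 1 \<and> (\<forall>i\<in>{1..r}. real (card {v\<in>S i. nbh adj V v \<noteq> V - S i}) \<le> C) \<and>
     (\<forall>i\<in>{1..r}. card V / (2 * r) \<le> card (S i)))"
proof -
  obtain M where M: "\<forall>\<gamma>::real. \<gamma> > 0 \<longrightarrow> (\<exists>N. \<forall>(adj :: 'b \<Rightarrow> 'b \<Rightarrow> bool) V. extremal_config adj V r t q \<longrightarrow> N \<le> card V \<longrightarrow>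
    (\<exists>S. disjoint_family_on S {1..r} \<and> (\<forall>i\<in>{1..r}. S i \<subseteq> V \<and> indep adj (S i)) \<and>
      card (V - (\<Union>i\<in>{1..r}. S i)) \<le> M \<and>
      (\<forall>i\<in>{1..r}. \<bar>card (S i) - card V / r\<bar> \<le> \<gamma> * card V \<and>
        (\<forall>v\<in>S i. card {w\<in>V - S i. \<not> adj v w} \<le> \<gamma> * card V))))"
    by (rule exE[OF extremal_structure[OF assms, where 'b = 'b]])
  \<comment> \<open>The factor 2^M cancels the number of types; 8r^2 (M + 1), here and in \<gamma>,
    makes each of the two terms in \<open>small\<close> at most 1/(4r).\<close>
  define \<kappa> where "\<kappa> = 1 / (8 * real r * r * (real M + 1) * 2 ^ M)"
  have rpos: "real r \<ge> 2" "real t \<ge> 1" using assms by simp_all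
  have M1: "real M + 1 > 0" "(2::real) ^ M > 0" by simp_all
  have \<kappa>0: "\<kappa> > 0" using rpos M1 by (simp add: \<kappa>_def)
  have \<kappa>M: "2 ^ M * \<kappa> = 1 / (8 * real r * r * (real M + 1))" using rpos M1 by (simp add: \<kappa>_def)
  have r4: "4 * real r \<le> 8 * real r * r * (real M + 1)"
  proof -
    have "4 * real r * 1 * 1 \<le> (4 * real r) * (2 * real r) * (real M + 1)"
      using rpos M1 by (intro mult_mono) auto
    then show ?thesis by simp
  qed
  have \<kappa>1: "2 ^ M * \<kappa> \<le> 1 / (4 * real r)"
    unfolding \<kappa>M using r4 rpos by (intro divide_left_mono) auto
  \<comment> \<open>By the first entry the two linear terms of \<open>select\<close> take at most a
    quarter of \<kappa> |V|, and half of it suffices for \<open>t\<close> once |V| is large.\<close>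
  define \<gamma> where "\<gamma> = min (\<kappa> / (8 * real t * r)) (1 / (8 * real r * r * (real M + 1)))"
  have \<gamma>0: "\<gamma> > 0" using \<kappa>0 rpos M1 by (simp add: \<gamma>_def)
  have \<gamma>a: "\<gamma> \<le> \<kappa> / (8 * real t * r)" and \<gamma>b: "\<gamma> \<le> 1 / (8 * real r * r * (real M + 1))" by (simp_all add: \<gamma>_def)
  have \<gamma>1: "\<gamma> \<le> 1 / (4 * real r)"
    using \<gamma>b r4 rpos by (intro order_trans[OF \<gamma>b] divide_left_mono) auto
  have quarter: "2 * r * M * (1 / (8 * real r * r * (real M + 1))) \<le> 1 / (4 * real r)"
  proof -
    have "2 * r * M * (1 / (8 * real r * r * (real M + 1))) \<le> 2 * r * (real M + 1) * (1 / (8 * real r * r * (real M + 1)))"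
      using rpos by (intro mult_right_mono) auto
    also have "\<dots> = 1 / (4 * real r)"
    proof -
      have "2 * real r * m * (1 / (8 * real r * r * m)) = 1 / (4 * real r)" if "m > 0" for m
        using that rpos by (simp add: field_simps)
      from this[OF M1(1)] show ?thesis by simp
    qed
    finally show ?thesis .
  qed
  have small: "2 * r * M * 2 ^ M * \<kappa> + 2 * r * M * \<gamma> \<le> 1 / r"
  proof -
    have "2 * r * M * 2 ^ M * \<kappa> = 2 * r * M * (1 / (8 * real r * r * (real M + 1)))"
      unfolding \<kappa>M[symmetric] by simp
    moreover have "2 * r * M * \<gamma> \<le> 2 * r * M * (1 / (8 * real r * r * (real M + 1)))"
      using \<gamma>b by (intro mult_left_mono) auto
    moreover have "1 / (4 * real r) + 1 / (4 * real r) \<le> 1 / real r" using rpos by (simp add: field_simps)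
    ultimately show ?thesis using quarter by linarith
  qed
  obtain N0 where N0: "\<forall>(adj :: 'b \<Rightarrow> 'b \<Rightarrow> bool) V. extremal_config adj V r t q \<longrightarrow> N0 \<le> card V \<longrightarrow>
    (\<exists>S. disjoint_family_on S {1..r} \<and> (\<forall>i\<in>{1..r}. S i \<subseteq> V \<and> indep adj (S i)) \<and>
      card (V - (\<Union>i\<in>{1..r}. S i)) \<le> M \<and>
      (\<forall>i\<in>{1..r}. \<bar>card (S i) - card V / r\<bar> \<le> \<gamma> * card V \<and>
        (\<forall>v\<in>S i. card {w\<in>V - S i. \<not> adj v w} \<le> \<gamma> * card V)))"
    by (rule exE[OF M[THEN spec, THEN mp, OF \<gamma>0]])
  define L where "L = 2 * real q ^ 2 + real r ^ 3 + 2 * (real M)\<^sup>2"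
  define N where "N = N0 + q + nat \<lceil>2 * t / \<kappa>\<rceil> + nat \<lceil>r * (L + 1)\<rceil>"
  show ?thesis
  proof (intro exI[of _ "real M + (real M)\<^sup>2 + 2 * r * ((M + 1) * (2 ^ M * t))"] exI[of _ N] allI impI)
    fix adj :: "'b \<Rightarrow> 'b \<Rightarrow> bool" and V :: "'b set"
    assume conf: "extremal_config adj V r t q" and NV: "N \<le> card V"
    interpret extremal_config adj V r t q by (rule conf)
    have n0: "N0 \<le> card V" "q \<le> card V" using NV unfolding N_def by linarith+
    have "2 * t / \<kappa> \<le> N" "r * (L + 1) \<le> N" unfolding N_def by linarith+
    moreover have "real N \<le> card V" using NV by simp
    ultimately have n1: "2 * t / \<kappa> \<le> card V" "r * (L + 1) \<le> card V" by linarith+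
    from N0[THEN spec, THEN spec, THEN mp, THEN mp, OF conf n0(1)] obtain P where
      P: "disjoint_family_on P {1..r}" "\<forall>i\<in>{1..r}. P i \<subseteq> V \<and> indep adj (P i)"
      "card (V - (\<Union>i\<in>{1..r}. P i)) \<le> M"
      "\<forall>i\<in>{1..r}. \<bar>card (P i) - card V / r\<bar> \<le> \<gamma> * card V \<and>
        (\<forall>v\<in>P i. card {w\<in>V - P i. \<not> adj v w} \<le> \<gamma> * card V)" by (elim exE conjE)
    have sel: "r * (t * (\<gamma> * card V)) + 2 * t * (\<gamma> * card V) + t \<le> \<kappa> * card V"
    proof -
      have "\<gamma> * (8 * real t * r) \<le> \<kappa>" using \<gamma>a rpos by (simp add: field_simps)
      then have "\<gamma> * (8 * real t * r) * card V \<le> \<kappa> * card V" by (intro mult_right_mono) auto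
      then have 1: "8 * (r * (t * (\<gamma> * card V))) \<le> \<kappa> * card V" by (simp add: mult_ac)
      have "2 * (t * (\<gamma> * card V)) \<le> r * (t * (\<gamma> * card V))" using rpos \<gamma>0 by (intro mult_right_mono) auto
      moreover have "t \<le> \<kappa> * card V / 2" using n1(1) \<kappa>0 by (simp add: field_simps)
      moreover have "0 \<le> t * (\<gamma> * card V)" using \<gamma>0 by simp
      moreover have "2 * t * (\<gamma> * card V) = 2 * (t * (\<gamma> * card V))" by simp
      ultimately show ?thesis using 1 by linarith
    qed
    have lar: "2 * real q ^ 2 + real r ^ 3 + 2 * M\<^sup>2 < card V / r"
    proof -
      have "L + 1 \<le> card V / r" using n1(2) rpos by (simp add: field_simps)
      then show ?thesis unfolding L_def by simp
    qed
    interpret typed_config adj V r t q P M \<gamma> \<kappa>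
      by unfold_locales (use P \<gamma>0 \<gamma>1 \<kappa>0 \<kappa>1 sel small lar n0 in auto)
    show "\<exists>W S. V = W \<union> (\<Union>i\<in>{1..r}. S i) \<and> disjoint_family_on S {1..r} \<and> (\<forall>i\<in>{1..r}. W \<inter> S i = {}) \<and>
      card W = q - 1 \<and> (\<forall>i\<in>{1..r}. real (card {v\<in>S i. nbh adj V v \<noteq> V - S i}) \<le> real M + (real M)\<^sup>2 + 2 * r * ((M + 1) * (2 ^ M * t))) \<and>
      (\<forall>i\<in>{1..r}. card V / (2 * r) \<le> card (S i))"
      by (rule almost_complete_structure)
  qed
qed

section \<open>Exact part sizes and the defect bound\<close>

text \<open>A minimal edge cover is a disjoint union of stars, and one edge from each star gives a matching. Below,
  \<open>p e\<close> is an end of \<open>e\<close> covered by no other edge of the cover and \<open>c e\<close> is the other end.\<close>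

lemma (in adjacency) card_le_of_no_matching:
  assumes fin: "finite R" and iso: "\<And>u. u \<in> R \<Longrightarrow> \<exists>w\<in>R. adj u w"
    and deg: "\<And>u. u \<in> R \<Longrightarrow> card (nbh adj R u) \<le> d"
    and nomatch: "\<And>M. matching adj M \<Longrightarrow> \<Union>M \<subseteq> R \<Longrightarrow> card M \<noteq> t"
  shows "card R \<le> (t - 1) * (d + 1)"
proof -
  define Ed where "Ed = {e. \<exists>x\<in>R. \<exists>y\<in>R. e = {x, y} \<and> adj x y}"
  define CC where "CC = {C\<in>Pow Ed. \<Union>C = R}"
  have EdP: "Ed \<subseteq> Pow R" by (auto simp: Ed_def)
  have finEd: "finite Ed" by (rule finite_subset[OF EdP]) (use fin in simp)
  have "\<Union>Ed = R"
  proof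
    show "R \<subseteq> \<Union>Ed"
    proof
      fix x assume x: "x \<in> R"
      then obtain w where w: "w \<in> R" "adj x w" using iso by blast
      then have "{x, w} \<in> Ed" using x unfolding Ed_def by blast
      then show "x \<in> \<Union>Ed" by blast
    qed
  qed (use EdP in auto)
  then have "Ed \<in> CC" by (simp add: CC_def)
  then obtain C where C: "C \<in> CC" and Cmin: "\<And>C'. C' \<in> CC \<Longrightarrow> card C \<le> card C'"
    using ex_has_least_nat[of "\<lambda>C. C \<in> CC" Ed card] by blast
  have CE: "C \<subseteq> Ed" and CR: "\<Union>C = R" using C by (auto simp: CC_def)
  have finC: "finite C" using CE finEd finite_subset by blast
  have "\<exists>p c. e = {p, c} \<and> adj p c \<and> p \<notin> \<Union>(C - {e})" if e: "e \<in> C" for e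
  proof -
    have "\<Union>(C - {e}) \<noteq> R"
    proof
      assume "\<Union>(C - {e}) = R"
      then have "C - {e} \<in> CC" using CE by (auto simp: CC_def)
      from Cmin[OF this] show False using e finC by (metis card_Diff1_less not_less)
    qed
    then obtain p where p: "p \<in> R" "p \<notin> \<Union>(C - {e})" using CR by blast
    then have "p \<in> e" using CR by blast
    moreover obtain x y where xy: "e = {x, y}" "adj x y" using e CE by (auto simp: Ed_def)
    ultimately consider "p = x" | "p = y" by blast
    then show ?thesis
    proof cases
      case 1
      then show ?thesis using xy p by (intro exI[of _ x] exI[of _ y]) simp
    next
      case 2
      then show ?thesis using xy p sym by (intro exI[of _ y] exI[of _ x]) (simp add: insert_commute)
    qed
  qed
  then obtain p c where pc: "\<And>e. e \<in> C \<Longrightarrow> e = {p e, c e} \<and> adj (p e) (c e) \<and> p e \<notin> \<Union>(C - {e})" by metis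
  \<comment> \<open>\<open>Z\<close> consists of the centres of the stars, and \<open>g\<close>
    picks one edge of each star.\<close>
  define Z where "Z = c ` C"
  define g where "g z = (SOME e. e \<in> C \<and> c e = z)" for z
  have g: "g z \<in> C" "c (g z) = z" if "z \<in> Z" for z
    using someI_ex[of "\<lambda>e. e \<in> C \<and> c e = z"] that by (auto simp: Z_def g_def)
  have finZ: "finite Z" using finC by (simp add: Z_def)
  have injg: "inj_on g Z" by (rule inj_onI) (metis g(2))
  have gz: "g z = {p (g z), z}" if "z \<in> Z" for z
    using conjunct1[OF pc[OF g(1)[OF that]]] unfolding g(2)[OF that] .
  \<comment> \<open>A private end lies on no other edge of the cover, and the centres differ, so
    edges picked from different stars cannot meet.\<close>
  have disj: "disjnt (g z) (g z')" if z: "z \<in> Z" "z' \<in> Z" "g z \<noteq> g z'" for z z'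
  proof -
    have 1: "p (g z) \<notin> g z'" "p (g z') \<notin> g z"
      using pc[OF g(1)[OF z(1)]] pc[OF g(1)[OF z(2)]] g(1)[OF z(1)] g(1)[OF z(2)] z(3) by blast+
    have "p (g z) \<notin> {p (g z'), z'}" by (subst gz[OF z(2), symmetric]) (rule 1(1))
    moreover have "p (g z') \<notin> {p (g z), z}" by (subst gz[OF z(1), symmetric]) (rule 1(2))
    moreover have "z \<noteq> z'" using z(3) by blast
    ultimately have "disjnt {p (g z), z} {p (g z'), z'}" by (auto simp: disjnt_def)
    then show ?thesis by (simp only: gz[OF z(1), symmetric] gz[OF z(2), symmetric])
  qed
  have "matching adj (g ` Z)"
    unfolding matching_def
  proof
    show "\<forall>e\<in>g ` Z. \<exists>x y. e = {x, y} \<and> adj x y"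
    proof
      fix e assume "e \<in> g ` Z"
      then have "e \<in> C" using g(1) by auto
      from pc[OF this] have "e = {p e, c e} \<and> adj (p e) (c e)" by (elim conjE) (rule conjI)
      then show "\<exists>x y. e = {x, y} \<and> adj x y" by (intro exI)
    qed
    show "pairwise disjnt (g ` Z)" unfolding pairwise_def using disj by blast
  qed
  have gZR: "\<Union>(g ` Z) \<subseteq> R" using g(1) CR by blast
  have cZ: "card Z \<le> t - 1"
  proof (rule ccontr)
    assume "\<not> card Z \<le> t - 1"
    then have "t \<le> card (g ` Z)" using card_image[OF injg] by simp
    then obtain M' where M': "M' \<subseteq> g ` Z" "card M' = t" by (meson obtain_subset_with_card_n)
    have "matching adj M'" using \<open>matching adj (g ` Z)\<close> M'(1) unfolding matching_def by (meson pairwise_subset subsetD)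
    moreover have "\<Union>M' \<subseteq> R" using M'(1) gZR by blast
    ultimately show False using nomatch M'(2) by blast
  qed
  have Rsub: "R \<subseteq> p ` C \<union> Z"
  proof
    fix x assume "x \<in> R"
    then obtain e where "e \<in> C" "x \<in> e" using CR by blast
    then show "x \<in> p ` C \<union> Z" using pc[of e] by (auto simp: Z_def)
  qed
  have "card R \<le> card (p ` C \<union> Z)" using finC finZ by (intro card_mono Rsub) auto
  also have "\<dots> \<le> card (p ` C) + card Z" by (rule card_Un_le)
  also have "card (p ` C) \<le> card C" by (rule card_image_le[OF finC])
  also have "C = (\<Union>z\<in>Z. {e\<in>C. c e = z})" by (auto simp: Z_def)
  also have "card (\<Union>z\<in>Z. {e\<in>C. c e = z}) \<le> (\<Sum>z\<in>Z. card {e\<in>C. c e = z})" by (rule card_UN_le[OF finZ])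
  also have "\<dots> \<le> of_nat (card Z) * d"
  proof (rule sum_bounded_above)
    fix z assume z: "z \<in> Z"
    have "z \<in> g z" using gz[OF z] by blast
    then have zR: "z \<in> R" using g(1)[OF z] CR by blast
    \<comment> \<open>The private ends of the edges of a star are distinct neighbours of its centre,
      so the star has at most \<open>d\<close> edges.\<close>
    have "inj_on p {e\<in>C. c e = z}"
    proof (rule inj_onI)
      fix e e' assume "e \<in> {e\<in>C. c e = z}" "e' \<in> {e\<in>C. c e = z}" "p e = p e'"
      then show "e = e'" using pc[of e] pc[of e'] by auto
    qed
    then have "card {e\<in>C. c e = z} = card (p ` {e\<in>C. c e = z})" by (simp add: card_image)
    also have "\<dots> \<le> card (nbh adj R z)"
    proof (rule card_mono)
      show "p ` {e\<in>C. c e = z} \<subseteq> nbh adj R z"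
      proof
        fix x assume "x \<in> p ` {e\<in>C. c e = z}"
        then obtain e where e: "e \<in> C" "c e = z" "x = p e" by blast
        then have "x \<in> e" "adj x z" using pc[of e] by auto
        then show "x \<in> nbh adj R z" using CR e(1) sym by (auto simp: nbh_def)
      qed
    qed (use fin in simp)
    also have "\<dots> \<le> d" by (rule deg[OF zR])
    finally show "card {e\<in>C. c e = z} \<le> d" .
  qed
  finally have "card R \<le> card Z * d + card Z" by simp
  also have "\<dots> = card Z * (d + 1)" by simp
  also have "\<dots> \<le> (t - 1) * (d + 1)" using cZ by (rule mult_right_mono) simp
  finally show ?thesis .
qed

text \<open>All sizes are within 1 of \<open>s i\<close>, and \<open>s i\<close> itself is among
  them, so the mean is at distance strictly less than 1 from \<open>s i\<close>. An integer that
  close to a real number is its floor or its ceiling.\<close>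

lemma near_equal_sizes:
  fixes s :: "'i \<Rightarrow> nat"
  assumes "finite J" "i \<in> J" "\<And>j k. j \<in> J \<Longrightarrow> k \<in> J \<Longrightarrow> s j \<le> s k + 1" "real (\<Sum>j\<in>J. s j) = N"
  shows "int (s i) \<in> {\<lfloor>N / card J\<rfloor>, \<lceil>N / card J\<rceil>}"
proof -
  have c: "real (card J) > 0" using assms(1,2) by (auto simp: card_gt_0_iff)
  have split: "(\<Sum>j\<in>J. real (s j)) = s i + (\<Sum>j\<in>J - {i}. real (s j))" using assms(1,2) by (simp add: sum.remove)
  have cc: "real (card (J - {i})) = real (card J) - 1" using assms(1,2) c by (simp add: of_nat_diff)
  have "(\<Sum>j\<in>J - {i}. real (s j)) \<le> of_nat (card (J - {i})) * (real (s i) + 1)"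
  proof (rule sum_bounded_above)
    fix j assume "j \<in> J - {i}"
    then show "real (s j) \<le> real (s i) + 1" using assms(3)[of j i] assms(2) by simp
  qed
  then have up: "N \<le> s i + (real (card J) - 1) * (real (s i) + 1)" using assms(4) split cc by simp
  have "of_nat (card (J - {i})) * (real (s i) - 1) \<le> (\<Sum>j\<in>J - {i}. real (s j))"
  proof (rule sum_bounded_below)
    fix j assume "j \<in> J - {i}"
    then show "real (s i) - 1 \<le> real (s j)" using assms(3)[of i j] assms(2) by simp
  qed
  then have low: "N \<ge> s i + (real (card J) - 1) * (real (s i) - 1)" using assms(4) split cc by simp
  have "N < (real (s i) + 1) * card J" using up c by (simp add: algebra_simps)
  then have 1: "N / card J < real (s i) + 1" using c by (simp add: pos_divide_less_eq)
  have "N > (real (s i) - 1) * card J" using low c by (simp add: algebra_simps)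
  then have 2: "N / card J > real (s i) - 1" using c by (simp add: pos_less_divide_eq)
  show ?thesis
  proof (cases "real (s i) \<le> N / card J")
    case True
    then have "\<lfloor>N / card J\<rfloor> = int (s i)" using 1 by (intro floor_unique) auto
    then show ?thesis by simp
  next
    case False
    then have "\<lceil>N / card J\<rceil> = int (s i)" using 2 by (intro ceiling_unique) auto
    then show ?thesis by simp
  qed
qed

text \<open>The unspecified defect bound \<open>C\<close> is improved to t^2 and the sizes become
  exact. Both rest on t + 1 typical vertices in each class: \<open>t\<close> of them, different from
  a given \<open>u\<close>, can serve as a block or as the set \<open>T\<close> of
  \<open>clone_bound\<close>.\<close>

lemma (in extremal_config) exact_structure:
  fixes C :: real
  assumes VWS: "V = W \<union> (\<Union>i\<in>{1..r}. S i)" and disjS: "disjoint_family_on S {1..r}"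
    and WS: "\<And>i. i \<in> {1..r} \<Longrightarrow> W \<inter> S i = {}" and cW: "card W = q - 1"
    and defect: "\<And>i. i \<in> {1..r} \<Longrightarrow> real (card {v\<in>S i. nbh adj V v \<noteq> V - S i}) \<le> C"
    and size: "\<And>i. i \<in> {1..r} \<Longrightarrow> C + (t + 1) \<le> card (S i)"
    and i: "i \<in> {1..r}"
  shows "card {v\<in>S i. nbh adj V v \<noteq> V - S i} \<le> t\<^sup>2"
    and "int (card (S i)) \<in> {\<lfloor>(real (card V) - real q + 1) / r\<rfloor>, \<lceil>(real (card V) - real q + 1) / r\<rceil>}"
proof -
  define S' where "S' j = {v\<in>S j. nbh adj V v = V - S j}" for j
  define R where "R = {v\<in>S i. nbh adj V v \<noteq> V - S i}"
  have SV: "S j \<subseteq> V" if "j \<in> {1..r}" for j using VWS that by blast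
  have WV: "W \<subseteq> V" using VWS by blast
  have finS: "finite (S j)" if "j \<in> {1..r}" for j using SV[OF that] finV finite_subset by blast
  have SS: "S j \<inter> S k = {}" if "j \<in> {1..r}" "k \<in> {1..r}" "j \<noteq> k" for j k
    using disjS that unfolding disjoint_family_on_def by blast
  have S'S: "S' j \<subseteq> S j" for j by (auto simp: S'_def)
  have adjS': "adj x a" if "a \<in> S' j" "x \<in> V - S j" for a x j
    using that sym by (auto simp: S'_def nbh_def)
  have cS': "t + 1 \<le> card (S' j)" if j: "j \<in> {1..r}" for j
  proof -
    have "S' j \<union> {v\<in>S j. nbh adj V v \<noteq> V - S j} = S j" by (auto simp: S'_def)
    moreover have "card (S' j \<union> {v\<in>S j. nbh adj V v \<noteq> V - S j}) = card (S' j) + card {v\<in>S j. nbh adj V v \<noteq> V - S j}"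
      using finS[OF j] by (intro card_Un_disjoint) (auto simp: S'_def)
    ultimately have "card (S' j) + card {v\<in>S j. nbh adj V v \<noteq> V - S j} = card (S j)" by simp
    then show ?thesis using defect[OF j] size[OF j] by linarith
  qed
  have ex: "\<exists>A. A \<subseteq> S' j - {u} \<and> card A = t \<and> finite A" if j: "j \<in> {1..r}" for j u
  proof -
    have "t \<le> card (S' j - {u})" using cS'[OF j] diff_card_le_card_Diff[of "{u}" "S' j"] by simp
    then show ?thesis by (meson obtain_subset_with_card_n)
  qed
  have "\<forall>j\<in>{1..r}. \<exists>A. A \<subseteq> S' j \<and> card A = t \<and> finite A"
  proof
    fix j assume "j \<in> {1..r}"
    \<comment> \<open>No vertex has to be avoided here; \<open>undefined\<close> stands for an
      arbitrary one.\<close>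
    from ex[OF this, of undefined] obtain A where "A \<subseteq> S' j - {undefined}" "card A = t" "finite A" by (elim exE conjE)
    then show "\<exists>A. A \<subseteq> S' j \<and> card A = t \<and> finite A" by (intro exI[of _ A] conjI) auto
  qed
  from bchoice[OF this] obtain A where A': "\<forall>j\<in>{1..r}. A j \<subseteq> S' j \<and> card (A j) = t \<and> finite (A j)" ..
  have A: "A j \<subseteq> S' j \<and> card (A j) = t \<and> finite (A j)" if "j \<in> {1..r}" for j
    using A' that by (rule bspec)
  have joinA: "adj x a" if "j \<in> {1..r}" "a \<in> A j" "x \<in> V - S j" for j a x
    using adjS'[of a j x] A[OF that(1)] that by blast
  have bl: "blocks adj t ({1..r} - {i}) A"
    unfolding blocks_def
  proof (intro conjI ballI impI)
    fix j k x y assume *: "j \<in> {1..r} - {i}" "k \<in> {1..r} - {i}" "j \<noteq> k" "x \<in> A j" "y \<in> A k"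
    then have "x \<in> V - S k" using A[of j] S'S[of j] SS[of j k] SV[of j] by blast
    then show "adj x y" using joinA[of k y x] * by blast
  qed (use A in auto)
  have AV: "A j \<subseteq> V" if "j \<in> {1..r} - {i}" for j using A[of j] S'S[of j] SV[of j] that by blast
  have SiS: "x \<in> V - S j" if "x \<in> S i" "j \<in> {1..r} - {i}" for x j using that SS[OF i, of j] SV[OF i] by blast
  have RS: "R \<subseteq> S i" by (auto simp: R_def)
  have finR: "finite R" using RS finS[OF i] finite_subset by blast
  have "card R \<le> (t - 1) * ((t - 1) + 1)"
  proof (rule card_le_of_no_matching[OF finR])
    fix M assume M: "matching adj M" "\<Union>M \<subseteq> R"
    show "card M \<noteq> t"
    proof
      assume cM: "card M = t"
      show False
      proof (rule no_matching_joinD[OF no_matching M(1) cM _ _ _ bl AV])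
        show "\<Union>M \<subseteq> V" using M(2) RS SV[OF i] by blast
        show "card ({1..r} - {i}) = r - 1" using i by simp
        show "adj x y" if "j \<in> {1..r} - {i}" "x \<in> \<Union>M" "y \<in> A j" for j x y
          using joinA[of j y x] SiS[of x j] that M(2) RS by blast
      qed auto
    qed
  next
    fix u assume u: "u \<in> R"
    have uS: "u \<in> S i" using u RS by blast
    show "card (nbh adj R u) \<le> t - 1"
    proof (rule ccontr)
      \<comment> \<open>Then \<open>u\<close> is the centre of a star with \<open>t\<close> leaves
        in \<open>R\<close>, while \<open>W\<close> and the typical vertices \<open>A i\<close> form
        the K_{q-1,t} of the graph forbidden by \<open>no_star\<close>.\<close>
      assume "\<not> card (nbh adj R u) \<le> t - 1"
      then have "t \<le> card (nbh adj R u)" by simp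
      then obtain B0 where B0: "B0 \<subseteq> nbh adj R u" "card B0 = t" by (meson obtain_subset_with_card_n)
      have B0R: "B0 \<subseteq> R" by (rule subset_trans[OF B0(1) nbh_subset])
      have Ai: "A i \<subseteq> S' i" "card (A i) = t" using A[OF i] by auto
      have S'R: "S' i \<inter> R = {}" by (auto simp: S'_def R_def)
      show False
      proof (rule no_star[OF WV cW _ Ai(2) _ _ B0(2) _ _ _ _ _ _ _ _ bl AV, of u])
        show "A i \<subseteq> V" using Ai(1) S'S SV[OF i] by blast
        show "u \<in> V" using uS SV[OF i] by blast
        show "B0 \<subseteq> V" using B0R RS SV[OF i] by blast
        show "A i \<inter> B0 = {}" using Ai(1) B0R S'R by blast
        show "u \<notin> W" using uS WS[OF i] by blast
        show "u \<notin> A i" using Ai(1) S'R u by blast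
        show "W \<inter> B0 = {}" using B0R RS WS[OF i] by blast
        show "adj x a" if "x \<in> W" "a \<in> A i" for x a
          using joinA[OF i that(2), of x] that(1) WV WS[OF i] by blast
        show "adj u b" if "b \<in> B0" for b using B0(1) that by (auto simp: nbh_def)
        show "card ({1..r} - {i}) = r - 1" using i by simp
        show "adj x a" if "j \<in> {1..r} - {i}" "a \<in> A j" "x \<in> W \<union> A i \<union> {u} \<union> B0" for j a x
        proof -
          have "x \<in> W \<or> x \<in> S i" using that(3) Ai(1) S'S B0R RS uS by blast
          moreover have "x \<in> V - S j" if "x \<in> W" using that WV WS[of j] \<open>j \<in> {1..r} - {i}\<close> by blast
          ultimately have "x \<in> V - S j" using SiS[of x j] that(1) by blast
          then show ?thesis using joinA[of j a x] that by blast
        qed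
      qed auto
    qed
    show "\<exists>w\<in>R. adj u w"
    proof (rule ccontr)
      \<comment> \<open>Such a \<open>u\<close> has all its neighbours in V - S i, since typical
        vertices of \<open>S i\<close> have none inside \<open>S i\<close>. Cloning typical vertices
        shows that it has at least |V - S i| neighbours, so it would be typical itself.\<close>
      assume no: "\<not> (\<exists>w\<in>R. adj u w)"
      obtain T where T: "T \<subseteq> S' i - {u}" "card T = t" "finite T" using ex[OF i] by blast
      have uV: "u \<in> V" using uS SV[OF i] by blast
      have "T \<subseteq> V - {u}" using T(1) S'S SV[OF i] by blast
      from clone_bound[OF uV this T(2)]
      have 1: "card {w\<in>V - {u}. \<forall>v\<in>T. adj v w} \<le> card (nbh adj V u)" .
      have "V - S i \<subseteq> {w\<in>V - {u}. \<forall>v\<in>T. adj v w}"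
        using T(1) uS by (auto simp: S'_def nbh_def)
      then have "card (V - S i) \<le> card {w\<in>V - {u}. \<forall>v\<in>T. adj v w}" using finV by (intro card_mono) auto
      with 1 have ge: "card (V - S i) \<le> card (nbh adj V u)" by simp
      have "nbh adj V u \<subseteq> V - S i"
      proof
        fix w assume w: "w \<in> nbh adj V u"
        then have wu: "w \<in> V" "adj u w" by (auto simp: nbh_def)
        have "w \<notin> R" using no wu by blast
        moreover have "w \<notin> S' i"
        proof
          assume "w \<in> S' i"
          then have "u \<in> V - S i" using wu uV sym by (auto simp: S'_def nbh_def)
          then show False using uS by simp
        qed
        ultimately show "w \<in> V - S i" using wu by (auto simp: R_def S'_def)
      qed
      then have "nbh adj V u = V - S i" using ge finV by (intro card_seteq) auto
      then show False using u by (simp add: R_def)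
    qed
  qed
  also have "\<dots> \<le> t * t" using t1 by (intro mult_mono) auto
  finally show "card {v\<in>S i. nbh adj V v \<noteq> V - S i} \<le> t\<^sup>2" by (simp add: R_def power2_eq_square)
  \<comment> \<open>Cloning moves a typical vertex \<open>u\<close> of \<open>S j\<close> into class
    \<open>k\<close>. It would have at least |V - S k| - 1 neighbours there, \<open>u\<close> itself
    being left out, as against |V - S j| now.\<close>
  have near: "card (S j) \<le> card (S k) + 1" if jk: "j \<in> {1..r}" "k \<in> {1..r}" for j k
  proof (cases "j = k")
    case False
    have "S' j \<noteq> {}" using cS'[OF jk(1)] by auto
    then obtain u where u: "u \<in> S' j" by blast
    then have uV: "u \<in> V" "u \<in> S j" and nu: "nbh adj V u = V - S j" using SV[OF jk(1)] by (auto simp: S'_def)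
    have uk: "u \<notin> S k" using SS[OF jk False] uV(2) by blast
    obtain T where T: "T \<subseteq> S' k - {u}" "card T = t" "finite T" using ex[OF jk(2)] by blast
    have "T \<subseteq> V - {u}" using T(1) S'S SV[OF jk(2)] by blast
    from clone_bound[OF uV(1) this T(2)]
    have 1: "card {w\<in>V - {u}. \<forall>v\<in>T. adj v w} \<le> card (V - S j)" using nu by simp
    have "V - S k - {u} \<subseteq> {w\<in>V - {u}. \<forall>v\<in>T. adj v w}" using T(1) by (auto simp: S'_def nbh_def)
    then have "card (V - S k - {u}) \<le> card {w\<in>V - {u}. \<forall>v\<in>T. adj v w}" using finV by (intro card_mono) auto
    with 1 have "card (V - S k - {u}) \<le> card (V - S j)" by simp
    moreover have "card (V - S k - {u}) + 1 = card (V - S k)"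
      using uV(1) uk finV by (metis Diff_iff Suc_eq_plus1 card_Suc_Diff1 finite_Diff)
    moreover have "card (V - S k) + card (S k) = card V" "card (V - S j) + card (S j) = card V"
      using card_Diff_subset[OF finS SV] card_mono[OF finV SV] jk by auto
    ultimately show ?thesis by linarith
  qed simp
  have "card V = card W + card (\<Union>j\<in>{1..r}. S j)"
    using VWS WS finV finS by (metis (no_types, lifting) card_Un_disjoint finite_Un UN_iff disjoint_iff)
  also have "card (\<Union>j\<in>{1..r}. S j) = (\<Sum>j\<in>{1..r}. card (S j))"
    using finS SS by (intro card_UN_disjoint) auto
  finally have "real (\<Sum>j\<in>{1..r}. card (S j)) = real (card V) - real q + 1"
    using cW q1 by (simp add: of_nat_diff)
  from near_equal_sizes[OF _ i near this]
  show "int (card (S i)) \<in> {\<lfloor>(real (card V) - real q + 1) / r\<rfloor>, \<lceil>(real (card V) - real q + 1) / r\<rceil>}"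
    by simp
qed

theorem extremal_config_structure:
  fixes r t q :: nat
  assumes "2 \<le> r" "1 \<le> t" "1 \<le> q"
  shows "\<exists>N. \<forall>(adj :: 'b \<Rightarrow> 'b \<Rightarrow> bool) V. extremal_config adj V r t q \<longrightarrow> N \<le> card V \<longrightarrow>
    (\<exists>W S. V = W \<union> (\<Union>i\<in>{1..r}. S i) \<and> disjoint_family_on S {1..r} \<and> (\<forall>i\<in>{1..r}. W \<inter> S i = {}) \<and>
     card W = q - 1 \<and>
     (\<forall>i\<in>{1..r}. int (card (S i)) \<in> {\<lfloor>(real (card V) - real q + 1) / r\<rfloor>, \<lceil>(real (card V) - real q + 1) / r\<rceil>}) \<and>
     (\<forall>i\<in>{1..r}. \<exists>S'\<subseteq>S i. card (S i - S') \<le> t\<^sup>2 \<and> (\<forall>v\<in>S'. nbh adj V v = V - S i)))"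
proof -
  obtain C :: real and N0 where C: "\<forall>(adj :: 'b \<Rightarrow> 'b \<Rightarrow> bool) V. extremal_config adj V r t q \<longrightarrow> N0 \<le> card V \<longrightarrow>
    (\<exists>W S. V = W \<union> (\<Union>i\<in>{1..r}. S i) \<and> disjoint_family_on S {1..r} \<and> (\<forall>i\<in>{1..r}. W \<inter> S i = {}) \<and>
     card W = q - 1 \<and> (\<forall>i\<in>{1..r}. real (card {v\<in>S i. nbh adj V v \<noteq> V - S i}) \<le> C) \<and>
     (\<forall>i\<in>{1..r}. card V / (2 * r) \<le> card (S i)))"
    using extremal_structure_bounded_defect[OF assms, where 'b = 'b] by (elim exE) (rule that)
  define N where "N = N0 + nat \<lceil>2 * r * (C + (t + 1))\<rceil>"
  show ?thesis
  proof (intro exI[of _ N] allI impI)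
    fix adj :: "'b \<Rightarrow> 'b \<Rightarrow> bool" and V :: "'b set"
    assume conf: "extremal_config adj V r t q" and NV: "N \<le> card V"
    interpret extremal_config adj V r t q by (rule conf)
    have n0: "N0 \<le> card V" using NV unfolding N_def by linarith
    from C[THEN spec, THEN spec, THEN mp, THEN mp, OF conf n0] obtain W S where
      WS: "V = W \<union> (\<Union>i\<in>{1..r}. S i)" "disjoint_family_on S {1..r}" "\<forall>i\<in>{1..r}. W \<inter> S i = {}"
      "card W = q - 1" "\<forall>i\<in>{1..r}. real (card {v\<in>S i. nbh adj V v \<noteq> V - S i}) \<le> C"
      "\<forall>i\<in>{1..r}. card V / (2 * r) \<le> card (S i)" by (elim exE conjE)
    have "2 * r * (C + (t + 1)) \<le> N" unfolding N_def by linarith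
    then have "2 * r * (C + (t + 1)) \<le> card V" using NV by linarith
    then have "C + (t + 1) \<le> card V / (2 * r)" using assms(1) by (simp add: field_simps)
    then have size: "C + (t + 1) \<le> card (S i)" if "i \<in> {1..r}" for i using WS(6) that by fastforce
    have main: "card {v\<in>S i. nbh adj V v \<noteq> V - S i} \<le> t\<^sup>2"
      "int (card (S i)) \<in> {\<lfloor>(real (card V) - real q + 1) / r\<rfloor>, \<lceil>(real (card V) - real q + 1) / r\<rceil>}"
      if "i \<in> {1..r}" for i
      using exact_structure[OF WS(1,2) _ WS(4) _ size that] WS(3,5) by blast+
    have exS: "\<exists>S'\<subseteq>S i. card (S i - S') \<le> t\<^sup>2 \<and> (\<forall>v\<in>S'. nbh adj V v = V - S i)" if i: "i \<in> {1..r}" for i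
    proof (intro exI[of _ "{v\<in>S i. nbh adj V v = V - S i}"] conjI)
      have "S i - {v\<in>S i. nbh adj V v = V - S i} = {v\<in>S i. nbh adj V v \<noteq> V - S i}" by blast
      then show "card (S i - {v\<in>S i. nbh adj V v = V - S i}) \<le> t\<^sup>2" using main(1)[OF i] by simp
    qed auto
    show "\<exists>W S. V = W \<union> (\<Union>i\<in>{1..r}. S i) \<and> disjoint_family_on S {1..r} \<and> (\<forall>i\<in>{1..r}. W \<inter> S i = {}) \<and>
     card W = q - 1 \<and>
     (\<forall>i\<in>{1..r}. int (card (S i)) \<in> {\<lfloor>(real (card V) - real q + 1) / r\<rfloor>, \<lceil>(real (card V) - real q + 1) / r\<rceil>}) \<and>
     (\<forall>i\<in>{1..r}. \<exists>S'\<subseteq>S i. card (S i - S') \<le> t\<^sup>2 \<and> (\<forall>v\<in>S'. nbh adj V v = V - S i))"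
      by (rule exI[of _ W], rule exI[of _ S]) (intro conjI WS(1-4) ballI main(2) exS)
  qed
qed

section \<open>From graphs to adjacency relations\<close>

definition edge_rel :: "'a graph \<Rightarrow> 'a \<Rightarrow> 'a \<Rightarrow> bool" where
  "edge_rel G u v \<longleftrightarrow> {u, v} \<in> edges G"

lemma inj_on_case_sum:
  assumes "inj_on f A" "inj_on g B" "f ` A \<inter> g ` B = {}"
  shows "inj_on (case_sum f g) (A <+> B)"
proof (rule inj_onI)
  fix x y assume xy: "x \<in> A <+> B" "y \<in> A <+> B" "case_sum f g x = case_sum f g y"
  have ne: "f a \<noteq> g b" if "a \<in> A" "b \<in> B" for a b using assms(3) that by blast
  show "x = y"
  proof (cases x; cases y)
    fix a b assume "x = Inl a" "y = Inl b"
    then show ?thesis using xy inj_onD[OF assms(1), of a b] by auto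
  next
    fix a b assume "x = Inr a" "y = Inr b"
    then show ?thesis using xy inj_onD[OF assms(2), of a b] by auto
  next
    fix a b assume "x = Inl a" "y = Inr b"
    then show ?thesis using xy ne[of a b] by auto
  next
    fix a b assume "x = Inr a" "y = Inl b"
    then show ?thesis using xy ne[of b a] by auto
  qed
qed

lemma obtain_bij_lessThan:
  assumes "finite A" "card A = n"
  obtains h where "bij_betw h {..<n} A"
  using ex_bij_betw_nat_finite[OF assms(1)] assms(2) by (auto simp: lessThan_atLeast0)

lemma simple_graphD:
  assumes "simple_graph G"
  shows "finite (verts G)" "e \<in> edges G \<Longrightarrow> e \<subseteq> verts G" "e \<in> edges G \<Longrightarrow> card e = 2"
  using assms unfolding simple_graph_def by blast+

lemma simple_graph_edgeE:
  assumes "simple_graph G" "e \<in> edges G"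
  obtains u v where "e = {u, v}" "u \<noteq> v" "u \<in> verts G" "v \<in> verts G"
proof -
  obtain u v where "e = {u, v}" "u \<noteq> v" using simple_graphD(3)[OF assms] by (auto simp: card_2_iff)
  then show thesis using that simple_graphD(2)[OF assms] by auto
qed

lemma adjacency_edge_rel:
  assumes "simple_graph G"
  shows "adjacency (edge_rel G)"
proof
  show "edge_rel G y x" if "edge_rel G x y" for x y using that by (simp add: edge_rel_def insert_commute)
  show "\<not> edge_rel G x x" for x using simple_graphD(3)[OF assms, of "{x}"] by (auto simp: edge_rel_def)
qed

lemma edge_rel_verts:
  assumes "simple_graph G" "edge_rel G u v"
  shows "u \<in> verts G" "v \<in> verts G"
  using simple_graphD(2)[OF assms(1), of "{u, v}"] assms(2) by (auto simp: edge_rel_def)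

lemma neighbourhood_eq_nbh:
  assumes "simple_graph G"
  shows "neighbourhood G v = nbh (edge_rel G) (verts G) v"
  using edge_rel_verts[OF assms] unfolding neighbourhood_def nbh_def edge_rel_def
  by (auto simp: insert_commute)

lemma finite_edges:
  assumes "simple_graph G"
  shows "finite (edges G)"
  by (rule finite_subset[of _ "Pow (verts G)"]) (use simple_graphD[OF assms] in auto)

lemma card_incident_edges:
  assumes "simple_graph G"
  shows "card {e\<in>edges G. v \<in> e} = card (nbh (edge_rel G) (verts G) v)"
proof -
  have "{e\<in>edges G. v \<in> e} = (\<lambda>u. {v, u}) ` nbh (edge_rel G) (verts G) v"
  proof
    show "{e\<in>edges G. v \<in> e} \<subseteq> (\<lambda>u. {v, u}) ` nbh (edge_rel G) (verts G) v"
    proof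
      fix e assume e: "e \<in> {e\<in>edges G. v \<in> e}"
      then obtain x y where xy: "e = {x, y}" "x \<noteq> y" "x \<in> verts G" "y \<in> verts G"
        using simple_graph_edgeE[OF assms, of e] by blast
      then have "e = {v, x} \<or> e = {v, y}" using e by auto
      then show "e \<in> (\<lambda>u. {v, u}) ` nbh (edge_rel G) (verts G) v"
        using e xy(3,4) by (auto simp: nbh_def edge_rel_def)
    qed
  qed (auto simp: nbh_def edge_rel_def)
  moreover have "inj_on (\<lambda>u. {v, u}) (nbh (edge_rel G) (verts G) v)"
    by (rule inj_onI) (auto simp: doubleton_eq_iff)
  ultimately show ?thesis by (simp add: card_image)
qed

lemma handshake:
  assumes "simple_graph G"
  shows "degsum (edge_rel G) (verts G) = 2 * card (edges G)"
proof -
  note fin = simple_graphD(1)[OF assms] finite_edges[OF assms]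
  have "degsum (edge_rel G) (verts G) = (\<Sum>v\<in>verts G. card {e\<in>edges G. v \<in> e})"
    unfolding degsum_def using card_incident_edges[OF assms] by simp
  also have "\<dots> = (\<Sum>v\<in>verts G. \<Sum>e\<in>edges G. if v \<in> e then 1 else 0)"
    using fin by (simp add: sum.If_cases Int_def)
  also have "\<dots> = (\<Sum>e\<in>edges G. \<Sum>v\<in>verts G. if v \<in> e then 1 else 0)" by (rule sum.swap)
  also have "\<dots> = (\<Sum>e\<in>edges G. 2)"
  proof (rule sum.cong[OF refl])
    fix e assume e: "e \<in> edges G"
    then have "{v \<in> verts G. v \<in> e} = e" using simple_graphD(2)[OF assms] by blast
    then show "(\<Sum>v\<in>verts G. if v \<in> e then 1 else 0) = (2::nat)"
      using fin simple_graphD(3)[OF assms e] by (simp add: sum.If_cases Int_def)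
  qed
  finally show ?thesis by simp
qed

section \<open>Copies of joins and of their factors\<close>

lemma has_copyE:
  assumes "F \<subseteq>\<^sub>G G"
  obtains f where "inj_on f (verts F)" "f ` verts F \<subseteq> verts G" "\<And>e. e \<in> edges F \<Longrightarrow> f ` e \<in> edges G"
proof -
  obtain f where "inj_on f (verts F) \<and> f ` verts F \<subseteq> verts G \<and> (\<forall>e\<in>edges F. f ` e \<in> edges G)"
    using assms unfolding has_copy_def ..
  then show thesis by (intro that[of f]) auto
qed

lemma has_copy_trans:
  assumes "F \<subseteq>\<^sub>G G" "G \<subseteq>\<^sub>G H"
  shows "F \<subseteq>\<^sub>G H"
proof -
  obtain f where f: "inj_on f (verts F)" "f ` verts F \<subseteq> verts G" "\<And>e. e \<in> edges F \<Longrightarrow> f ` e \<in> edges G"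
    by (rule has_copyE[OF assms(1)], rule that)
  obtain g where g: "inj_on g (verts G)" "g ` verts G \<subseteq> verts H" "\<And>e. e \<in> edges G \<Longrightarrow> g ` e \<in> edges H"
    by (rule has_copyE[OF assms(2)], rule that)
  have "inj_on (g \<circ> f) (verts F)" by (rule comp_inj_on[OF f(1) inj_on_subset[OF g(1) f(2)]])
  moreover have "(g \<circ> f) ` verts F \<subseteq> verts H" using f(2) g(2) by (auto simp: image_subset_iff)
  moreover have "\<forall>e\<in>edges F. (g \<circ> f) ` e \<in> edges H" using f(3) g(3) unfolding image_comp[symmetric] by blast
  ultimately show ?thesis unfolding has_copy_def by (intro exI[of _ "g \<circ> f"] conjI)
qed

text \<open>Fitted to the encoding of \<open>turan_graph\<close>: the residue of \<open>i\<close>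
  selects the block, the quotient the vertex in it.\<close>

lemma blocks_parametrization:
  assumes "finite J" "card J = k" "blocks adj t J A"
  obtains g where "\<And>i. i < t * k \<Longrightarrow> \<exists>j\<in>J. g i \<in> A j"
    "\<And>i i'. i < t * k \<Longrightarrow> i' < t * k \<Longrightarrow> i mod k \<noteq> i' mod k \<Longrightarrow> adj (g i) (g i')"
    "\<And>i i'. i < t * k \<Longrightarrow> i' < t * k \<Longrightarrow> i mod k = i' mod k \<Longrightarrow> g i = g i' \<Longrightarrow> i = i'"
proof -
  obtain ix where ix: "bij_betw ix {..<k} J" using obtain_bij_lessThan[OF assms(1,2)] .
  have "\<forall>j\<in>J. \<exists>e. bij_betw e {..<t} (A j)"
  proof
    fix j assume "j \<in> J"
    then have "finite (A j)" "card (A j) = t" using assms(3) by (auto simp: blocks_def)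
    then obtain e where "bij_betw e {..<t} (A j)" by (rule obtain_bij_lessThan)
    then show "\<exists>e. bij_betw e {..<t} (A j)" by blast
  qed
  from bchoice[OF this] obtain en where en: "\<forall>j\<in>J. bij_betw (en j) {..<t} (A j)" ..
  define g where "g i = en (ix (i mod k)) (i div k)" for i
  have mk: "i mod k < k" "i div k < t" if "i < t * k" for i
  proof -
    have "k > 0" using that by (cases k) auto
    then show "i mod k < k" by simp
    show "i div k < t" using that by (simp add: less_mult_imp_div_less)
  qed
  have ixJ: "ix (i mod k) \<in> J" if "i < t * k" for i
    using mk(1)[OF that] ix by (auto simp: bij_betw_def)
  have gA: "g i \<in> A (ix (i mod k))" if "i < t * k" for i
    using en ixJ[OF that] mk(2)[OF that] unfolding g_def bij_betw_def by blast
  show thesis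
  proof (rule that[of g])
    show "\<exists>j\<in>J. g i \<in> A j" if "i < t * k" for i using gA ixJ that by blast
    show "adj (g i) (g i')" if "i < t * k" "i' < t * k" "i mod k \<noteq> i' mod k" for i i'
    proof -
      have "ix (i mod k) \<noteq> ix (i' mod k)"
        using ix mk(1)[OF that(1)] mk(1)[OF that(2)] that(3) by (auto simp: bij_betw_def inj_on_def)
      then show ?thesis using blocks_adj[OF assms(3) ixJ ixJ] gA that by blast
    qed
    show "i = i'" if "i < t * k" "i' < t * k" "i mod k = i' mod k" "g i = g i'" for i i'
    proof -
      have "inj_on (en (ix (i mod k))) {..<t}" using en ixJ[OF that(1)] by (auto simp: bij_betw_def)
      then have "i div k = i' div k"
        using that mk(2)[OF that(1)] mk(2)[OF that(2)] unfolding g_def inj_on_def by auto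
      then show ?thesis using that(3) by (metis div_mult_mod_eq)
    qed
  qed
qed

text \<open>The maps on the two factors combine to an injection because completely joined sets are
  disjoint by irreflexivity; the same argument separates the residue classes.\<close>

lemma copy_of_join_turan:
  assumes G: "simple_graph G" and f: "inj_on f (verts B)" "f ` verts B \<subseteq> verts G" "\<And>e. e \<in> edges B \<Longrightarrow> f ` e \<in> edges G"
    and J: "finite J" "card J = k" and A: "blocks (edge_rel G) t J A" "\<And>j. j \<in> J \<Longrightarrow> A j \<subseteq> verts G"
    and join: "\<And>j x a. j \<in> J \<Longrightarrow> x \<in> f ` verts B \<Longrightarrow> a \<in> A j \<Longrightarrow> edge_rel G x a"
  shows "B \<otimes>\<^sub>G turan_graph (t * k) k \<subseteq>\<^sub>G G"
proof -
  interpret adjacency "edge_rel G" by (rule adjacency_edge_rel[OF G])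
  obtain g where g: "\<And>i. i < t * k \<Longrightarrow> \<exists>j\<in>J. g i \<in> A j"
    "\<And>i i'. i < t * k \<Longrightarrow> i' < t * k \<Longrightarrow> i mod k \<noteq> i' mod k \<Longrightarrow> edge_rel G (g i) (g i')"
    "\<And>i i'. i < t * k \<Longrightarrow> i' < t * k \<Longrightarrow> i mod k = i' mod k \<Longrightarrow> g i = g i' \<Longrightarrow> i = i'"
    using blocks_parametrization[OF J A(1)] by blast
  have injg: "i = i'" if "i < t * k" "i' < t * k" "g i = g i'" for i i'
    using g(2)[OF that(1,2)] g(3)[OF that(1,2)] that(3) irrefl by metis
  have fg: "edge_rel G (f x) (g i)" if "x \<in> verts B" "i < t * k" for x i
    using g(1)[OF that(2)] join that(1) by blast
  define h where "h = case_sum f g"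
  have vj: "verts (B \<otimes>\<^sub>G turan_graph (t * k) k) = verts B <+> {..<t * k}"
    by (simp add: graph_join_def graph_union_def turan_graph_def)
  have inj: "inj_on h (verts B <+> {..<t * k})"
    unfolding h_def
  proof (rule inj_on_case_sum[OF f(1)])
    show "inj_on g {..<t * k}" by (rule inj_onI) (use injg in auto)
    have ne: "f b \<noteq> g i" if "b \<in> verts B" "i < t * k" for b i using fg[OF that] irrefl by metis
    then show "f ` verts B \<inter> g ` {..<t * k} = {}" by blast
  qed
  have verts: "h ` (verts B <+> {..<t * k}) \<subseteq> verts G"
  proof
    fix z assume "z \<in> h ` (verts B <+> {..<t * k})"
    then obtain x where x: "x \<in> verts B <+> {..<t * k}" "z = h x" by blast
    show "z \<in> verts G"
    proof (cases x)
      case (Inl a)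
      then show ?thesis using x f(2) by (auto simp: h_def)
    next
      case (Inr i)
      then have "i < t * k" using x by auto
      then show ?thesis using g(1) A(2) Inr x(2) by (auto simp: h_def)
    qed
  qed
  have "h ` e \<in> edges G" if "e \<in> edges (B \<otimes>\<^sub>G turan_graph (t * k) k)" for e
  proof -
    consider (l) e' where "e' \<in> edges B" "e = Inl ` e'"
      | (r) i j where "i < t * k" "j < t * k" "i mod k \<noteq> j mod k" "e = Inr ` {i, j}"
      | (c) u i where "u \<in> verts B" "i < t * k" "e = {Inl u, Inr i}"
      using \<open>e \<in> edges _\<close> unfolding graph_join_def graph_union_def turan_graph_def by auto
    then show ?thesis
    proof cases
      case l
      then show ?thesis using f(3) by (simp add: h_def image_image)
    next
      case r
      then show ?thesis using g(2)[of i j] by (simp add: h_def edge_rel_def)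
    next
      case c
      then show ?thesis using fg[of u i] by (simp add: h_def edge_rel_def)
    qed
  qed
  then show ?thesis unfolding has_copy_def vj using inj verts by blast
qed

text \<open>Class 0 goes into the edgeless factor and class c > 0 to the residue c - 1; as |F| \<le>
  t, there are enough quotients to keep the vertices of a class apart. The lemma serves twice: to
  show that \<open>q\<close> is attained, and that the first competitor contains no member of the
  family.\<close>

lemma copy_in_join_turan_of_classes:
  assumes F: "simple_graph F" and t: "card (verts F) \<le> t" and r: "0 < r"
    and cl: "\<And>x. x \<in> verts F \<Longrightarrow> cl x \<le> r" "\<And>u v. {u, v} \<in> edges F \<Longrightarrow> cl u \<noteq> cl v"
    and s: "card {x\<in>verts F. cl x = 0} \<le> s"
  shows "F \<subseteq>\<^sub>G edgeless_graph s \<otimes>\<^sub>G turan_graph (t * r) r"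
proof -
  note finF = simple_graphD(1)[OF F]
  obtain a where a: "inj_on a {x\<in>verts F. cl x = 0}" "a ` {x\<in>verts F. cl x = 0} \<subseteq> {..<s}"
    using card_le_inj[of "{x\<in>verts F. cl x = 0}" "{..<s}"] finF s by auto
  obtain b where b: "inj_on b (verts F)" "b ` verts F \<subseteq> {..<t}"
    using card_le_inj[of "verts F" "{..<t}"] finF t by auto
  define g where "g x = b x * r + (cl x - 1)" for x
  define h where "h x = (if cl x = 0 then Inl (a x) else Inr (g x))" for x
  have gm: "g x mod r = cl x - 1" "g x div r = b x" if "x \<in> verts F" for x
    using cl(1)[OF that] r by (auto simp: g_def)
  have gl: "g x < t * r" if "x \<in> verts F" for x
  proof -
    have "b x < t" using b(2) that by auto
    then have "b x * r + r \<le> t * r" by (metis Suc_leI add.commute mult_Suc mult_le_mono1)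
    moreover have "cl x - 1 < r" using cl(1)[OF that] r by simp
    ultimately show ?thesis unfolding g_def by linarith
  qed
  have "inj_on h (verts F)"
  proof (rule inj_onI)
    fix x y assume xy: "x \<in> verts F" "y \<in> verts F" "h x = h y"
    show "x = y"
    proof (cases "cl x = 0")
      case True
      then have "cl y = 0" "a x = a y" using xy(3) by (auto simp: h_def split: if_splits)
      then show ?thesis using a(1) xy True by (auto simp: inj_on_def)
    next
      case False
      then have "g x = g y" using xy(3) by (auto simp: h_def split: if_splits)
      then have "b x = b y" using gm(2) xy by metis
      then show ?thesis using b(1) xy by (auto simp: inj_on_def)
    qed
  qed
  moreover have "h ` verts F \<subseteq> verts (edgeless_graph s \<otimes>\<^sub>G turan_graph (t * r) r)"
    using a(2) gl by (auto simp: h_def graph_join_def graph_union_def turan_graph_def edgeless_graph_def)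
  moreover have "h ` e \<in> edges (edgeless_graph s \<otimes>\<^sub>G turan_graph (t * r) r)" if e: "e \<in> edges F" for e
  proof -
    obtain u v where uv: "e = {u, v}" "u \<noteq> v" "u \<in> verts F" "v \<in> verts F"
      using simple_graph_edgeE[OF F e] by blast
    have ne: "cl u \<noteq> cl v" using cl(2) e uv(1) by simp
    have cross: "{Inl (a x), Inr (g y)} \<in> edges (edgeless_graph s \<otimes>\<^sub>G turan_graph (t * r) r)"
      if "x \<in> verts F" "y \<in> verts F" "cl x = 0" for x y
    proof -
      have "a x < s" using a(2) that by auto
      then show ?thesis using gl[OF that(2)]
        by (auto simp: graph_join_def edgeless_graph_def turan_graph_def)
    qed
    show ?thesis
    proof (cases "cl u = 0")
      case True
      then have "h ` e = {Inl (a u), Inr (g v)}" using ne uv(1) by (simp add: h_def insert_commute)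
      then show ?thesis using cross[OF uv(3,4) True] by simp
    next
      case u0: False
      show ?thesis
      proof (cases "cl v = 0")
        case True
        then have "h ` e = {Inl (a v), Inr (g u)}" using u0 uv(1) by (simp add: h_def insert_commute)
        then show ?thesis using cross[OF uv(4,3) True] by simp
      next
        case False
        have "g u mod r \<noteq> g v mod r" using gm(1) uv ne u0 False by simp
        then have "{g u, g v} \<in> edges (turan_graph (t * r) r)"
          using gl[OF uv(3)] gl[OF uv(4)] by (auto simp: turan_graph_def)
        then have "(Inr :: nat \<Rightarrow> nat + nat) ` {g u, g v} \<in> (\<lambda>e. Inr ` e) ` edges (turan_graph (t * r) r)" by (rule imageI)
        then have "Inr ` {g u, g v} \<in> edges (edgeless_graph s \<otimes>\<^sub>G turan_graph (t * r) r)"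
          by (simp add: graph_join_def graph_union_def del: image_insert)
        then show ?thesis using u0 False uv(1) by (simp add: h_def)
      qed
    qed
  qed
  ultimately show ?thesis unfolding has_copy_def by blast
qed

lemma copy_of_matching:
  assumes G: "simple_graph G" and M: "matching (edge_rel G) M" "card M = t" "0 < t"
  obtains f where "inj_on f (verts (graph_copies t (complete_graph 2)))"
    "f ` verts (graph_copies t (complete_graph 2)) \<subseteq> \<Union>M"
    "\<And>e. e \<in> edges (graph_copies t (complete_graph 2)) \<Longrightarrow> f ` e \<in> edges G"
proof -
  \<comment> \<open>Infinite sets have cardinality 0, which t > 0 excludes.\<close>
  have "finite M" using M(2,3) card_gt_0_iff by metis
  then obtain en where en: "bij_betw en {..<t} M" using obtain_bij_lessThan M(2) by blast
  have enM: "en i \<in> M" if "i < t" for i using en that by (auto simp: bij_betw_def)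
  have "\<forall>e\<in>M. \<exists>xy. e = {fst xy, snd xy} \<and> edge_rel G (fst xy) (snd xy)"
  proof
    fix e assume "e \<in> M"
    then obtain x y where "e = {x, y} \<and> edge_rel G x y" using M(1) unfolding matching_def by blast
    then show "\<exists>xy. e = {fst xy, snd xy} \<and> edge_rel G (fst xy) (snd xy)" by (intro exI[of _ "(x, y)"]) simp
  qed
  from bchoice[OF this] obtain xy where xy: "\<forall>e\<in>M. e = {fst (xy e), snd (xy e)} \<and> edge_rel G (fst (xy e)) (snd (xy e))" ..
  define f where "f = (\<lambda>(i, b :: nat). if b = 0 then fst (xy (en i)) else snd (xy (en i)))"
  have fen: "f (i, b) \<in> en i" if "i < t" for i b
  proof -
    have "en i = {fst (xy (en i)), snd (xy (en i))}" using xy enM[OF that] by blast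
    then show ?thesis unfolding f_def by auto
  qed
  have ne: "f (i, 0) \<noteq> f (i, Suc 0)" if "i < t" for i
  proof -
    have "edge_rel G (fst (xy (en i))) (snd (xy (en i)))" using xy enM[OF that] by blast
    then show ?thesis using adjacency.irrefl[OF adjacency_edge_rel[OF G]] by (auto simp: f_def)
  qed
  have vc: "verts (graph_copies t (complete_graph 2)) = {..<t} \<times> {..<2}"
    by (simp add: graph_copies_def complete_graph_def)
  show thesis
  proof (rule that[of f])
    show "inj_on f (verts (graph_copies t (complete_graph 2)))"
      unfolding vc
    proof (rule inj_onI)
      fix x y assume x: "x \<in> {..<t} \<times> {..<2}" and y: "y \<in> {..<t} \<times> {..<2}" and eq: "f x = f y"
      obtain i b where xi: "x = (i, b)" "i < t" "b < 2" using x by auto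
      obtain j c where yj: "y = (j, c)" "j < t" "c < 2" using y by auto
      have ij: "i = j"
      proof (rule ccontr)
        assume "i \<noteq> j"
        then have "en i \<noteq> en j" using en xi yj by (auto simp: bij_betw_def inj_on_def)
        then have "disjnt (en i) (en j)"
          using M(1) enM xi yj unfolding matching_def pairwise_def by blast
        then show False using fen[OF xi(2), of b] fen[OF yj(2), of c] eq xi yj by (auto simp: disjnt_def)
      qed
      have "b = 0 \<or> b = Suc 0" "c = 0 \<or> c = Suc 0" using xi(3) yj(3) by auto
      then have "b = c" using ne[OF xi(2)] eq xi(1) yj(1) ij by auto
      then show "x = y" using ij xi yj by simp
    qed
    show "f ` verts (graph_copies t (complete_graph 2)) \<subseteq> \<Union>M"
      unfolding vc using fen enM by fastforce
    show "f ` e \<in> edges G" if "e \<in> edges (graph_copies t (complete_graph 2))" for e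
    proof -
      obtain i a b where i: "i < t" "e = Pair i ` {a, b}" "a < 2" "b < 2" "a \<noteq> b"
        using \<open>e \<in> edges _\<close> unfolding graph_copies_def complete_graph_def by auto
      then have "{a, b} = {0, 1}" by auto
      then have "f ` e = {fst (xy (en i)), snd (xy (en i))}" unfolding i(2) f_def by simp
      moreover have "edge_rel G (fst (xy (en i))) (snd (xy (en i)))" using xy enM[OF i(1)] by blast
      ultimately show ?thesis by (simp add: edge_rel_def)
    qed
  qed
qed

lemma copy_of_stars:
  assumes G: "simple_graph G" and "finite Q" "card Q = p" "finite A0" "card A0 = t" "finite B0" "card B0 = t"
    "A0 \<inter> B0 = {}" "y \<notin> Q" "y \<notin> A0" "Q \<inter> B0 = {}"
    "\<And>x a. x \<in> Q \<Longrightarrow> a \<in> A0 \<Longrightarrow> edge_rel G x a" "\<And>b. b \<in> B0 \<Longrightarrow> edge_rel G y b"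
  obtains f where "inj_on f (verts (complete_bipartite p t \<uplus>\<^sub>G complete_bipartite 1 t))"
    "f ` verts (complete_bipartite p t \<uplus>\<^sub>G complete_bipartite 1 t) \<subseteq> Q \<union> A0 \<union> {y} \<union> B0"
    "\<And>e. e \<in> edges (complete_bipartite p t \<uplus>\<^sub>G complete_bipartite 1 t) \<Longrightarrow> f ` e \<in> edges G"
proof -
  interpret adjacency "edge_rel G" by (rule adjacency_edge_rel[OF G])
  obtain a where a: "bij_betw a {..<p} Q" using obtain_bij_lessThan[OF assms(2,3)] .
  obtain b where b: "bij_betw b {..<t} A0" using obtain_bij_lessThan[OF assms(4,5)] .
  obtain d where d: "bij_betw d {..<t} B0" using obtain_bij_lessThan[OF assms(6,7)] .
  \<comment> \<open>These two disjointness relations come from adjacency; the others are hypotheses,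
    since nothing is assumed about edges between the sets concerned.\<close>
  have QA: "Q \<inter> A0 = {}" using assms(12) irrefl by blast
  have yB: "y \<notin> B0" using assms(13) irrefl by blast
  have aQ: "a i \<in> Q" if "i < p" for i using a that by (auto simp: bij_betw_def)
  have bA: "b i \<in> A0" if "i < t" for i using b that by (auto simp: bij_betw_def)
  have dB: "d i \<in> B0" if "i < t" for i using d that by (auto simp: bij_betw_def)
  define f where "f = case_sum (case_sum a b) (case_sum (\<lambda>_ :: nat. y) d)"
  have vs: "verts (complete_bipartite p t \<uplus>\<^sub>G complete_bipartite 1 t) = ({..<p} <+> {..<t}) <+> ({..<1} <+> {..<t})"
    by (simp add: complete_bipartite_def graph_union_def graph_join_def edgeless_graph_def)
  have es: "edges (complete_bipartite p t \<uplus>\<^sub>G complete_bipartite 1 t) =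
      (`) Inl ` {{Inl u, Inr v} | u v. u < p \<and> v < t} \<union> (`) Inr ` {{Inl u, Inr v} | u v. u < 1 \<and> v < t}"
    by (simp add: complete_bipartite_def graph_union_def graph_join_def edgeless_graph_def)
  show thesis
  proof (rule that[of f])
    have im: "a ` {..<p} = Q" "b ` {..<t} = A0" "d ` {..<t} = B0"
      and inj: "inj_on a {..<p}" "inj_on b {..<t}" "inj_on d {..<t}"
      using a b d by (auto simp: bij_betw_def)
    have 1: "inj_on (case_sum a b) ({..<p} <+> {..<t})"
      by (rule inj_on_case_sum) (simp_all add: inj im QA)
    have 2: "inj_on (case_sum (\<lambda>_ :: nat. y) d) ({..<1} <+> {..<t})"
      by (rule inj_on_case_sum) (use yB im inj in \<open>auto simp: lessThan_Suc\<close>)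
    have 3: "case_sum a b ` ({..<p} <+> {..<t}) = Q \<union> A0"
      by (simp add: Plus_def image_Un image_image im)
    have 4: "case_sum (\<lambda>_ :: nat. y) d ` ({..<1} <+> {..<t}) = {y} \<union> B0"
      by (simp add: Plus_def image_Un image_image im lessThan_Suc)
    have 5: "(Q \<union> A0) \<inter> ({y} \<union> B0) = {}" using assms(8-11) by blast
    show "inj_on f (verts (complete_bipartite p t \<uplus>\<^sub>G complete_bipartite 1 t))"
      unfolding vs f_def by (rule inj_on_case_sum[OF 1 2]) (simp only: 3 4 5)
    show "f ` verts (complete_bipartite p t \<uplus>\<^sub>G complete_bipartite 1 t) \<subseteq> Q \<union> A0 \<union> {y} \<union> B0"
      unfolding vs using aQ bA dB by (auto simp: f_def)
    show "f ` e \<in> edges G" if "e \<in> edges (complete_bipartite p t \<uplus>\<^sub>G complete_bipartite 1 t)" for e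
    proof -
      consider (1) u v where "u < p" "v < t" "e = Inl ` {Inl u, Inr v}"
        | (2) u v where "u < 1" "v < t" "e = Inr ` {Inl u, Inr v}"
        using \<open>e \<in> edges _\<close> unfolding es by blast
      then show ?thesis
      proof cases
        case 1
        then show ?thesis using assms(12)[OF aQ bA, of u v] by (simp add: f_def edge_rel_def)
      next
        case 2
        then show ?thesis using assms(13)[OF dB, of v] by (simp add: f_def edge_rel_def)
      qed
    qed
  qed
qed

section \<open>The parameters of the family\<close>

locale graph_family =
  fixes \<F> :: "'a graph set" and r t q :: nat
  assumes fin: "finite \<F>" and nonempty: "\<F> \<noteq> {}" and simple: "\<And>F. F \<in> \<F> \<Longrightarrow> simple_graph F"
    and chi: "family_chi \<F> = r + 1" and r2: "2 \<le> r"
    and t_def: "t = family_order \<F>" and q_def: "q = family_q \<F>"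
begin

lemma card_verts_le: "F \<in> \<F> \<Longrightarrow> card (verts F) \<le> t"
  unfolding t_def family_order_def using fin by (intro Max_ge) auto

lemma not_colourable:
  assumes "F \<in> \<F>"
  shows "\<not> colourable r F"
proof
  assume "colourable r F"
  then have "chromatic_number F \<le> r" unfolding chromatic_number_def by (rule Least_le)
  moreover have "family_chi \<F> \<le> chromatic_number F"
    unfolding family_chi_def using fin assms by (intro Min_le) auto
  ultimately show False using chi by simp
qed

text \<open>If t = 0, all members would be empty graphs, which are
  \<open>r\<close>-colourable.\<close>

lemma t_pos: "1 \<le> t"
proof (rule ccontr)
  assume "\<not> 1 \<le> t"
  obtain F where F: "F \<in> \<F>" using nonempty by blast
  have "card (verts F) = 0" using card_verts_le[OF F] \<open>\<not> 1 \<le> t\<close> by linarith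
  then have "verts F = {}" using simple_graphD(1)[OF simple[OF F]] by simp
  moreover have "edges F = {}"
    using \<open>verts F = {}\<close> simple_graphD(2,3)[OF simple[OF F]] by fastforce
  ultimately have "colourable r F" by (simp add: colourable_def)
  then show False using not_colourable[OF F] by blast
qed

text \<open>\<open>chromatic_number\<close> is a \<open>LEAST\<close>, so some colouring must be
  exhibited before it is known to be attained; an enumeration of the vertices is one.\<close>

lemma exists_minimal_colouring: "\<exists>F\<in>\<F>. colourable (r + 1) F"
proof -
  have "family_chi \<F> \<in> chromatic_number ` \<F>"
    unfolding family_chi_def using fin nonempty by (intro Min_in) auto
  then obtain F where F: "F \<in> \<F>" "chromatic_number F = r + 1" using chi by auto
  note finF = simple_graphD(1)[OF simple[OF F(1)]]
  obtain c where c: "bij_betw c (verts F) {0..<card (verts F)}"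
    using ex_bij_betw_finite_nat[OF finF] by blast
  have "colourable (card (verts F)) F"
    unfolding colourable_def
  proof (intro exI[of _ c] conjI allI impI)
    show "c ` verts F \<subseteq> {..<card (verts F)}" using c by (auto simp: bij_betw_def)
    fix u v assume "{u, v} \<in> edges F"
    then have "edge_rel F u v" by (simp add: edge_rel_def)
    then have "u \<in> verts F" "v \<in> verts F" "u \<noteq> v"
      using edge_rel_verts[OF simple[OF F(1)]] adjacency.irrefl[OF adjacency_edge_rel[OF simple[OF F(1)]]] by blast+
    then show "c u \<noteq> c v" using c by (auto simp: bij_betw_def inj_on_def)
  qed
  then have "colourable (chromatic_number F) F" unfolding chromatic_number_def by (rule LeastI)
  then show ?thesis using F by auto
qed

lemma q_eq: "q = (LEAST s. \<exists>F\<in>\<F>. F \<subseteq>\<^sub>G edgeless_graph s \<otimes>\<^sub>G turan_graph (t * r) r)"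
  unfolding q_def family_q_def Let_def chi t_def by simp

lemma q_attained: "\<exists>F\<in>\<F>. F \<subseteq>\<^sub>G edgeless_graph q \<otimes>\<^sub>G turan_graph (t * r) r"
proof -
  obtain F where F: "F \<in> \<F>" "colourable (r + 1) F" using exists_minimal_colouring by blast
  then obtain c where c: "c ` verts F \<subseteq> {..<r + 1}" "\<And>u v. {u, v} \<in> edges F \<Longrightarrow> c u \<noteq> c v"
    unfolding colourable_def by blast
  have "F \<subseteq>\<^sub>G edgeless_graph (card (verts F)) \<otimes>\<^sub>G turan_graph (t * r) r"
  proof (rule copy_in_join_turan_of_classes[OF simple[OF F(1)] card_verts_le[OF F(1)], of _ c])
    show "card {x \<in> verts F. c x = 0} \<le> card (verts F)"
      using simple_graphD(1)[OF simple[OF F(1)]] by (intro card_mono) auto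
  qed (use r2 c in \<open>auto simp: image_subset_iff less_Suc_eq_le\<close>)
  then have "\<exists>F\<in>\<F>. F \<subseteq>\<^sub>G edgeless_graph (card (verts F)) \<otimes>\<^sub>G turan_graph (t * r) r" using F(1) by blast
  then have "\<exists>s. \<exists>F\<in>\<F>. F \<subseteq>\<^sub>G edgeless_graph s \<otimes>\<^sub>G turan_graph (t * r) r" by blast
  then show ?thesis unfolding q_eq by (rule LeastI_ex)
qed

lemma q_minimal:
  assumes "F \<in> \<F>" "F \<subseteq>\<^sub>G edgeless_graph s \<otimes>\<^sub>G turan_graph (t * r) r"
  shows "q \<le> s"
  unfolding q_eq by (rule Least_le) (use assms in blast)

text \<open>Without the edgeless factor a member would embed into a graph coloured by residues
  modulo \<open>r\<close>, against the minimal chromatic number r + 1.\<close>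

lemma q_pos: "1 \<le> q"
proof (rule ccontr)
  assume "\<not> 1 \<le> q"
  then have "q = 0" by simp
  then obtain F where F: "F \<in> \<F>" "F \<subseteq>\<^sub>G edgeless_graph 0 \<otimes>\<^sub>G turan_graph (t * r) r"
    using q_attained by blast
  obtain h where h: "inj_on h (verts F)" "h ` verts F \<subseteq> verts (edgeless_graph 0 \<otimes>\<^sub>G turan_graph (t * r) r)"
    "\<And>e. e \<in> edges F \<Longrightarrow> h ` e \<in> edges (edgeless_graph 0 \<otimes>\<^sub>G turan_graph (t * r) r)"
    by (rule has_copyE[OF F(2)], rule that)
  \<comment> \<open>The value 0 on the left summand is a dummy, as \<open>edgeless_graph 0\<close>
    has no vertices.\<close>
  define c where "c x = (case h x of Inl _ \<Rightarrow> 0 | Inr i \<Rightarrow> i mod r)" for x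
  have "colourable r F"
    unfolding colourable_def
  proof (intro exI[of _ c] conjI allI impI)
    show "c ` verts F \<subseteq> {..<r}" using r2 by (auto simp: c_def split: sum.splits)
    fix u v assume "{u, v} \<in> edges F"
    from h(3)[OF this] obtain i j where ij: "h ` {u, v} = {Inr i, Inr j}" "i mod r \<noteq> j mod r"
      by (auto simp: graph_join_def graph_union_def edgeless_graph_def turan_graph_def)
    then have "(h u = Inr i \<and> h v = Inr j) \<or> (h u = Inr j \<and> h v = Inr i)" by (auto simp: doubleton_eq_iff)
    then show "c u \<noteq> c v" using ij(2) by (auto simp: c_def)
  qed
  then show False using not_colourable[OF F(1)] by blast
qed

end

section \<open>Extremal graphs satisfy the assumptions of \<open>extremal_config\<close>\<close>

locale extremal_graph = graph_family \<F> r t q for \<F> :: "'a graph set" and r t q +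
  fixes G :: "'b graph" and n :: nat
  assumes extremal: "G \<in> extremal_graphs n \<F>"
    and F1: "\<exists>F1\<in>\<F>. F1 \<subseteq>\<^sub>G graph_copies t (complete_graph 2) \<otimes>\<^sub>G turan_graph (t * (r - 1)) (r - 1)"
    and F2: "\<exists>F2\<in>\<F>. F2 \<subseteq>\<^sub>G (complete_bipartite (q - 1) t \<uplus>\<^sub>G complete_bipartite 1 t)
                        \<otimes>\<^sub>G turan_graph (t * (r - 1)) (r - 1)"
begin

abbreviation "adj \<equiv> edge_rel G"

lemma simpleG: "simple_graph G" and cardG: "card (verts G) = n" and freeG: "F \<in> \<F> \<Longrightarrow> \<not> F \<subseteq>\<^sub>G G"
  and maxG: "simple_graph H \<Longrightarrow> card (verts H) = n \<Longrightarrow> family_free \<F> H \<Longrightarrow> card (edges H) \<le> card (edges G)"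
  for H :: "'b graph"
  using extremal by (auto simp: extremal_graphs_def family_free_def)

lemma adjG: "adjacency adj"
  by (rule adjacency_edge_rel[OF simpleG])

lemma finV: "finite (verts G)"
  by (rule simple_graphD(1)[OF simpleG])

lemma no_matching_joinG: "no_matching_join adj r t (verts G)"
  unfolding no_matching_join_def
proof (intro allI impI notI)
  fix M :: "'b set set" and J :: "nat set" and A
  assume M: "matching adj M" "card M = t" "\<Union>M \<subseteq> verts G"
    and J: "finite J" "card J = r - 1" and A: "blocks adj t J A" "\<forall>j\<in>J. A j \<subseteq> verts G"
    and join: "\<forall>j\<in>J. \<forall>x\<in>\<Union>M. \<forall>y\<in>A j. adj x y"
  have "0 < t" using t_pos by simp
  then obtain f where f: "inj_on f (verts (graph_copies t (complete_graph 2)))"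
    "f ` verts (graph_copies t (complete_graph 2)) \<subseteq> \<Union>M"
    "\<And>e. e \<in> edges (graph_copies t (complete_graph 2)) \<Longrightarrow> f ` e \<in> edges G"
    using copy_of_matching[OF simpleG M(1,2)] by blast
  have "graph_copies t (complete_graph 2) \<otimes>\<^sub>G turan_graph (t * (r - 1)) (r - 1) \<subseteq>\<^sub>G G"
  proof (rule copy_of_join_turan[OF simpleG f(1) subset_trans[OF f(2) M(3)] f(3) J A(1)])
    show "A j \<subseteq> verts G" if "j \<in> J" for j using A(2) that by blast
    show "adj x a" if "j \<in> J" "x \<in> f ` verts (graph_copies t (complete_graph 2))" "a \<in> A j" for j x a
      using join that f(2) by (meson subsetD)
  qed
  then show False using F1 freeG has_copy_trans by metis
qed

lemma no_starG:
  fixes J :: "nat set"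
  assumes "Q \<subseteq> verts G" "card Q = q - 1" "A0 \<subseteq> verts G" "card A0 = t" "y \<in> verts G" "B0 \<subseteq> verts G" "card B0 = t"
    "A0 \<inter> B0 = {}" "y \<notin> Q" "y \<notin> A0" "Q \<inter> B0 = {}"
    "\<And>x a. x \<in> Q \<Longrightarrow> a \<in> A0 \<Longrightarrow> adj x a" "\<And>b. b \<in> B0 \<Longrightarrow> adj y b"
    "finite J" "card J = r - 1" "blocks adj t J A" "\<And>j. j \<in> J \<Longrightarrow> A j \<subseteq> verts G"
    "\<And>j a x. j \<in> J \<Longrightarrow> a \<in> A j \<Longrightarrow> x \<in> Q \<union> A0 \<union> {y} \<union> B0 \<Longrightarrow> adj x a"
  shows False
proof -
  have finQ: "finite Q" "finite A0" "finite B0" using assms(1,3,6) finV finite_subset by blast+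
  obtain f where f: "inj_on f (verts (complete_bipartite (q - 1) t \<uplus>\<^sub>G complete_bipartite 1 t))"
    "f ` verts (complete_bipartite (q - 1) t \<uplus>\<^sub>G complete_bipartite 1 t) \<subseteq> Q \<union> A0 \<union> {y} \<union> B0"
    "\<And>e. e \<in> edges (complete_bipartite (q - 1) t \<uplus>\<^sub>G complete_bipartite 1 t) \<Longrightarrow> f ` e \<in> edges G"
    by (rule copy_of_stars[OF simpleG finQ(1) assms(2) finQ(2) assms(4) finQ(3) assms(7-13)]) blast+
  have "(complete_bipartite (q - 1) t \<uplus>\<^sub>G complete_bipartite 1 t) \<otimes>\<^sub>G turan_graph (t * (r - 1)) (r - 1) \<subseteq>\<^sub>G G"
  proof (rule copy_of_join_turan[OF simpleG f(1) _ f(3) assms(14-17)])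
    show "f ` verts (complete_bipartite (q - 1) t \<uplus>\<^sub>G complete_bipartite 1 t) \<subseteq> verts G"
      using assms(1,3,5,6) by (intro subset_trans[OF f(2)]) simp
    show "adj x a" if "j \<in> J" "x \<in> f ` verts (complete_bipartite (q - 1) t \<uplus>\<^sub>G complete_bipartite 1 t)" "a \<in> A j" for j x a
      using assms(18)[OF that(1,3)] subsetD[OF f(2) that(2)] by blast
  qed
  then show False using F2 freeG has_copy_trans by metis
qed

lemma no_independentG:
  fixes J :: "nat set"
  assumes "Q \<subseteq> verts G" "card Q = q" "finite J" "card J = r" "blocks adj t J A" "\<And>j. j \<in> J \<Longrightarrow> A j \<subseteq> verts G"
    "\<And>j a x. j \<in> J \<Longrightarrow> a \<in> A j \<Longrightarrow> x \<in> Q \<Longrightarrow> adj x a"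
  shows False
proof -
  have "finite Q" using assms(1) finV finite_subset by blast
  then obtain f where f: "bij_betw f {..<q} Q" using assms(2) by (rule obtain_bij_lessThan)
  then have f': "inj_on f (verts (edgeless_graph q))" "f ` verts (edgeless_graph q) = Q"
    by (simp_all add: bij_betw_def edgeless_graph_def)
  have "edgeless_graph q \<otimes>\<^sub>G turan_graph (t * r) r \<subseteq>\<^sub>G G"
    by (rule copy_of_join_turan[OF simpleG f'(1) _ _ assms(3-6)])
      (use f'(2) assms(1,7) in \<open>auto simp: edgeless_graph_def\<close>)
  then show False using q_attained freeG has_copy_trans by metis
qed

text \<open>The competitor \<open>H\<close> is complete multipartite with classes \<open>W\<close>
  and \<open>P i\<close>. A copy of a member in \<open>H\<close> uses at most q - 1 vertices of
  \<open>W\<close> and so embeds into the graph that defines \<open>q\<close>, with q - 1 in place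
  of \<open>q\<close>, contrary to minimality.\<close>

lemma partition_boundG:
  assumes W: "W \<subseteq> verts G" "card W = q - 1" and P: "disjoint_family_on P {1..r}" "(\<Union>i\<in>{1..r}. P i) = verts G - W"
  shows "2 * (q - 1) * card (verts G - W) + (card (verts G - W))\<^sup>2
    \<le> degsum adj (verts G) + (\<Sum>i\<in>{1..r}. (card (P i))\<^sup>2)"
proof -
  define V where "V = verts G"
  note finV = finV[folded V_def]
  have WV: "W \<subseteq> V" using W(1) by (simp add: V_def)
  have UP: "(\<Union>i\<in>{1..r}. P i) = V - W" using P(2) by (simp add: V_def)
  have PV: "P i \<subseteq> V - W" if "i \<in> {1..r}" for i using UP that by blast
  have finP: "finite (P i)" if "i \<in> {1..r}" for i using PV[OF that] finV finite_subset by blast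
  have finW: "finite W" using WV finV finite_subset by blast
  \<comment> \<open>Class 0 is reserved for \<open>W\<close>, as required by
    \<open>copy_in_join_turan_of_classes\<close>.\<close>
  define cl where "cl x = (if x \<in> W then 0 else THE i. i \<in> {1..r} \<and> x \<in> P i)" for x
  have clP: "cl x = i" if "i \<in> {1..r}" "x \<in> P i" for x i
  proof -
    have "x \<notin> W" using PV[OF that(1)] that(2) by blast
    moreover have "(THE i. i \<in> {1..r} \<and> x \<in> P i) = i"
      using P(1) that unfolding disjoint_family_on_def by (intro the_equality) blast+
    ultimately show ?thesis by (simp add: cl_def)
  qed
  have clW: "cl x = 0" if "x \<in> W" for x using that by (simp add: cl_def)
  have cases: "x \<in> W \<or> (\<exists>i\<in>{1..r}. x \<in> P i)" if "x \<in> V" for x using UP that by blast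
  define H where "H = \<lparr>verts = V, edges = {{x, y} | x y. x \<in> V \<and> y \<in> V \<and> cl x \<noteq> cl y}\<rparr>"
  have relH: "edge_rel H x y \<longleftrightarrow> x \<in> V \<and> y \<in> V \<and> cl x \<noteq> cl y" for x y
    by (auto simp: edge_rel_def H_def doubleton_eq_iff)
  have simpleH: "simple_graph H"
    unfolding simple_graph_def using finV by (auto simp: H_def card_insert_if)
  have "family_free \<F> H"
    unfolding family_free_def
  proof (intro ballI notI)
    fix F assume F: "F \<in> \<F>" "F \<subseteq>\<^sub>G H"
    obtain f where f: "inj_on f (verts F)" "f ` verts F \<subseteq> verts H" "\<And>e. e \<in> edges F \<Longrightarrow> f ` e \<in> edges H"
      by (rule has_copyE[OF F(2)], rule that)
    have fV: "f x \<in> V" if "x \<in> verts F" for x using f(2) that by (auto simp: H_def)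
    have "F \<subseteq>\<^sub>G edgeless_graph (q - 1) \<otimes>\<^sub>G turan_graph (t * r) r"
    proof (rule copy_in_join_turan_of_classes[OF simple[OF F(1)] card_verts_le[OF F(1)], of _ "\<lambda>x. cl (f x)"])
      show "0 < r" using r2 by simp
      show "cl (f x) \<le> r" if "x \<in> verts F" for x
        using cases[OF fV[OF that]] clP clW by fastforce
      show "cl (f u) \<noteq> cl (f v)" if "{u, v} \<in> edges F" for u v
      proof -
        have "edge_rel H (f u) (f v)" using f(3)[OF that] by (simp add: edge_rel_def)
        then show ?thesis by (simp add: relH)
      qed
      have "f ` {x \<in> verts F. cl (f x) = 0} \<subseteq> W"
      proof
        fix y assume "y \<in> f ` {x \<in> verts F. cl (f x) = 0}"
        then have "y \<in> V" "cl y = 0" using fV by auto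
        then show "y \<in> W" using cases[of y] clP by fastforce
      qed
      then have "card (f ` {x \<in> verts F. cl (f x) = 0}) \<le> q - 1"
        using card_mono[OF finW] W(2) by metis
      moreover have "inj_on f {x \<in> verts F. cl (f x) = 0}" using f(1) by (rule inj_on_subset) blast
      ultimately show "card {x \<in> verts F. cl (f x) = 0} \<le> q - 1" by (simp add: card_image)
    qed
    then have "q \<le> q - 1" by (rule q_minimal[OF F(1)])
    then show False using q_pos by simp
  qed
  moreover have "card (verts H) = n" using cardG by (simp add: H_def V_def)
  ultimately have "card (edges H) \<le> card (edges G)" using simpleH by (intro maxG)
  then have le: "degsum (edge_rel H) V \<le> degsum adj V"
    using handshake[OF simpleH] handshake[OF simpleG] by (simp add: H_def V_def)
  define N where "N = card (V - W)"
  have cVW: "card V = (q - 1) + N"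
    using card_Diff_subset[OF finW WV] card_mono[OF finV WV] W(2) by (simp add: N_def)
  have sumP: "(\<Sum>i\<in>{1..r}. card (P i)) = N"
    unfolding N_def UP[symmetric] using finP P(1) unfolding disjoint_family_on_def
    by (intro card_UN_disjoint[symmetric]) auto
  have dW: "card (nbh (edge_rel H) V x) = N" if x: "x \<in> W" for x
  proof -
    have "nbh (edge_rel H) V x = V - W"
    proof
      show "nbh (edge_rel H) V x \<subseteq> V - W" using clW[OF x] clW by (auto simp: nbh_def relH)
      show "V - W \<subseteq> nbh (edge_rel H) V x"
        using cases clP clW[OF x] x WV by (fastforce simp: nbh_def relH)
    qed
    then show ?thesis by (simp add: N_def)
  qed
  have dP: "card (nbh (edge_rel H) V x) + card (P i) = card V" if i: "i \<in> {1..r}" and x: "x \<in> P i" for i x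
  proof -
    have "nbh (edge_rel H) V x = V - P i"
    proof
      show "nbh (edge_rel H) V x \<subseteq> V - P i" using clP[OF i] x by (auto simp: nbh_def relH)
      show "V - P i \<subseteq> nbh (edge_rel H) V x"
      proof
        fix y assume y: "y \<in> V - P i"
        have "cl y \<noteq> i"
        proof (cases "y \<in> W")
          case True
          then show ?thesis using clW i by auto
        next
          case False
          then obtain j where "j \<in> {1..r}" "y \<in> P j" using cases y by blast
          then show ?thesis using clP y by auto
        qed
        then show "y \<in> nbh (edge_rel H) V x" using y clP[OF i x] PV[OF i] x by (auto simp: nbh_def relH)
      qed
    qed
    moreover have "P i \<subseteq> V" using PV[OF i] by blast
    ultimately show ?thesis
      using card_Diff_subset[OF finP[OF i]] card_mono[OF finV] by simp
  qed
  have "degsum (edge_rel H) V = (\<Sum>x\<in>W. card (nbh (edge_rel H) V x)) + (\<Sum>x\<in>V - W. card (nbh (edge_rel H) V x))"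
    unfolding degsum_def using finV WV by (simp add: sum.subset_diff add.commute)
  also have "(\<Sum>x\<in>W. card (nbh (edge_rel H) V x)) = (q - 1) * N" using dW W(2) by simp
  also have "(\<Sum>x\<in>V - W. card (nbh (edge_rel H) V x)) = (\<Sum>i\<in>{1..r}. \<Sum>x\<in>P i. card (nbh (edge_rel H) V x))"
    unfolding UP[symmetric] using finP P(1) unfolding disjoint_family_on_def
    by (intro sum.UNION_disjoint) auto
  finally have "degsum (edge_rel H) V + (\<Sum>i\<in>{1..r}. \<Sum>x\<in>P i. card (P i)) =
      (q - 1) * N + (\<Sum>i\<in>{1..r}. \<Sum>x\<in>P i. card (nbh (edge_rel H) V x) + card (P i))"
    by (simp only: sum.distrib)
  also have "(\<Sum>i\<in>{1..r}. \<Sum>x\<in>P i. card (nbh (edge_rel H) V x) + card (P i)) = (\<Sum>i\<in>{1..r}. \<Sum>x\<in>P i. card V)"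
    using dP by (intro sum.cong refl)
  also have "\<dots> = N * card V" using sumP by (simp add: sum_distrib_right[symmetric])
  also have "(q - 1) * N + N * card V = 2 * (q - 1) * N + N\<^sup>2"
    unfolding cVW by (simp add: power2_eq_square algebra_simps)
  finally have "degsum (edge_rel H) V + (\<Sum>i\<in>{1..r}. (card (P i))\<^sup>2) = 2 * (q - 1) * N + N\<^sup>2"
    by (simp add: power2_eq_square)
  then show ?thesis using le by (simp add: V_def N_def)
qed

text \<open>If \<open>u\<close> is given the common neighbourhood of \<open>T\<close>, a copy of \<open>F\<close> using \<open>u\<close> misses some \<open>v \<in> T\<close> since \<open>|F| \<le> t\<close>, and
  replacing \<open>u\<close> by \<open>v\<close> yields a copy in \<open>G\<close>.\<close>

lemma clone_boundG:
  assumes u: "u \<in> verts G" and T: "T \<subseteq> verts G - {u}" "card T = t"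
  shows "card {w\<in>verts G - {u}. \<forall>v\<in>T. adj v w} \<le> card (nbh adj (verts G) u)"
proof -
  interpret adjacency adj by (rule adjG)
  define N' where "N' = {w\<in>verts G - {u}. \<forall>v\<in>T. adj v w}"
  define E1 where "E1 = {e\<in>edges G. u \<notin> e}"
  define E2 where "E2 = (\<lambda>w. {u, w}) ` N'"
  define H where "H = \<lparr>verts = verts G, edges = E1 \<union> E2\<rparr>"
  have finE: "finite (edges G)" by (rule finite_edges[OF simpleG])
  have finN: "finite N'" using finV by (simp add: N'_def)
  have simpleH: "simple_graph H"
    unfolding simple_graph_def
  proof (intro conjI ballI)
    show "finite (verts H)" using finV by (simp add: H_def)
    fix e assume "e \<in> edges H"
    then consider "e \<in> edges G" | w where "w \<in> N'" "e = {u, w}" by (auto simp: H_def E1_def E2_def)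
    then have "e \<subseteq> verts G \<and> card e = 2"
    proof cases
      case 1
      then show ?thesis using simple_graphD(2,3)[OF simpleG] by blast
    next
      case 2
      then show ?thesis using u by (auto simp: N'_def)
    qed
    then show "e \<subseteq> verts H" "card e = 2" by (simp_all add: H_def)
  qed
  have "family_free \<F> H"
    unfolding family_free_def
  proof (intro ballI notI)
    fix F assume F: "F \<in> \<F>" "F \<subseteq>\<^sub>G H"
    note sF = simple[OF F(1)]
    obtain f where f: "inj_on f (verts F)" "f ` verts F \<subseteq> verts H" "\<And>e. e \<in> edges F \<Longrightarrow> f ` e \<in> edges H"
      by (rule has_copyE[OF F(2)], rule that)
    have fV: "f ` verts F \<subseteq> verts G" using f(2) by (simp add: H_def)
    have "F \<subseteq>\<^sub>G G"
    proof (cases "u \<in> f ` verts F")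
      case False
      have "f ` e \<in> edges G" if e: "e \<in> edges F" for e
      proof -
        have "u \<notin> f ` e" using simple_graphD(2)[OF sF e] False by blast
        then show ?thesis using f(3)[OF e] by (auto simp: H_def E1_def E2_def)
      qed
      then show ?thesis unfolding has_copy_def using f(1) fV by (intro exI[of _ f]) simp
    next
      case True
      then obtain x0 where x0: "x0 \<in> verts F" "f x0 = u" by blast
      note finF = simple_graphD(1)[OF sF]
      have "\<not> T \<subseteq> f ` (verts F - {x0})"
      proof
        assume "T \<subseteq> f ` (verts F - {x0})"
        then have "card T \<le> card (f ` (verts F - {x0}))" using finF by (intro card_mono) auto
        also have "\<dots> \<le> card (verts F - {x0})" using finF by (intro card_image_le) auto
        also have "\<dots> < card (verts F)" by (rule card_Diff1_less[OF finF x0(1)])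
        finally show False using T(2) card_verts_le[OF F(1)] by simp
      qed
      then obtain v where v: "v \<in> T" "v \<notin> f ` (verts F - {x0})" by blast
      define f' where "f' = f(x0 := v)"
      have "inj_on f' (verts F)"
      proof (rule inj_onI)
        fix x y assume xy: "x \<in> verts F" "y \<in> verts F" "f' x = f' y"
        show "x = y"
        proof (rule ccontr)
          assume "x \<noteq> y"
          then show False using xy v(2) inj_onD[OF f(1), of x y] by (auto simp: f'_def split: if_splits)
        qed
      qed
      moreover have "f' ` verts F \<subseteq> verts G" using fV v(1) T(1) by (auto simp: f'_def)
      moreover have "f' ` e \<in> edges G" if e: "e \<in> edges F" for e
      proof (cases "x0 \<in> e")
        case False
        have "u \<notin> f ` e"
        proof
          assume "u \<in> f ` e"
          then obtain y where y: "y \<in> e" "f y = u" by blast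
          then have "y = x0" using inj_onD[OF f(1), of y x0] x0 simple_graphD(2)[OF sF e] by auto
          then show False using y False by simp
        qed
        then have "f ` e \<in> edges G" using f(3)[OF e] by (auto simp: H_def E1_def E2_def)
        moreover have "f' ` e = f ` e" using False by (intro image_cong) (auto simp: f'_def)
        ultimately show ?thesis by simp
      next
        case True
        obtain a b where ab: "e = {a, b}" "a \<noteq> b" "a \<in> verts F" "b \<in> verts F" by (rule simple_graph_edgeE[OF sF e])
        define y where "y = (if a = x0 then b else a)"
        have y: "e = {x0, y}" "y \<noteq> x0" using ab True by (auto simp: y_def)
        then have "f ` e = {u, f y}" using x0 by simp
        then have "{u, f y} \<in> edges H" using f(3)[OF e] by simp
        then have "f y \<in> N'" by (auto simp: H_def E1_def E2_def doubleton_eq_iff N'_def)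
        then have "adj v (f y)" using v(1) by (simp add: N'_def)
        then show ?thesis using y by (simp add: f'_def edge_rel_def insert_commute)
      qed
      ultimately show ?thesis unfolding has_copy_def by (intro exI[of _ f']) simp
    qed
    then show False using freeG[OF F(1)] by blast
  qed
  moreover have "card (verts H) = n" using cardG by (simp add: H_def)
  ultimately have le: "card (edges H) \<le> card (edges G)" using simpleH by (intro maxG)
  have "card (edges H) = card E1 + card E2"
    unfolding H_def graph.simps using finE finN
    by (intro card_Un_disjoint) (auto simp: E1_def E2_def)
  also have "card E2 = card N'"
    unfolding E2_def by (intro card_image inj_onI) (auto simp: doubleton_eq_iff)
  finally have 1: "card (edges H) = card E1 + card N'" .
  have "card (edges G) = card E1 + card {e\<in>edges G. u \<in> e}"
  proof -
    have "edges G = E1 \<union> {e\<in>edges G. u \<in> e}" by (auto simp: E1_def)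
    moreover have "card (E1 \<union> {e\<in>edges G. u \<in> e}) = card E1 + card {e\<in>edges G. u \<in> e}"
      using finE by (intro card_Un_disjoint) (auto simp: E1_def)
    ultimately show ?thesis by simp
  qed
  then show ?thesis using 1 le card_incident_edges[OF simpleG, of u] by (simp add: N'_def)
qed

lemma extremal_configG: "extremal_config adj (verts G) r t q"
proof -
  interpret adjacency adj by (rule adjG)
  show ?thesis
  proof
    show "finite (verts G)" by (rule finV)
    show "2 \<le> r" "1 \<le> t" "1 \<le> q" by (rule r2 t_pos q_pos)+
    show "no_matching_join adj r t (verts G)" by (rule no_matching_joinG)
  qed (fact no_starG no_independentG partition_boundG clone_boundG)+
qed

end

theorem theorem1p3:
  fixes \<F> :: "'a graph set" and r t q :: nat
  assumes "finite \<F>" and "\<F> \<noteq> {}" and "\<And>F. F \<in> \<F> \<Longrightarrow> simple_graph F"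
    and "family_chi \<F> = r + 1" and "r + 1 \<ge> 3"
    and "t = family_order \<F>" and "q = family_q \<F>"
    and "\<exists>F1\<in>\<F>. F1 \<subseteq>\<^sub>G graph_copies t (complete_graph 2) \<otimes>\<^sub>G turan_graph (t * (r - 1)) (r - 1)"
    and "\<exists>F2\<in>\<F>. F2 \<subseteq>\<^sub>G (complete_bipartite (q - 1) t \<uplus>\<^sub>G complete_bipartite 1 t)
                        \<otimes>\<^sub>G turan_graph (t * (r - 1)) (r - 1)"
  shows "\<forall>\<^sub>F n in sequentially. \<forall>G :: 'b graph. G \<in> extremal_graphs n \<F> \<longrightarrow>
    (\<exists>W S. verts G = W \<union> (\<Union>i\<in>{1..r}. S i) \<and>
       disjoint_family_on S {1..r} \<and> (\<forall>i\<in>{1..r}. W \<inter> S i = {}) \<and>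
       card W = q - 1 \<and>
       (\<forall>i\<in>{1..r}. int (card (S i)) \<in>
          {\<lfloor>(real n - real q + 1) / real r\<rfloor>, \<lceil>(real n - real q + 1) / real r\<rceil>}) \<and>
       (\<forall>i\<in>{1..r}. \<exists>S'\<subseteq>S i. card (S i - S') \<le> t\<^sup>2 \<and>
          (\<forall>v\<in>S'. neighbourhood G v = verts G - S i)))"
proof -
  have fam: "graph_family \<F> r t q" using assms by unfold_locales auto
  interpret graph_family \<F> r t q by (rule fam)
  obtain N where N: "\<forall>(adj :: 'b \<Rightarrow> 'b \<Rightarrow> bool) V. extremal_config adj V r t q \<longrightarrow> N \<le> card V \<longrightarrow>
    (\<exists>W S. V = W \<union> (\<Union>i\<in>{1..r}. S i) \<and> disjoint_family_on S {1..r} \<and> (\<forall>i\<in>{1..r}. W \<inter> S i = {}) \<and>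
     card W = q - 1 \<and>
     (\<forall>i\<in>{1..r}. int (card (S i)) \<in> {\<lfloor>(real (card V) - real q + 1) / r\<rfloor>, \<lceil>(real (card V) - real q + 1) / r\<rceil>}) \<and>
     (\<forall>i\<in>{1..r}. \<exists>S'\<subseteq>S i. card (S i - S') \<le> t\<^sup>2 \<and> (\<forall>v\<in>S'. nbh adj V v = V - S i)))"
    by (rule exE[OF extremal_config_structure[OF r2 t_pos q_pos, where 'b = 'b]])
  show ?thesis
    unfolding eventually_sequentially
  proof (intro exI[of _ N] allI impI)
    fix n and G :: "'b graph"
    assume n: "N \<le> n" and G: "G \<in> extremal_graphs n \<F>"
    interpret extremal_graph \<F> r t q G n
      using fam G assms(8,9) by (simp add: extremal_graph_def extremal_graph_axioms_def)
    show "\<exists>W S. verts G = W \<union> (\<Union>i\<in>{1..r}. S i) \<and>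
       disjoint_family_on S {1..r} \<and> (\<forall>i\<in>{1..r}. W \<inter> S i = {}) \<and>
       card W = q - 1 \<and>
       (\<forall>i\<in>{1..r}. int (card (S i)) \<in>
          {\<lfloor>(real n - real q + 1) / real r\<rfloor>, \<lceil>(real n - real q + 1) / real r\<rceil>}) \<and>
       (\<forall>i\<in>{1..r}. \<exists>S'\<subseteq>S i. card (S i - S') \<le> t\<^sup>2 \<and>
          (\<forall>v\<in>S'. neighbourhood G v = verts G - S i))"
      unfolding neighbourhood_eq_nbh[OF simpleG] cardG[symmetric]
      by (rule N[THEN spec, THEN spec, THEN mp, THEN mp, OF extremal_configG]) (use n cardG in simp)
  qed
qed

end
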